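(* Let $N,d\ge 1$ and let $G=(V,E)$, $V=\{1,\dots,N\}$, be an undirected connected simple graph, with $\Omega_n=\{\ell\in V : (n,\ell)\in E\}$ the set of neighbors of node $n$. For $n=1,\dots,N$ let $f_n:\mathbb{R}^d\to\mathbb{R}$ be of class $C^2$, coercive, and with Lipschitz continuous gradient $\nabla f_n$, and let $f=\sum_{n=1}^N f_n$. Let $\alpha_t=(t+1)^{-\tau_\alpha}$ and $\beta_t=(t+1)^{-\tau_\beta}$ with $0\le \tau_\beta<\tau_\alpha\le 1$. Consider the system $$\dot{\mathbf{x}}_n(t)=\beta_t\sum_{\ell\in\Omega_n}(\mathbf{x}_\ell(t)-\mathbf{x}_n(t))-\alpha_t\nabla f_n(\mathbf{x}_n(t)),\qquad n=1,\dots,N.$$ Let $x^*\in\mathbb{R}^d$ be a nondegenerate saddle point of $f$, and let $p$ denote the number of negative eigenvalues (with multiplicity) of the Hessian $\nabla^2 f(x^* )$. Then for all $t_0$ sufficiently large there exists a manifold $S\subset\mathbb{R}^{Nd}$ of dimension $Nd-p$ such that the following holds: a solution $(\mathbf{x}_n(t))_{n=1}^N$ of the system converges to $x^*$, in the sense that $\mathbf{x}_n(t)\to x^*$ as $t\to\infty$ for some $n$, if and only if it is initialized on $S$ at time $t_0$, i.e., $(\mathbf{x}_n(t_0))_{n=1}^N=x_0$ with $x_0\in S$.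
   Context: A nondegenerate saddle point of $f$ is a critical point $x^*$ of $f$ (i.e. $\nabla f(x^* )=0$) such that the Hessian $\nabla^2 f(x^* )$ is nonsingular and has at least one positive and at least one negative eigenvalue; in particular $p\ge 1$. "A manifold $S$ of dimension $Nd-p$" means that $S$ is the graph of a continuous function defined on an $(Nd-p)$-dimensional domain (no smoothness of $S$ is claimed). A solution is a $C^1$ map $t\mapsto(\mathbf{x}_n(t))_{n=1}^N\in\mathbb{R}^{Nd}$ satisfying the system for all $t$ (under the Lipschitz gradient hypothesis solutions exist and are unique). A function $g:\mathbb{R}^d\to\mathbb{R}$ is coercive if $g(x)\to\infty$ as $\|x\|\to\infty$.
   Formalization: "Manifold S of dimension Nd-p" is taken as nonempty and, near each of its points, the graph of a continuous function on an (Nd-p)-dimensional domain, not one graph globally; the full stable set can spiral (e.g. N=1, d=2), so a single global graph need not exist. *)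

theory Defs
  imports "HOL-Analysis.Analysis"
begin

subsection \<open>Gradients, Hessians and eigenvalues\<close>

definition grad :: "(real ^ 'd \<Rightarrow> real) \<Rightarrow> real ^ 'd \<Rightarrow> real ^ 'd" where
  "grad f x = (THE g. GDERIV f x :> g)"

definition hessian :: "(real ^ 'd \<Rightarrow> real) \<Rightarrow> real ^ 'd \<Rightarrow> real ^ 'd ^ 'd" where
  "hessian f x = matrix (frechet_derivative (grad f) (at x))"

definition C2 :: "(real ^ 'd \<Rightarrow> real) \<Rightarrow> bool" where
  "C2 f \<longleftrightarrow> f differentiable_on UNIV \<and> grad f differentiable_on UNIV
     \<and> continuous_on UNIV (hessian f)"

definition coercive :: "(real ^ 'd \<Rightarrow> real) \<Rightarrow> bool" where
  "coercive f \<longleftrightarrow> filterlim f at_top at_infinity"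

definition eigenspace :: "real ^ 'd ^ 'd \<Rightarrow> real \<Rightarrow> (real ^ 'd) set" where
  "eigenspace A \<mu> = {v. A *v v = \<mu> *\<^sub>R v}"

definition eigenvalue :: "real ^ 'd ^ 'd \<Rightarrow> real \<Rightarrow> bool" where
  "eigenvalue A \<mu> \<longleftrightarrow> (\<exists>v \<in> eigenspace A \<mu>. v \<noteq> 0)"

text \<open>Multiplicity is the dimension of the eigenspace. This is only used for the Hessian of a
  \<open>C\<^sup>2\<close> function, which is symmetric, so that it is also the algebraic multiplicity.\<close>

definition num_neg_eigenvalues :: "real ^ 'd ^ 'd \<Rightarrow> nat" where
  "num_neg_eigenvalues A = (\<Sum>\<mu> | eigenvalue A \<mu> \<and> \<mu> < 0. dim (eigenspace A \<mu>))"

definition nondegenerate_saddle :: "(real ^ 'd \<Rightarrow> real) \<Rightarrow> real ^ 'd \<Rightarrow> bool" where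
  "nondegenerate_saddle f x \<longleftrightarrow>
     grad f x = 0 \<and> invertible (hessian f x)
     \<and> (\<exists>\<mu>>0. eigenvalue (hessian f x) \<mu>) \<and> (\<exists>\<mu><0. eigenvalue (hessian f x) \<mu>)"


subsection \<open>Manifolds without smoothness\<close>

text \<open>The ambient space is split into complementary subspaces \<open>A\<close> and \<open>B\<close>, and \<open>S\<close> is the
  graph of a continuous \<open>\<phi> : D \<rightarrow> B\<close> over a \<open>k\<close>-dimensional domain \<open>D\<close> of \<open>A\<close>.\<close>

definition continuous_graph :: "nat \<Rightarrow> 'a::euclidean_space set \<Rightarrow> bool" where
  "continuous_graph k S \<longleftrightarrow>
     (\<exists>A B D \<phi>. subspace A \<and> subspace B \<and> A \<inter> B = {0} \<and> {a + b | a b. a \<in> A \<and> b \<in> B} = UNIV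
        \<and> dim A = k
        \<and> openin (top_of_set A) D \<and> connected D \<and> D \<noteq> {}
        \<and> continuous_on D \<phi> \<and> \<phi> ` D \<subseteq> B
        \<and> S = {u + \<phi> u | u. u \<in> D})"

text \<open>As for any embedded manifold, the description as a graph is required near each point
  of \<open>S\<close>; the splitting may depend on the point. A set that is globally a
  \<^const>\<open>continuous_graph\<close> qualifies, with \<open>U = UNIV\<close>. The global stable set of a saddle may turn
  back with respect to every fixed splitting, so it need not be a single such graph.\<close>

definition graph_manifold :: "nat \<Rightarrow> 'a::euclidean_space set \<Rightarrow> bool" where
  "graph_manifold k S \<longleftrightarrow>
     S \<noteq> {} \<and> (\<forall>z\<in>S. \<exists>U. open U \<and> z \<in> U \<and> continuous_graph k (S \<inter> U))"


subsection \<open>Distributed gradient flow\<close>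

definition connected_simple_graph :: "('n \<times> 'n) set \<Rightarrow> bool" where
  "connected_simple_graph E \<longleftrightarrow> sym E \<and> irrefl E \<and> E\<^sup>* = UNIV"

definition neighbors :: "('n \<times> 'n) set \<Rightarrow> 'n \<Rightarrow> 'n set" where
  "neighbors E n = {l. (n, l) \<in> E}"

definition weight :: "real \<Rightarrow> real \<Rightarrow> real" where
  "weight \<tau> t = (t + 1) powr (- \<tau>)"

text \<open>The derivative at the initial time \<open>t\<^sub>0\<close> is one-sided. Solutions are automatically of class
  \<open>C\<^sup>1\<close>, since for \<open>t\<^sub>0 > -1\<close> and \<open>C\<^sup>2\<close> functions \<open>f n\<close> the right-hand side is continuous
  in \<open>t\<close>.\<close>

definition dgf_solution ::
  "('n \<times> 'n) set \<Rightarrow> ('n \<Rightarrow> real ^ 'd \<Rightarrow> real) \<Rightarrow> real \<Rightarrow> real \<Rightarrow> real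
     \<Rightarrow> (real \<Rightarrow> real ^ 'd ^ 'n::finite) \<Rightarrow> bool" where
  "dgf_solution E f \<tau>\<^sub>\<alpha> \<tau>\<^sub>\<beta> t\<^sub>0 x \<longleftrightarrow>
     (\<forall>t\<ge>t\<^sub>0. \<forall>n. ((\<lambda>s. x s $ n) has_vector_derivative
        (weight \<tau>\<^sub>\<beta> t *\<^sub>R (\<Sum>l\<in>neighbors E n. x t $ l - x t $ n)
          - weight \<tau>\<^sub>\<alpha> t *\<^sub>R grad (f n) (x t $ n))) (at t within {t\<^sub>0..}))"

end

theory Submission
  imports Defs "HOL-Real_Asymp.Real_Asymp"
begin

text \<open>Put \<open>\<gamma> = \<beta>/\<alpha> \<rightarrow> \<infinity>\<close> and \<open>X\<^sub>0 = (x\<^sup>*, \<dots>, x\<^sup>*)\<close>. The quadratic form that is positive on the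
  negative eigenspace \<open>W\<close> of the Hessian of \<open>\<Sum>\<^sub>n f\<^sub>n\<close>, embedded as consensus vectors, and negative on
  \<open>W\<^sup>\<bottom>\<close> grows along differences of solutions near \<open>X\<^sub>0\<close> once \<open>\<gamma>\<close> is large, because consensus then
  dominates the coupling through the individual Hessians. If the nonlinearity is frozen outside a small
  ball, this holds globally: from late times the bounded solutions converge to \<open>X\<^sub>0\<close> and start on a
  Lipschitz graph over \<open>W\<^sup>\<bottom>\<close>. Existence comes from shooting: the \<open>W\<close>-component of the flow is an
  expanding, hence by invariance of domain surjective, function of the \<open>W\<close>-component of the initial value.

  The energy \<open>\<Sum>\<^sub>n f\<^sub>n(x\<^sub>n) + \<gamma>/2 \<langle>x, Lx\<rangle>\<close>, shifted to be nonnegative and multiplied by \<open>exp(C/\<gamma>)\<close>, is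
  a Lyapunov function although \<open>\<gamma>\<close> grows. It yields consensus, and it shows that a solution that leaves
  the ball after coming close to \<open>X\<^sub>0\<close> has lost too much energy to converge to \<open>X\<^sub>0\<close>. So near each of its
  points the stable set is the preimage of the graph under the flow. Pulling \<open>W\<close> back along
  the linearised flow gives a subspace that no two nearby points of the stable set differ by; projecting
  along it, invariance of domain turns the preimage into a continuous graph.\<close>

section \<open>Solutions of Lipschitz differential equations\<close>

text \<open>The consensus point \<open>X0\<close> is in general not a zero of the field: only the
  sum of the individual gradients vanishes there, so the field at \<open>X0\<close> is \<alpha>
  times a fixed vector orthogonal to consensus. Estimates relative to \<open>X0\<close> therefore
  carry a defect, which the growing damping makes of order 1/\<gamma>; differences of two solutions
  carry none. Time is measured by \<open>A\<close>, a primitive of \<alpha>, which tends to infinity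
  because \<open>\<tau>\<^sub>\<alpha> \<le> 1\<close>. In this clock the field has no uniform
  Lipschitz bound, since the damping of disagreement grows like \<gamma>, so all long-time estimates
  are one-sided inequalities for quadratic forms. Two forms, weighting the complement of
  \<open>W\<close> by 1 and by 2, are used together: an upper bound of one and a lower bound of the
  other bound the norm. At late times bounded solutions differ by vectors of the cone in which the
  \<open>W\<close>-component is at most the rest. The flow back to time \<open>t\<^sub>0\<close> may
  turn this cone in any direction, which is why the splitting has to depend on the point.\<close>

lemma gronwall_lower:
  fixes g A :: "real \<Rightarrow> real"
  assumes "a \<le> b" "continuous_on {a..b} g" "continuous_on {a..b} A"
    and g': "\<And>t. a < t \<Longrightarrow> t < b \<Longrightarrow> (g has_real_derivative g' t) (at t)"
    and A': "\<And>t. a < t \<Longrightarrow> t < b \<Longrightarrow> (A has_real_derivative \<alpha> t) (at t)"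
    and le: "\<And>t. a < t \<Longrightarrow> t < b \<Longrightarrow> \<alpha> t * g t \<le> g' t"
  shows "g a * exp (A b - A a) \<le> g b"
proof -
  \<comment> \<open>Integrating factor: the rate is given through a primitive \<open>A\<close>, so
    neither integrals nor the signs of \<open>g\<close> and \<open>\<alpha>\<close> enter.\<close>
  let ?h = "\<lambda>t. g t * exp (- A t)"
  have "?h a \<le> ?h b"
  proof (rule DERIV_nonneg_imp_increasing_open[OF \<open>a \<le> b\<close>])
    show "continuous_on {a..b} ?h"
      using assms by (intro continuous_intros)
    fix t assume t: "a < t" "t < b"
    have "(?h has_real_derivative (g' t - \<alpha> t * g t) * exp (- A t)) (at t)"
      using g'[OF t] A'[OF t] by (auto intro!: derivative_eq_intros simp: algebra_simps)
    then show "\<exists>y. (?h has_real_derivative y) (at t) \<and> 0 \<le> y"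
      using le[OF t] by (intro exI[of _ "(g' t - \<alpha> t * g t) * exp (- A t)"]) auto
  qed
  then have "?h a * exp (A b) \<le> ?h b * exp (A b)"
    by (intro mult_right_mono) auto
  then show ?thesis
    by (simp add: exp_diff exp_minus field_simps)
qed

lemma gronwall_upper:
  fixes g A :: "real \<Rightarrow> real"
  assumes "a \<le> b" "continuous_on {a..b} g" "continuous_on {a..b} A"
    and g': "\<And>t. a < t \<Longrightarrow> t < b \<Longrightarrow> (g has_real_derivative g' t) (at t)"
    and A': "\<And>t. a < t \<Longrightarrow> t < b \<Longrightarrow> (A has_real_derivative \<alpha> t) (at t)"
    and le: "\<And>t. a < t \<Longrightarrow> t < b \<Longrightarrow> g' t \<le> \<alpha> t * g t"
  shows "g b \<le> g a * exp (A b - A a)"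
proof -
  have "(- g a) * exp (A b - A a) \<le> - g b"
  proof (rule gronwall_lower[where g' = "\<lambda>t. - g' t" and \<alpha> = \<alpha>])
    show "((\<lambda>t. - g t) has_real_derivative - g' t) (at t)" if "a < t" "t < b" for t
      using DERIV_minus[OF g'[OF that]] .
    show "\<alpha> t * - g t \<le> - g' t" if "a < t" "t < b" for t
      using le[OF that] by simp
  qed (use assms in \<open>auto intro: continuous_on_minus\<close>)
  then show ?thesis by simp
qed

lemma has_real_derivative_norm_power2:
  fixes x :: "real \<Rightarrow> 'a::real_inner"
  assumes "(x has_vector_derivative x') (at t within S)"
  shows "((\<lambda>t. (norm (x t))\<^sup>2) has_real_derivative 2 * (x t \<bullet> x')) (at t within S)"
proof -
  have "((\<lambda>t. x t \<bullet> x t) has_real_derivative 2 * (x t \<bullet> x')) (at t within S)"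
    using assms unfolding has_vector_derivative_def has_field_derivative_def
    by (auto intro!: derivative_eq_intros simp: fun_eq_iff inner_commute algebra_simps)
  then show ?thesis
    by (simp add: power2_norm_eq_inner)
qed

text \<open>Both inequalities come from bounding the derivative of the squared norm, which is
  differentiable even at zeros of \<open>x\<close>, by 2K times itself. The second one runs time
  backwards and gives uniqueness into the past.\<close>

lemma norm_growth_bounds:
  fixes x :: "real \<Rightarrow> 'a::real_inner"
  assumes "a \<le> b" "continuous_on {a..b} x"
    and x': "\<And>t. a < t \<Longrightarrow> t < b \<Longrightarrow> (x has_vector_derivative x' t) (at t)"
    and le: "\<And>t. a < t \<Longrightarrow> t < b \<Longrightarrow> norm (x' t) \<le> K * norm (x t)"
  shows "norm (x b) \<le> exp (K * (b - a)) * norm (x a)"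
    and "norm (x a) \<le> exp (K * (b - a)) * norm (x b)"
proof -
  let ?g = "\<lambda>t. (norm (x t))\<^sup>2"
  have ip: "\<bar>2 * (x t \<bullet> x' t)\<bar> \<le> (2 * K) * ?g t" if "a < t" "t < b" for t
  proof -
    have "\<bar>x t \<bullet> x' t\<bar> \<le> norm (x t) * norm (x' t)"
      by (rule Cauchy_Schwarz_ineq2)
    also have "\<dots> \<le> norm (x t) * (K * norm (x t))"
      using le[OF that] by (intro mult_left_mono) auto
    finally show ?thesis
      by (simp add: power2_eq_square algebra_simps)
  qed
  have cont: "continuous_on {a..b} ?g"
    using assms by (intro continuous_intros)
  have d: "(?g has_real_derivative 2 * (x t \<bullet> x' t)) (at t)" if "a < t" "t < b" for t
    using has_real_derivative_norm_power2[OF x'[OF that]] .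
  have e: "exp (2 * K * b - 2 * K * a) = (exp (K * (b - a)))\<^sup>2"
    by (simp add: power2_eq_square flip: exp_add) (simp add: algebra_simps)
  have "?g b \<le> ?g a * exp (2 * K * b - 2 * K * a)"
  proof (rule gronwall_upper[where \<alpha> = "\<lambda>_. 2 * K", OF \<open>a \<le> b\<close> cont _ d])
    show "2 * (x t \<bullet> x' t) \<le> 2 * K * ?g t" if "a < t" "t < b" for t
      using ip[OF that] by linarith
  qed (auto intro!: continuous_intros derivative_eq_intros)
  then show "norm (x b) \<le> exp (K * (b - a)) * norm (x a)"
    unfolding e by - (rule power2_le_imp_le, simp_all add: power_mult_distrib mult.commute)
  have "?g a * exp ((- 2 * K) * b - (- 2 * K) * a) \<le> ?g b"
  proof (rule gronwall_lower[where \<alpha> = "\<lambda>_. - 2 * K", OF \<open>a \<le> b\<close> cont _ d])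
    show "- 2 * K * ?g t \<le> 2 * (x t \<bullet> x' t)" if "a < t" "t < b" for t
      using ip[OF that] by linarith
  qed (auto intro!: continuous_intros derivative_eq_intros)
  then have "?g a * exp ((- 2 * K) * b - (- 2 * K) * a) * exp (2 * K * b - 2 * K * a)
      \<le> ?g b * exp (2 * K * b - 2 * K * a)"
    by (rule mult_right_mono) auto
  then have "?g a \<le> ?g b * exp (2 * K * b - 2 * K * a)"
    by (simp add: mult.assoc flip: exp_add)
  then show "norm (x a) \<le> exp (K * (b - a)) * norm (x b)"
    unfolding e by - (rule power2_le_imp_le, simp_all add: power_mult_distrib mult.commute)
qed

lemma has_vector_derivative_at_interior:
  fixes x :: "real \<Rightarrow> 'a::real_normed_vector"
  assumes "(x has_vector_derivative x') (at t within {a..})" "a < t"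
  shows "(x has_vector_derivative x') (at t)"
proof -
  have "(x has_vector_derivative x') (at t within {a<..})"
    using assms(1) by (rule has_vector_derivative_within_subset) auto
  then show ?thesis
    using assms(2) at_within_open[of t "{a<..}"] by simp
qed

text \<open>Time ranges over the whole line and the Lipschitz constant is uniform in time, so
  solutions are global in both directions and each evolution map is invertible.
  \<open>F_bound\<close> controls the field at the origin for the Picard operator.\<close>

locale lipschitz_ode =
  fixes F :: "real \<Rightarrow> 'a::euclidean_space \<Rightarrow> 'a" and K M :: real
  assumes F_cont: "continuous_on UNIV (\<lambda>(t, x). F t x)"
    and F_lip: "norm (F t x - F t y) \<le> K * norm (x - y)"
    and F_bound: "norm (F t 0) \<le> M"
    and K_pos: "0 < K"
begin

lemma continuous_on_F:
  "continuous_on S g \<Longrightarrow> continuous_on S x \<Longrightarrow> continuous_on S (\<lambda>s. F (g s) (x s))"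
  using continuous_on_compose2[OF F_cont, of S "\<lambda>s. (g s, x s)"]
  by (auto intro: continuous_on_Pair)

definition solution :: "(real \<Rightarrow> 'a) \<Rightarrow> bool" where
  "solution x \<longleftrightarrow> (\<forall>t. (x has_vector_derivative F t (x t)) (at t))"

lemma solution_continuous_on: "solution x \<Longrightarrow> continuous_on S x"
  unfolding solution_def
  by (rule continuous_on_vector_derivative, rule has_vector_derivative_at_within) blast

text \<open>Picard iteration for \<^term>\<open>g t = x t /\<^sub>R cosh (2 * K * (t - T))\<close>, on which the integral
  operator is a contraction over the whole time axis.\<close>

lemma solution_exists: "\<exists>x. solution x \<and> x T = x0"
proof -
  define w where "w t = cosh (2 * K * (t - T))" for t
  define sh where "sh t = sinh (2 * K * (t - T))" for t
  have w_ge: "1 \<le> w t" for t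
    by (simp add: w_def cosh_real_ge_1)
  have w_pos[simp]: "0 < w t" "w t \<noteq> 0" "\<bar>w t\<bar> = w t" for t
    by (simp_all add: w_def)
  have sh_le: "\<bar>sh t\<bar> \<le> w t" for t
    using sinh_le_cosh_real[of "2 * K * (t - T)"] sinh_le_cosh_real[of "-(2 * K * (t - T))"]
    unfolding sh_def w_def sinh_minus cosh_minus by linarith
  have sh_deriv: "(sh has_real_derivative 2 * K * w t) (at t)" for t
    unfolding sh_def w_def by (auto intro!: derivative_eq_intros)
  have w_cont: "continuous_on UNIV w"
    unfolding w_def by (intro continuous_intros)
  have prim: "\<exists>H. (\<forall>t. (H has_vector_derivative h t) (at t)) \<and> H T = 0"
    if "continuous_on UNIV h" for h :: "real \<Rightarrow> 'a"
  proof -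
    have "\<exists>H. \<forall>t. (H has_vector_derivative h t) (at t)"
      using einterval_antiderivative[of "-\<infinity>" \<infinity> h] that
      by (simp add: continuous_on_eq_continuous_at)
    then obtain H where H: "\<And>t. (H has_vector_derivative h t) (at t)"
      by blast
    have "((\<lambda>t. H t - H T) has_vector_derivative h t) (at t)" for t
      using has_vector_derivative_diff[OF H has_vector_derivative_const[of "H T"]] by simp
    then show ?thesis
      by (intro exI[of _ "\<lambda>t. H t - H T"]) auto
  qed
  \<comment> \<open>\<open>C / 2 * sh\<close> has derivative \<open>K * C * w\<close>: the rate 2K
    in the weight is what produces the contraction factor 1/2.\<close>
  have prim_bound: "norm (H t) \<le> C * w t / 2"
    if H: "\<And>t. (H has_vector_derivative h t) (at t)" and H0: "H T = 0"
      and bd: "\<And>t. norm (h t) \<le> K * C * w t" for H h :: "real \<Rightarrow> 'a" and C t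
  proof -
    have C: "0 \<le> C"
      using order_trans[OF norm_ge_zero bd[of T]] K_pos w_pos(1)[of T]
      by (auto simp: zero_le_mult_iff)
    have cH: "continuous_on S H" for S
      by (rule continuous_on_vector_derivative, rule has_vector_derivative_at_within, rule H)
    have ph: "((\<lambda>t. C / 2 * sh t) has_vector_derivative K * C * w t) (at t)" for t
      using DERIV_cmult[OF sh_deriv[of t], of "C / 2"]
      by (simp add: has_real_derivative_iff_has_vector_derivative algebra_simps)
    have cp: "continuous_on S (\<lambda>t. C / 2 * sh t)" for S
      unfolding sh_def by (intro continuous_intros)
    have shT: "sh T = 0" by (simp add: sh_def)
    have le: "C / 2 * \<bar>sh t\<bar> \<le> C * w t / 2"
      using mult_left_mono[OF sh_le, of "C / 2" t] C by simp
    consider "t = T" | "T < t" | "t < T" by linarith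
    then show ?thesis
    proof cases
      case 1 then show ?thesis using mult_nonneg_nonneg[OF C less_imp_le[OF w_pos(1)[of T]]] H0 by simp
    next
      case 2
      have "norm (H t - H T) \<le> C / 2 * sh t - C / 2 * sh T"
        by (rule differentiable_bound_general[OF 2 cH cp H ph]) (use bd in auto)
      then show ?thesis
        using shT H0 le C mult_left_mono[OF abs_ge_self[of "sh t"], of "C/2"] by simp
    next
      case 3
      have "norm (H T - H t) \<le> C / 2 * sh T - C / 2 * sh t"
        by (rule differentiable_bound_general[OF 3 cH cp H ph]) (use bd in auto)
      then show ?thesis
        using shT H0 le C mult_left_mono[OF abs_ge_minus_self[of "sh t"], of "C/2"] by simp
    qed
  qed
  define f where "f g t = F t (w t *\<^sub>R apply_bcontfun g t)" for g :: "real \<Rightarrow>\<^sub>C 'a" and t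
  have f_cont: "continuous_on UNIV (f g)" for g
    unfolding f_def by (intro continuous_on_F continuous_intros w_cont) auto
  define H where "H g = (SOME H. (\<forall>t. (H has_vector_derivative f g t) (at t)) \<and> H T = 0)" for g
  have H: "(H g has_vector_derivative f g t) (at t)" "H g T = 0" for g t
    using someI_ex[OF prim[OF f_cont[of g]]] unfolding H_def[symmetric] by blast+
  define G where "G g t = (x0 + H g t) /\<^sub>R w t" for g t
  have G_bcont: "G g \<in> bcontfun" for g
  proof (rule bcontfun_normI)
    have "continuous_on UNIV (H g)"
      by (rule continuous_on_vector_derivative, rule has_vector_derivative_at_within, rule H)
    then show "continuous_on UNIV (G g)"
      unfolding G_def by (intro continuous_intros w_cont) auto
    fix t
    \<comment> \<open>Since \<open>1 \<le> w\<close>, the inhomogeneous bound \<open>M\<close> is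
      absorbed as \<open>K * (M / K) * w\<close>.\<close>
    let ?C = "(norm g + M / K)"
    have M: "0 \<le> M" using order_trans[OF norm_ge_zero F_bound] .
    have "norm (f g s) \<le> K * ?C * w s" for s
    proof -
      have "norm (f g s) \<le> norm (F s (w s *\<^sub>R apply_bcontfun g s) - F s 0) + norm (F s 0)"
        unfolding f_def by (metis add.commute norm_triangle_sub)
      also have "\<dots> \<le> K * norm (w s *\<^sub>R apply_bcontfun g s) + M"
        using F_lip[of s "w s *\<^sub>R apply_bcontfun g s" 0] F_bound[of s] by simp
      also have "\<dots> \<le> K * (w s * norm g) + M * w s"
      proof (rule add_mono)
        show "K * norm (w s *\<^sub>R apply_bcontfun g s) \<le> K * (w s * norm g)"
          using norm_bounded[of g s] K_pos by (simp add: mult_left_mono less_imp_le)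
        show "M \<le> M * w s"
          using mult_left_mono[OF w_ge[of s] M] by simp
      qed
      also have "\<dots> = K * ?C * w s"
        using K_pos by (simp add: algebra_simps)
      finally show ?thesis .
    qed
    from prim_bound[OF H this, of t]
    have "norm (x0 + H g t) \<le> norm x0 * w t + ?C * w t / 2"
      using mult_left_mono[OF w_ge[of t] norm_ge_zero[of x0]] norm_triangle_ineq[of x0 "H g t"]
      by linarith
    then have "norm (x0 + H g t) / w t \<le> (norm x0 * w t + ?C * w t / 2) / w t"
      by (rule divide_right_mono) (simp add: less_imp_le)
    also have "\<dots> = norm x0 + ?C / 2"
      by (simp add: add_divide_distrib)
    also have "norm (x0 + H g t) / w t = norm (G g t)"
      by (simp add: G_def divide_inverse mult.commute)
    finally show "norm (G g t) \<le> norm x0 + ?C / 2" .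
  qed
  define P where "P g = Bcontfun (G g)" for g
  have P: "apply_bcontfun (P g) = G g" for g
    unfolding P_def by (rule Bcontfun_inverse[OF G_bcont])
  have contr: "dist (P g) (P h) \<le> 1/2 * dist g h" for g h
  proof -
    have "norm (apply_bcontfun (P g - P h) t) \<le> dist g h / 2" for t
    proof -
      have D: "((\<lambda>t. H g t - H h t) has_vector_derivative f g t - f h t) (at t)" for t
        by (intro has_vector_derivative_diff H)
      have "norm (f g s - f h s) \<le> K * dist g h * w s" for s
      proof -
        have "norm (f g s - f h s) \<le> K * norm (w s *\<^sub>R apply_bcontfun (g - h) s)"
          unfolding f_def using F_lip[of s "w s *\<^sub>R apply_bcontfun g s" "w s *\<^sub>R apply_bcontfun h s"]
          by (simp add: algebra_simps)
        also have "\<dots> = K * (w s * norm (apply_bcontfun (g - h) s))"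
          by simp
        also have "\<dots> \<le> K * (w s * norm (g - h))"
          using norm_bounded[of "g - h" s] K_pos
          by (intro mult_left_mono) (simp_all add: less_imp_le)
        also have "\<dots> = K * dist g h * w s"
          by (simp add: dist_norm mult.commute mult.left_commute)
        finally show ?thesis .
      qed
      from prim_bound[OF D _ this, of t]
      have "norm (H g t - H h t) \<le> dist g h * w t / 2" by (simp add: H)
      moreover have "apply_bcontfun (P g - P h) t = (H g t - H h t) /\<^sub>R w t"
        by (simp add: P G_def scaleR_diff_right[symmetric])
      then have "norm (apply_bcontfun (P g - P h) t) = norm (H g t - H h t) / w t"
        by (simp add: divide_inverse mult.commute)
      ultimately show ?thesis
        by (simp add: divide_le_eq)
    qed
    then have "norm (P g - P h) \<le> dist g h / 2" by (rule norm_bound)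
    then show ?thesis by (simp add: dist_norm)
  qed
  obtain g where g: "P g = g"
    using banach_fix_type[of "1/2" P] contr by auto
  define x where "x t = x0 + H g t" for t
  have xw: "x t = w t *\<^sub>R apply_bcontfun g t" for t
    using P[of g] g by (simp add: x_def G_def)
  have "(x has_vector_derivative F t (x t)) (at t)" for t
    using has_vector_derivative_add[OF has_vector_derivative_const[of x0] H(1)[of g t]]
    unfolding x_def[symmetric] f_def xw[symmetric] by simp
  moreover have "x T = x0" by (simp add: x_def H)
  ultimately show ?thesis by (auto simp: solution_def)
qed

lemma solution_dist:
  assumes "a \<le> b" "continuous_on {a..b} x" "continuous_on {a..b} y"
    and "\<And>t. a < t \<Longrightarrow> t < b \<Longrightarrow> (x has_vector_derivative F t (x t)) (at t)"
    and "\<And>t. a < t \<Longrightarrow> t < b \<Longrightarrow> (y has_vector_derivative F t (y t)) (at t)"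
  shows "norm (x b - y b) \<le> exp (K * (b - a)) * norm (x a - y a)"
    and "norm (x a - y a) \<le> exp (K * (b - a)) * norm (x b - y b)"
proof -
  have c: "continuous_on {a..b} (\<lambda>t. x t - y t)"
    using assms by (intro continuous_on_diff)
  have d: "((\<lambda>t. x t - y t) has_vector_derivative F t (x t) - F t (y t)) (at t)"
    if "a < t" "t < b" for t
    by (intro has_vector_derivative_diff assms that)
  from norm_growth_bounds[OF \<open>a \<le> b\<close> c d F_lip]
  show "norm (x b - y b) \<le> exp (K * (b - a)) * norm (x a - y a)"
    and "norm (x a - y a) \<le> exp (K * (b - a)) * norm (x b - y b)"
    by blast+
qed

section \<open>The two-parameter evolution of a nonautonomous field\<close>

definition flow :: "real \<Rightarrow> real \<Rightarrow> 'a \<Rightarrow> 'a" where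
  "flow s t x0 = (SOME x. solution x \<and> x s = x0) t"

lemma flow_init [simp]: "flow s s x0 = x0"
  using someI_ex[OF solution_exists, of s x0] by (simp add: flow_def)

lemma solution_flow: "solution (\<lambda>t. flow s t x0)"
  using someI_ex[OF solution_exists, of s x0] by (simp add: flow_def)

lemma flow_deriv: "((\<lambda>t. flow s t x0) has_vector_derivative F t (flow s t x0)) (at t)"
  using solution_flow by (simp add: solution_def)

lemma continuous_on_flow_time: "continuous_on S (\<lambda>t. flow s t x0)"
  by (rule continuous_on_vector_derivative, rule has_vector_derivative_at_within, rule flow_deriv)

lemma flow_dist: "norm (flow s t x - flow s t y) \<le> exp (K * \<bar>t - s\<bar>) * norm (x - y)"
proof (cases "s \<le> t")
  case True
  then show ?thesis
    using solution_dist(1)[of s t "\<lambda>t. flow s t x" "\<lambda>t. flow s t y"] flow_deriv continuous_on_flow_time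
    by simp
next
  case False
  then show ?thesis
    using solution_dist(2)[of t s "\<lambda>t. flow s t x" "\<lambda>t. flow s t y"] flow_deriv continuous_on_flow_time
    by simp
qed

lemma continuous_on_flow: "continuous_on S (flow s t)"
proof -
  have "(exp (K * \<bar>t - s\<bar>))-lipschitz_on S (flow s t)"
    by (rule lipschitz_onI) (use flow_dist in \<open>auto simp: dist_norm\<close>)
  then show ?thesis by (rule lipschitz_on_continuous_on)
qed

lemma flow_unique_on:
  assumes "s \<in> {a..b}" "t \<in> {a..b}" "continuous_on {a..b} x"
    and "\<And>t. a < t \<Longrightarrow> t < b \<Longrightarrow> (x has_vector_derivative F t (x t)) (at t)"
  shows "x t = flow s t (x s)"
proof (cases "s \<le> t")
  case True
  have "norm (x t - flow s t (x s)) \<le> exp (K * (t - s)) * norm (x s - flow s s (x s))"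
    by (rule solution_dist) (use assms True flow_deriv continuous_on_flow_time
        in \<open>auto intro: continuous_on_subset\<close>)
  then show ?thesis by simp
next
  case False
  have "norm (x t - flow s t (x s)) \<le> exp (K * (s - t)) * norm (x s - flow s s (x s))"
    by (rule solution_dist) (use assms False flow_deriv continuous_on_flow_time
        in \<open>auto intro: continuous_on_subset\<close>)
  then show ?thesis by simp
qed

lemma flow_unique: "solution x \<Longrightarrow> x t = flow s t (x s)"
  by (rule flow_unique_on[of s "min s t" "max s t" t x])
    (auto simp: solution_def intro: solution_continuous_on)

text \<open>The solutions in the theorem live on a half-line, with a one-sided derivative at its
  left end, whereas \<open>flow\<close> solves the equation for all times; this identifies the
  two.\<close>

lemma flow_unique_ray:
  assumes "\<And>t. a \<le> t \<Longrightarrow> (x has_vector_derivative F t (x t)) (at t within {a..})" "a \<le> t" "a \<le> s"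
  shows "x t = flow s t (x s)"
proof (rule flow_unique_on[of s a "max s t" t x])
  have "continuous_on {a..} x"
    by (rule continuous_on_vector_derivative) (use assms in auto)
  then show "continuous_on {a..max s t} x"
    by (rule continuous_on_subset) auto
  show "(x has_vector_derivative F u (x u)) (at u)" if "a < u" for u
    using assms(1)[of u] that by (intro has_vector_derivative_at_interior) auto
qed (use assms in auto)

lemma flow_flow [simp]: "flow s t (flow r s x) = flow r t x"
  using flow_unique[OF solution_flow[of r x], of t s] by simp

lemma inj_flow: "inj (flow s t)"
  by (rule inj_on_inverseI[of _ "flow t s"]) simp

end

section \<open>Negative eigenspaces of a symmetric matrix\<close>

text \<open>A minimiser of the Rayleigh quotient on the unit sphere of \<open>Y\<close> is an
  eigenvector. This takes the place of the spectral theorem three times: on the span of the negative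
  eigenspaces, on its complement, and for the Laplacian off consensus.\<close>

lemma rayleigh_minimizer:
  fixes T :: "'a::euclidean_space \<Rightarrow> 'a"
  assumes T: "linear T" and sym: "\<And>x y. x \<bullet> T y = T x \<bullet> y"
    and Y: "subspace Y" and inv: "\<And>y. y \<in> Y \<Longrightarrow> T y \<in> Y" and "w \<in> Y" "w \<noteq> 0"
  obtains v \<mu> where "v \<in> Y" "norm v = 1" "T v = \<mu> *\<^sub>R v"
    "\<And>y. y \<in> Y \<Longrightarrow> \<mu> * (norm y)\<^sup>2 \<le> y \<bullet> T y"
proof -
  let ?S = "Y \<inter> sphere 0 1"
  have bl: "bounded_linear T"
    using T by (simp add: linear_conv_bounded_linear)
  have "compact ?S"
    using Y by (intro closed_Int_compact closed_subspace) auto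
  moreover have "w /\<^sub>R norm w \<in> ?S"
    using assms by (auto intro: subspace_scale)
  moreover have "continuous_on ?S (\<lambda>v. v \<bullet> T v)"
    by (intro continuous_intros linear_continuous_on bl)
  ultimately obtain v where v: "v \<in> ?S" and vmin: "\<And>y. y \<in> ?S \<Longrightarrow> v \<bullet> T v \<le> y \<bullet> T y"
    using continuous_attains_inf[of ?S "\<lambda>v. v \<bullet> T v"] by blast
  define \<mu> where "\<mu> = v \<bullet> T v"
  have le: "\<mu> * (norm y)\<^sup>2 \<le> y \<bullet> T y" if "y \<in> Y" for y
  proof (cases "y = 0")
    case False
    then have "y /\<^sub>R norm y \<in> ?S"
      using that Y by (auto intro: subspace_scale)
    from vmin[OF this] have "\<mu> \<le> (y \<bullet> T y) / (norm y)\<^sup>2"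
      using T by (simp add: \<mu>_def linear_scale power2_eq_square divide_inverse mult.commute mult.left_commute)
    then show ?thesis
      using False by (simp add: pos_le_divide_eq)
  qed (simp add: linear_0[OF T])
  define g where "g = T v - \<mu> *\<^sub>R v"
  have vY: "v \<in> Y" and nv: "norm v = 1" using v by auto
  have gY: "g \<in> Y"
    unfolding g_def using Y vY inv by (intro subspace_diff subspace_scale) auto
  define b where "b = g \<bullet> T g - \<mu> * (norm g)\<^sup>2"
  have b: "0 \<le> b"
    using le[OF gY] by (simp add: b_def)
  \<comment> \<open>Minimality along the line \<open>v + s *\<^sub>R g\<close>, where the residual
    \<open>g\<close> lies in \<open>Y\<close> by invariance. The linear coefficient is
    \<open>2 * (norm g)\<^sup>2\<close>, so a suitable negative \<open>s\<close> gives a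
    contradiction unless \<open>g = 0\<close>.\<close>
  have q: "0 \<le> 2 * s * (norm g)\<^sup>2 + s\<^sup>2 * b" for s
  proof -
    have "v + s *\<^sub>R g \<in> Y"
      using Y vY gY by (intro subspace_add subspace_scale)
    from le[OF this] have "0 \<le> (v + s *\<^sub>R g) \<bullet> T (v + s *\<^sub>R g) - \<mu> * ((v + s *\<^sub>R g) \<bullet> (v + s *\<^sub>R g))"
      by (simp add: power2_norm_eq_inner)
    also have "\<dots> = (v \<bullet> T v - \<mu> * (v \<bullet> v)) + 2 * s * (g \<bullet> T v - \<mu> * (g \<bullet> v))
        + s\<^sup>2 * (g \<bullet> T g - \<mu> * (g \<bullet> g))"
      using sym[of v g] by (simp add: linear_add[OF T] linear_scale[OF T] inner_add_left inner_add_right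
          inner_commute power2_eq_square algebra_simps)
    also have "v \<bullet> T v - \<mu> * (v \<bullet> v) = 0"
      using nv by (simp add: \<mu>_def norm_eq_1)
    also have "g \<bullet> T v - \<mu> * (g \<bullet> v) = g \<bullet> g"
      by (simp add: g_def inner_diff_right)
    finally show ?thesis
      by (simp add: b_def power2_norm_eq_inner)
  qed
  have "g = 0"
  proof (rule ccontr)
    assume "g \<noteq> 0"
    define G where "G = (norm g)\<^sup>2"
    have G: "0 < G" using \<open>g \<noteq> 0\<close> by (simp add: G_def)
    show False
    proof (cases "b = 0")
      case True
      then show False using q[of "-1"] G by (simp add: G_def)
    next
      case False
      have "0 \<le> 2 * (- G / b) * G + (- G / b)\<^sup>2 * b"
        using q unfolding G_def .
      also have "\<dots> = - (G\<^sup>2 / b)"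
        using False by (simp add: field_simps power2_eq_square)
      finally show False
        using G b False by (simp add: divide_le_0_iff)
    qed
  qed
  then show ?thesis
    using that[of v \<mu>] vY nv le by (simp add: g_def)
qed

text \<open>Built from an orthonormal basis, so that linearity is at hand: the projection gets
  applied to derivatives of solutions.\<close>

lemma orthogonal_projection:
  fixes S :: "'a::euclidean_space set"
  assumes "subspace S"
  obtains P where "linear P" "\<And>x. P x \<in> S" "\<And>x y. y \<in> S \<Longrightarrow> (x - P x) \<bullet> y = 0"
proof -
  obtain B where B: "B \<subseteq> S" "pairwise orthogonal B" "\<And>x. x \<in> B \<Longrightarrow> norm x = 1"
      "independent B" "span B = S"
    using orthonormal_basis_subspace[OF assms] by metis
  have fin: "finite B"
    using B(2) by (rule pairwise_orthogonal_imp_finite)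
  define P where "P x = (\<Sum>b\<in>B. (x \<bullet> b) *\<^sub>R b)" for x
  have "linear P"
    unfolding P_def by (intro linearI)
      (simp_all add: inner_add_left scaleR_add_left sum.distrib scaleR_sum_right)
  moreover have PS: "P x \<in> S" for x
    unfolding P_def using B(1) assms by (intro subspace_sum subspace_scale) auto
  moreover have "(x - P x) \<bullet> y = 0" if "y \<in> S" for x y
  proof -
    have ob: "orthogonal (x - P x) c" if c: "c \<in> B" for c
    proof -
      have "P x \<bullet> c = (\<Sum>b\<in>B. (x \<bullet> b) * (b \<bullet> c))"
        by (simp add: P_def inner_sum_left)
      also have "\<dots> = (\<Sum>b\<in>B. if b = c then x \<bullet> c else 0)"
        using B(2,3) c by (intro sum.cong) (auto simp: pairwise_def orthogonal_def norm_eq_1)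
      also have "\<dots> = x \<bullet> c"
        using fin c by simp
      finally show ?thesis
        by (simp add: orthogonal_def inner_diff_left)
    qed
    have "orthogonal (x - P x) y"
      by (rule orthogonal_to_span[OF _ ob]) (use B(5) that in auto)
    then show ?thesis
      by (simp add: orthogonal_def)
  qed
  ultimately show ?thesis using that by blast
qed

lemma norm_power2_decomposition:
  fixes w :: "'a::real_inner"
  assumes "(w - p) \<bullet> p = 0"
  shows "(norm w)\<^sup>2 = (norm p)\<^sup>2 + (norm (w - p))\<^sup>2"
  using assms unfolding power2_norm_eq_inner
  by (simp add: inner_diff_left inner_diff_right inner_commute)

lemma eigenspace_orthogonal:
  fixes A :: "real ^ 'd ^ 'd"
  assumes "\<And>x y. x \<bullet> (A *v y) = (A *v x) \<bullet> y" "\<mu> \<noteq> \<nu>" "x \<in> eigenspace A \<mu>" "y \<in> eigenspace A \<nu>"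
  shows "x \<bullet> y = 0"
proof -
  have "\<nu> * (x \<bullet> y) = \<mu> * (x \<bullet> y)"
    using assms(1)[of x y] assms(3,4) by (simp add: eigenspace_def)
  with \<open>\<mu> \<noteq> \<nu>\<close> show ?thesis by simp
qed

text \<open>Eigenvectors chosen for distinct eigenvalues are nonzero and pairwise orthogonal.
  Finiteness matters because \<open>num_neg_eigenvalues\<close> is a sum over all negative
  eigenvalues, which would collapse to 0 over an infinite set.\<close>

lemma finite_eigenvalues:
  fixes A :: "real ^ 'd ^ 'd"
  assumes sym: "\<And>x y. x \<bullet> (A *v y) = (A *v x) \<bullet> y"
  shows "finite {\<mu>. eigenvalue A \<mu>}"
proof -
  define e where "e \<mu> = (SOME v. v \<in> eigenspace A \<mu> \<and> v \<noteq> 0)" for \<mu>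
  have e: "e \<mu> \<in> eigenspace A \<mu> \<and> e \<mu> \<noteq> 0" if "eigenvalue A \<mu>" for \<mu>
    unfolding e_def using that by (intro someI_ex[of "\<lambda>v. v \<in> eigenspace A \<mu> \<and> v \<noteq> 0"])
      (auto simp: eigenvalue_def)
  have "pairwise orthogonal (e ` {\<mu>. eigenvalue A \<mu>})"
    unfolding pairwise_def using e eigenspace_orthogonal[OF sym] by (auto simp: orthogonal_def) metis
  then have "finite (e ` {\<mu>. eigenvalue A \<mu>})"
    by (rule pairwise_orthogonal_imp_finite)
  moreover have "inj_on e {\<mu>. eigenvalue A \<mu>}"
  proof (rule inj_onI)
    fix \<mu> \<nu> assume "\<mu> \<in> {\<mu>. eigenvalue A \<mu>}" "\<nu> \<in> {\<mu>. eigenvalue A \<mu>}" "e \<mu> = e \<nu>"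
    then show "\<mu> = \<nu>"
      using e[of \<mu>] e[of \<nu>] eigenspace_orthogonal[OF sym, of \<mu> \<nu> "e \<mu>" "e \<nu>"] by auto
  qed
  ultimately show ?thesis
    by (rule finite_imageD)
qed

lemma dim_sum_eigenspaces:
  fixes A :: "real ^ 'd ^ 'd"
  assumes sym: "\<And>x y. x \<bullet> (A *v y) = (A *v x) \<bullet> y" and "finite M"
  shows "dim (\<Union>\<mu>\<in>M. eigenspace A \<mu>) = (\<Sum>\<mu>\<in>M. dim (eigenspace A \<mu>))"
  using \<open>finite M\<close>
proof induction
  case (insert \<nu> M)
  have "dim (eigenspace A \<nu> \<union> (\<Union>\<mu>\<in>M. eigenspace A \<mu>))
      = dim (eigenspace A \<nu>) + dim (\<Union>\<mu>\<in>M. eigenspace A \<mu>)"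
  proof (rule dim_orthogonal_sum)
    fix x y assume x: "x \<in> eigenspace A \<nu>" and "y \<in> (\<Union>\<mu>\<in>M. eigenspace A \<mu>)"
    then obtain \<mu> where \<mu>: "\<mu> \<in> M" "y \<in> eigenspace A \<mu>" by blast
    then have "\<nu> \<noteq> \<mu>" using insert.hyps by blast
    from eigenspace_orthogonal[OF sym this x \<mu>(2)] show "x \<bullet> y = 0" .
  qed
  then show ?case using insert by simp
qed simp

text \<open>\<open>V\<close> is the span of the negative eigenspaces. The extreme values of the
  quadratic form on \<open>V\<close> and on its orthogonal complement are attained at eigenvectors,
  whose eigenvalues can only have the expected sign; the smaller modulus is the common margin
  \<open>m\<close>.\<close>

lemma neg_eigenspace_splitting:
  fixes A :: "real ^ 'd ^ 'd"
  assumes sym: "\<And>x y. x \<bullet> (A *v y) = (A *v x) \<bullet> y" and inv: "invertible A"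
  obtains V m where "subspace V" "dim V = num_neg_eigenvalues A" "0 < m"
    "\<And>v. v \<in> V \<Longrightarrow> A *v v \<in> V"
    "\<And>v. v \<in> V \<Longrightarrow> v \<bullet> (A *v v) \<le> - m * (norm v)\<^sup>2"
    "\<And>w. \<forall>v\<in>V. w \<bullet> v = 0 \<Longrightarrow> m * (norm w)\<^sup>2 \<le> w \<bullet> (A *v w)"
proof -
  define M where "M = {\<mu>. eigenvalue A \<mu> \<and> \<mu> < 0}"
  have "finite M"
    unfolding M_def using finite_eigenvalues[OF sym] by simp
  define U where "U = (\<Union>\<mu>\<in>M. eigenspace A \<mu>)"
  define V where "V = span U"
  have V: "subspace V" by (simp add: V_def)
  have dimV: "dim V = num_neg_eigenvalues A"
    using dim_sum_eigenspaces[OF sym \<open>finite M\<close>]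
    by (simp add: V_def U_def M_def num_neg_eigenvalues_def)
  have AV: "A *v v \<in> V" if "v \<in> V" for v
    using that unfolding V_def
  proof (induction rule: span_induct_alt)
    case base
    then show ?case by (simp add: span_0)
  next
    case (step c x y)
    obtain \<nu> where "A *v x = \<nu> *\<^sub>R x"
      using step(1) by (auto simp: U_def eigenspace_def)
    then have "A *v x \<in> span U"
      using step(1) by (simp add: span_scale span_base)
    then show ?case
      using step by (simp add: matrix_vector_right_distrib matrix_vector_mult_scaleR span_add span_scale)
  qed
  define W where "W = {w. \<forall>v\<in>V. w \<bullet> v = 0}"
  have W: "subspace W"
    unfolding W_def subspace_def by (auto simp: inner_add_left)
  have AW: "A *v w \<in> W" if "w \<in> W" for w
    using that AV sym by (auto simp: W_def) (metis inner_commute)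
  have lin: "linear (\<lambda>x. A *v x)" "linear (\<lambda>x. - (A *v x))"
    by (auto intro: matrix_vector_mul_linear linear_compose_neg)
  have negE: "x \<in> V" if "A *v x = \<mu> *\<^sub>R x" "\<mu> < 0" for x \<mu>
  proof (cases "x = 0")
    case False
    then have "\<mu> \<in> M" using that by (auto simp: M_def eigenvalue_def eigenspace_def)
    then show ?thesis using that unfolding V_def U_def eigenspace_def by (intro span_base) auto
  qed (simp add: V subspace_0)
  have "\<exists>m>0. \<forall>w\<in>W. m * (norm w)\<^sup>2 \<le> w \<bullet> (A *v w)"
  proof (cases "W \<subseteq> {0}")
    case True
    then show ?thesis by (intro exI[of _ 1]) auto
  next
    case False
    then obtain w0 where w0: "w0 \<in> W" "w0 \<noteq> 0" by auto
    obtain v \<mu> where v: "v \<in> W" "norm v = 1" "A *v v = \<mu> *\<^sub>R v"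
      and le: "\<And>y. y \<in> W \<Longrightarrow> \<mu> * (norm y)\<^sup>2 \<le> y \<bullet> (A *v y)"
      using rayleigh_minimizer[OF lin(1) sym W AW w0] by metis
    \<comment> \<open>An eigenvector in the complement with negative eigenvalue would also lie in
      \<open>V\<close>; eigenvalue 0 is excluded by invertibility.\<close>
    have "\<mu> > 0"
    proof (rule ccontr)
      assume "\<not> 0 < \<mu>"
      then consider "\<mu> < 0" | "\<mu> = 0" by linarith
      then show False
      proof cases
        case 1
        then have "v \<in> V" using negE v(3) by blast
        then have "v \<bullet> v = 0" using v(1) by (auto simp: W_def)
        then show False using v(2) by simp
      next
        case 2
        then have "A *v v = 0" using v(3) by simp
        then have "v = 0" using inv by (metis invertible_def matrix_left_invertible_ker)
        then show False using v(2) by simp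
      qed
    qed
    then show ?thesis using le by blast
  qed
  then obtain m1 where m1: "m1 > 0" "\<And>w. w \<in> W \<Longrightarrow> m1 * (norm w)\<^sup>2 \<le> w \<bullet> (A *v w)"
    by blast
  have "\<exists>m>0. \<forall>v\<in>V. v \<bullet> (A *v v) \<le> - m * (norm v)\<^sup>2"
  proof (cases "V \<subseteq> {0}")
    case True
    then show ?thesis by (intro exI[of _ 1]) auto
  next
    case False
    then obtain w0 where w0: "w0 \<in> V" "w0 \<noteq> 0" by auto
    have sym': "x \<bullet> (- (A *v y)) = - (A *v x) \<bullet> y" for x y
      using sym by simp
    have AV': "- (A *v y) \<in> V" if "y \<in> V" for y
      using AV[OF that] V by (simp add: subspace_neg)
    obtain v \<mu> where v: "v \<in> V" "norm v = 1" "- (A *v v) = \<mu> *\<^sub>R v"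
      and le: "\<And>y. y \<in> V \<Longrightarrow> \<mu> * (norm y)\<^sup>2 \<le> y \<bullet> (- (A *v y))"
      using rayleigh_minimizer[OF lin(2) sym' V AV' w0] by metis
    have eig: "A *v v = (- \<mu>) *\<^sub>R v"
      using v(3) by (metis minus_minus scaleR_minus_left)
    \<comment> \<open>Otherwise the eigenvalue \<open>- \<mu>\<close> of \<open>A\<close> is
      nonnegative, hence differs from every negative one, and \<open>v\<close> is orthogonal to all
      of \<open>V\<close>, including itself.\<close>
    have "\<mu> > 0"
    proof (rule ccontr)
      assume "\<not> 0 < \<mu>"
      have "orthogonal v u" if u: "u \<in> U" for u
      proof -
        obtain \<nu> where "\<nu> < 0" "u \<in> eigenspace A \<nu>"
          using u by (auto simp: U_def M_def)
        then show ?thesis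
          using eigenspace_orthogonal[OF sym, of "- \<mu>" \<nu> v u] eig \<open>\<not> 0 < \<mu>\<close>
          by (simp add: eigenspace_def orthogonal_def)
      qed
      then have "orthogonal v v"
        using orthogonal_to_span[OF v(1)[unfolded V_def]] by blast
      then show False
        using v(2) by (simp add: orthogonal_def)
    qed
    then show ?thesis
      using le by (intro exI[of _ \<mu>]) (simp add: le_minus_iff[of "_ \<bullet> _"])
  qed
  then obtain m2 where m2: "m2 > 0" "\<And>v. v \<in> V \<Longrightarrow> v \<bullet> (A *v v) \<le> - m2 * (norm v)\<^sup>2"
    by blast
  define m where "m = min m1 m2"
  show ?thesis
  proof (rule that[OF V dimV _ AV])
    show "0 < m" using m1 m2 by (simp add: m_def)
    show "v \<bullet> (A *v v) \<le> - m * (norm v)\<^sup>2" if "v \<in> V" for v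
      using m2(2)[OF that] mult_right_mono[of m m2 "(norm v)\<^sup>2"] by (simp add: m_def)
    show "m * (norm w)\<^sup>2 \<le> w \<bullet> (A *v w)" if "\<forall>v\<in>V. w \<bullet> v = 0" for w
      using m1(2)[of w] that mult_right_mono[of m m1 "(norm w)\<^sup>2"] by (simp add: m_def W_def)
  qed
qed

section \<open>Gradients and Hessians\<close>

lemma differentiable_imp_GDERIV:
  fixes f :: "'a::euclidean_space \<Rightarrow> real"
  assumes "f differentiable (at x)"
  obtains D where "GDERIV f x :> D"
proof -
  obtain f' where f': "(f has_derivative f') (at x)"
    using assms by (auto simp: differentiable_def)
  have lin: "linear f'" using f' by (rule has_derivative_linear)
  have "f' = (\<lambda>h. h \<bullet> (\<Sum>b\<in>Basis. f' b *\<^sub>R b))"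
  proof
    fix h
    have "f' h = f' (\<Sum>b\<in>Basis. (h \<bullet> b) *\<^sub>R b)" by (simp add: euclidean_representation)
    also have "\<dots> = (\<Sum>b\<in>Basis. (h \<bullet> b) * f' b)"
      using lin by (simp add: linear_sum linear_scale)
    finally show "f' h = h \<bullet> (\<Sum>b\<in>Basis. f' b *\<^sub>R b)"
      by (simp add: inner_sum_right mult.commute)
  qed
  then show ?thesis
    using f' that unfolding gderiv_def by metis
qed

lemma GDERIV_unique:
  fixes f :: "'a::real_inner \<Rightarrow> real"
  assumes "GDERIV f x :> D" "GDERIV f x :> D'"
  shows "D = D'"
proof -
  have "(\<lambda>h. h \<bullet> D) = (\<lambda>h. h \<bullet> D')"
    using assms unfolding gderiv_def by (rule has_derivative_unique)
  then have "(D - D') \<bullet> D = (D - D') \<bullet> D'" by metis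
  then have "(D - D') \<bullet> (D - D') = 0" by (simp add: inner_diff_right)
  then show ?thesis by simp
qed

lemma grad_eqI: "GDERIV f x :> D \<Longrightarrow> grad f x = D"
  unfolding grad_def by (rule the_equality) (auto dest: GDERIV_unique)

lemma C2_GDERIV:
  assumes "C2 f"
  shows "GDERIV f x :> grad f x"
proof -
  have "f differentiable (at x)"
    using assms by (simp add: C2_def differentiable_on_def)
  then obtain D where "GDERIV f x :> D" by (rule differentiable_imp_GDERIV)
  then show ?thesis using grad_eqI by metis
qed

lemma C2_grad_derivative:
  assumes "C2 f"
  shows "(grad f has_derivative (\<lambda>h. hessian f x *v h)) (at x)"
proof -
  have "grad f differentiable (at x)"
    using assms by (simp add: C2_def differentiable_on_def)
  then have d: "(grad f has_derivative frechet_derivative (grad f) (at x)) (at x)"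
    by (simp add: frechet_derivative_works)
  then have "(\<lambda>h. hessian f x *v h) = frechet_derivative (grad f) (at x)"
    unfolding hessian_def using matrix_vector_mul(2)[OF has_derivative_linear[OF d]] by simp
  with d show ?thesis by metis
qed

lemma sum_matrix_vector_mult:
  fixes A :: "'i \<Rightarrow> real ^ 'b ^ 'c"
  shows "(\<Sum>i\<in>I. A i) *v x = (\<Sum>i\<in>I. A i *v x)"
  by (induction I rule: infinite_finite_induct) (simp_all add: matrix_vector_mult_add_rdistrib)

lemma C2_sum:
  fixes f :: "'n::finite \<Rightarrow> real ^ 'd::finite \<Rightarrow> real"
  assumes "\<And>n. C2 (f n)"
  shows "grad (\<lambda>y. \<Sum>n\<in>UNIV. f n y) = (\<lambda>y. \<Sum>n\<in>UNIV. grad (f n) y)"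
    and "hessian (\<lambda>y. \<Sum>n\<in>UNIV. f n y) x *v v = (\<Sum>n\<in>UNIV. hessian (f n) x *v v)"
    and "C2 (\<lambda>y. \<Sum>n\<in>UNIV. f n y)"
proof -
  let ?F = "\<lambda>y. \<Sum>n\<in>UNIV. f n y"
  have gd: "GDERIV ?F x :> (\<Sum>n\<in>UNIV. grad (f n) x)" for x
    using C2_GDERIV[OF assms] unfolding gderiv_def inner_sum_right
    by (intro has_derivative_sum) auto
  then show g: "grad ?F = (\<lambda>y. \<Sum>n\<in>UNIV. grad (f n) y)"
    using grad_eqI by blast
  have d: "(grad ?F has_derivative (\<lambda>h. \<Sum>n\<in>UNIV. hessian (f n) x *v h)) (at x)" for x
    unfolding g by (intro has_derivative_sum C2_grad_derivative assms)
  have h: "hessian ?F x = (\<Sum>n\<in>UNIV. hessian (f n) x)" for x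
  proof -
    have "frechet_derivative (grad ?F) (at x) = (\<lambda>h. \<Sum>n\<in>UNIV. hessian (f n) x *v h)"
      using frechet_derivative_at[OF d[of x]] by simp
    also have "\<dots> = (\<lambda>h. (\<Sum>n\<in>UNIV. hessian (f n) x) *v h)"
      by (simp add: fun_eq_iff sum_matrix_vector_mult)
    finally show ?thesis by (simp add: hessian_def)
  qed
  show "hessian ?F x *v v = (\<Sum>n\<in>UNIV. hessian (f n) x *v v)"
    by (simp add: h sum_matrix_vector_mult)
  have "continuous_on UNIV (hessian ?F)"
    unfolding h[abs_def] using assms by (intro continuous_on_sum) (auto simp: C2_def)
  then show "C2 ?F"
    using gd d unfolding C2_def gderiv_def differentiable_on_def differentiable_def by blast
qed

lemma norm_matrix_vector_mult:
  fixes A :: "real ^ 'm ^ 'n"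
  shows "norm (A *v x) \<le> norm A * norm x"
proof -
  have "norm (A *v x) = L2_set (\<lambda>i. \<bar>A $ i \<bullet> x\<bar>) UNIV"
    by (simp add: norm_vec_def matrix_vector_mul_component)
  also have "\<dots> \<le> L2_set (\<lambda>i. norm (A $ i) * norm x) UNIV"
    by (intro L2_set_mono) (auto simp: Cauchy_Schwarz_ineq2)
  also have "\<dots> = norm A * norm x"
    by (simp add: L2_set_left_distrib norm_vec_def)
  finally show ?thesis .
qed

text \<open>Mean value inequality for \<open>grad f z - hessian f c *v z\<close>, whose derivative
  is small near \<open>c\<close> by uniform continuity of the Hessian on a ball. Uniformity in
  \<open>c\<close> is what the linearisation along a whole trajectory segment requires.\<close>

lemma C2_grad_approx:
  assumes "C2 f" "0 < e"
  obtains d where "0 < d"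
    "\<And>c x y. norm c \<le> R \<Longrightarrow> norm (x - c) \<le> d \<Longrightarrow> norm (y - c) \<le> d \<Longrightarrow>
       norm (grad f x - grad f y - hessian f c *v (x - y)) \<le> e * norm (x - y)"
proof -
  have "uniformly_continuous_on (cball 0 (R + 1)) (hessian f)"
    using assms(1) by (intro compact_uniformly_continuous) (auto simp: C2_def intro: continuous_on_subset)
  then obtain d0 where d0: "0 < d0" "\<And>x y. x \<in> cball 0 (R + 1) \<Longrightarrow> y \<in> cball 0 (R + 1) \<Longrightarrow>
      dist y x < d0 \<Longrightarrow> dist (hessian f y) (hessian f x) < e"
    using assms(2) unfolding uniformly_continuous_on_def by metis
  \<comment> \<open>The bound 1 keeps all points in the ball of radius \<open>R + 1\<close>; half of
    \<open>d0\<close> makes the strict inequality available on the closed ball.\<close>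
  define d where "d = min (d0 / 2) 1"
  show ?thesis
  proof
    show "0 < d" using d0 by (simp add: d_def)
    fix c x y :: "real ^ 'a"
    assume c: "norm c \<le> R" and x: "norm (x - c) \<le> d" and y: "norm (y - c) \<le> d"
    have "norm ((grad f x - hessian f c *v x) - (grad f y - hessian f c *v y)) \<le> e * norm (x - y)"
    proof (rule differentiable_bound[of "cball c d"
          "\<lambda>z. grad f z - hessian f c *v z" "\<lambda>z h. hessian f z *v h - hessian f c *v h"])
      fix z assume "z \<in> cball c d"
      then have z: "norm (z - c) \<le> d" by (simp add: dist_norm norm_minus_commute)
      have "bounded_linear (\<lambda>z. hessian f c *v z)"
        by (rule matrix_vector_mul_bounded_linear)
      then show "((\<lambda>z. grad f z - hessian f c *v z) has_derivative
          (\<lambda>h. hessian f z *v h - hessian f c *v h)) (at z within cball c d)"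
        using has_derivative_at_withinI[OF has_derivative_diff[OF C2_grad_derivative[OF assms(1)]
          bounded_linear_imp_has_derivative]] by blast
      have "norm z \<le> R + 1"
        using c z norm_triangle_ineq[of "z - c" c] by (simp add: d_def)
      then have "norm (hessian f z - hessian f c) \<le> e"
        using d0(2)[of c z] d0(1) c z by (simp add: d_def dist_norm less_imp_le)
      then show "onorm (\<lambda>h. hessian f z *v h - hessian f c *v h) \<le> e"
        using assms(2) by (intro onorm_bound) (auto simp: matrix_vector_mult_diff_rdistrib[symmetric]
             intro!: order_trans[OF norm_matrix_vector_mult] mult_right_mono)
    qed (use x y in \<open>auto simp: dist_norm norm_minus_commute\<close>)
    also have "(grad f x - hessian f c *v x) - (grad f y - hessian f c *v y)
        = grad f x - grad f y - hessian f c *v (x - y)"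
      by (simp add: matrix_vector_mult_diff_distrib)
    finally show "norm (grad f x - grad f y - hessian f c *v (x - y)) \<le> e * norm (x - y)" .
  qed
qed

lemma C2_line_derivative:
  assumes "C2 f"
  shows "((\<lambda>s. f (x + s *\<^sub>R v)) has_real_derivative v \<bullet> grad f (x + s *\<^sub>R v)) (at s)"
proof -
  have "(f has_derivative (\<lambda>h. h \<bullet> grad f (x + s *\<^sub>R v))) (at (x + s *\<^sub>R v))"
    using C2_GDERIV[OF assms] by (simp add: gderiv_def)
  moreover have "((\<lambda>s. x + s *\<^sub>R v) has_derivative (\<lambda>h. h *\<^sub>R v)) (at s)"
    by (auto intro!: derivative_eq_intros)
  ultimately have "((\<lambda>s. f (x + s *\<^sub>R v)) has_derivative (\<lambda>h. (h *\<^sub>R v) \<bullet> grad f (x + s *\<^sub>R v))) (at s)"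
    by (rule has_derivative_compose[rotated])
  then show ?thesis
    by (simp add: has_field_derivative_def mult.commute[of _ "v \<bullet> _"])
qed

text \<open>The mean value theorem in direction \<open>v\<close>, applied to the increment in
  direction \<open>w\<close>, followed by the gradient approximation at \<open>x\<close>. The second
  difference itself is symmetric in \<open>v\<close> and \<open>w\<close>.\<close>

lemma second_difference:
  assumes "C2 f" "0 < e"
  shows "\<forall>\<^sub>F t in at_right 0. \<bar>f (x + t *\<^sub>R v + t *\<^sub>R w) - f (x + t *\<^sub>R v) - f (x + t *\<^sub>R w) + f x
      - t\<^sup>2 * (v \<bullet> (hessian f x *v w))\<bar> \<le> e * t\<^sup>2"
proof -
  \<comment> \<open>The gradient error gets multiplied by \<open>norm v * norm w\<close>; the added
    1 keeps the divisor positive.\<close>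
  define B where "B = norm v * norm w + 1"
  have B: "0 < B" by (simp add: B_def add_nonneg_pos)
  obtain d where d: "0 < d" and approx: "\<And>c a b. norm c \<le> norm x \<Longrightarrow> norm (a - c) \<le> d \<Longrightarrow>
      norm (b - c) \<le> d \<Longrightarrow> norm (grad f a - grad f b - hessian f c *v (a - b)) \<le> (e / B) * norm (a - b)"
    using C2_grad_approx[OF assms(1), of "e / B" "norm x"] assms(2) B by (metis divide_pos_pos)
  define r where "r = d / (norm v + norm w + 1)"
  have r: "0 < r" using d by (simp add: r_def add_nonneg_pos)
  have main: "\<bar>f (x + t *\<^sub>R v + t *\<^sub>R w) - f (x + t *\<^sub>R v) - f (x + t *\<^sub>R w) + f x
      - t\<^sup>2 * (v \<bullet> (hessian f x *v w))\<bar> \<le> e * t\<^sup>2" if t: "0 < t" "t < r" for t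
  proof -
    let ?\<phi> = "\<lambda>s. f ((x + t *\<^sub>R w) + s *\<^sub>R v) - f (x + s *\<^sub>R v)"
    let ?G = "\<lambda>s. grad f ((x + t *\<^sub>R w) + s *\<^sub>R v) - grad f (x + s *\<^sub>R v)"
    have "(?\<phi> has_real_derivative v \<bullet> ?G s) (at s)" for s
      unfolding inner_diff_right by (intro DERIV_diff C2_line_derivative assms)
    from MVT2[OF t(1) this] obtain s where s: "0 < s" "s < t" "?\<phi> t - ?\<phi> 0 = t * (v \<bullet> ?G s)"
      by auto
    have tr: "t * (norm v + norm w + 1) \<le> d"
      using t(2) by (simp add: r_def pos_less_divide_eq add_nonneg_pos less_imp_le)
    have sv: "s * norm v \<le> t * norm v"
      using s by (intro mult_right_mono) auto
    have "norm (((x + t *\<^sub>R w) + s *\<^sub>R v) - x) \<le> t * norm w + s * norm v"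
      using norm_triangle_ineq[of "t *\<^sub>R w" "s *\<^sub>R v"] s t by (simp add: algebra_simps)
    then have n1: "norm (((x + t *\<^sub>R w) + s *\<^sub>R v) - x) \<le> d"
      using tr sv t by (simp add: algebra_simps)
    have "t * norm v \<le> d"
    proof -
      have "0 \<le> t * norm w" using t by simp
      moreover have "t * (norm v + norm w + 1) = t * norm v + t * norm w + t"
        by (simp add: algebra_simps)
      ultimately show ?thesis using tr t by linarith
    qed
    then have n2: "norm ((x + s *\<^sub>R v) - x) \<le> d"
      using sv s by simp
    have eq: "((x + t *\<^sub>R w) + s *\<^sub>R v) - (x + s *\<^sub>R v) = t *\<^sub>R w"
      by simp
    have "norm (?G s - hessian f x *v (t *\<^sub>R w)) \<le> (e / B) * norm (t *\<^sub>R w)"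
      using approx[OF _ n1 n2] unfolding eq by simp
    then have ap: "norm (?G s - t *\<^sub>R (hessian f x *v w)) \<le> (e / B) * (t * norm w)"
      using t by (simp add: matrix_vector_mult_scaleR)
    have "t * (v \<bullet> ?G s) - t\<^sup>2 * (v \<bullet> (hessian f x *v w)) = t * (v \<bullet> (?G s - t *\<^sub>R (hessian f x *v w)))"
      by (simp add: inner_diff_right algebra_simps power2_eq_square)
    also have "\<bar>\<dots>\<bar> \<le> t * (norm v * norm (?G s - t *\<^sub>R (hessian f x *v w)))"
      using t Cauchy_Schwarz_ineq2[of v "?G s - t *\<^sub>R (hessian f x *v w)"] by (simp add: abs_mult)
    also have "\<dots> \<le> t * (norm v * ((e / B) * (t * norm w)))"
      using t ap by (intro mult_left_mono) auto
    also have "\<dots> = e * t\<^sup>2 * ((norm v * norm w) / B)"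
      by (simp add: power2_eq_square)
    also have "\<dots> \<le> e * t\<^sup>2 * 1"
      using assms(2) B by (intro mult_left_mono) (auto simp: B_def)
    finally show ?thesis
      using s(3) by (simp add: algebra_simps)
  qed
  show ?thesis
    using eventually_at_right_less[of "0::real"] r
    by (auto simp: eventually_at_right_field intro!: exI[of _ r] main)
qed

text \<open>Schwarz's theorem: \<open>C2\<close> only provides a differentiable gradient with
  continuous Jacobian, but the symmetric second difference approximates both bilinear values up to
  any \<open>e\<close>.\<close>

lemma hessian_selfadjoint:
  assumes "C2 f"
  shows "v \<bullet> (hessian f x *v w) = (hessian f x *v v) \<bullet> w"
proof -
  let ?a = "v \<bullet> (hessian f x *v w)" and ?b = "w \<bullet> (hessian f x *v v)"
  have "\<bar>?a - ?b\<bar> \<le> e" if "0 < e" for e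
  proof -
    let ?S = "\<lambda>t v w. f (x + t *\<^sub>R v + t *\<^sub>R w) - f (x + t *\<^sub>R v) - f (x + t *\<^sub>R w) + f x"
    have "\<forall>\<^sub>F t in at_right 0. \<bar>?S t v w - t\<^sup>2 * ?a\<bar> \<le> e / 2 * t\<^sup>2 \<and>
        \<bar>?S t w v - t\<^sup>2 * ?b\<bar> \<le> e / 2 * t\<^sup>2 \<and> 0 < t"
      using second_difference[OF assms half_gt_zero[OF that], of x v w]
        second_difference[OF assms half_gt_zero[OF that], of x w v] eventually_at_right_less[of "0::real"]
      by (intro eventually_conj)
    then obtain t where t: "\<bar>?S t v w - t\<^sup>2 * ?a\<bar> \<le> e / 2 * t\<^sup>2"
        "\<bar>?S t w v - t\<^sup>2 * ?b\<bar> \<le> e / 2 * t\<^sup>2" "0 < t"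
      using eventually_happens'[OF trivial_limit_at_right_real] by blast
    have "?S t v w = ?S t w v"
      by (simp add: add.commute add.left_commute)
    then have "\<bar>t\<^sup>2 * ?a - t\<^sup>2 * ?b\<bar> \<le> e * t\<^sup>2"
      using t(1,2) by linarith
    then have "t\<^sup>2 * \<bar>?a - ?b\<bar> \<le> t\<^sup>2 * e"
      by (simp add: abs_mult mult.commute flip: right_diff_distrib)
    then show ?thesis using t(3) by (simp add: mult_le_cancel_left)
  qed
  then have "\<bar>?a - ?b\<bar> \<le> 0"
    using field_le_epsilon[of "\<bar>?a - ?b\<bar>" 0] by simp
  then show ?thesis by (simp add: inner_commute)
qed

text \<open>Difference quotients of the gradient inherit its Lipschitz constant, and the Hessian
  differs from them by an arbitrarily small error.\<close>

lemma hessian_lipschitz_bound: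
  assumes "C2 f" and L: "\<And>x y. norm (grad f x - grad f y) \<le> K * norm (x - y)"
  shows "norm (hessian f x *v v) \<le> K * norm v"
proof -
  have "norm (hessian f x *v v) \<le> K * norm v + e" if e: "0 < e" for e
  proof -
    define e' where "e' = e / (norm v + 1)"
    have e': "0 < e'" "e' * norm v \<le> e"
      using e by (auto simp: e'_def field_simps add_pos_nonneg)
    obtain d where d: "0 < d" and approx: "\<And>c y z. norm c \<le> norm x \<Longrightarrow> norm (y - c) \<le> d \<Longrightarrow>
        norm (z - c) \<le> d \<Longrightarrow> norm (grad f y - grad f z - hessian f c *v (y - z)) \<le> e' * norm (y - z)"
      using C2_grad_approx[OF assms(1) e'(1)] by metis
    define t where "t = d / (norm v + 1)"
    have t: "0 < t" "t * norm v \<le> d"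
      using d by (auto simp: t_def field_simps add_pos_nonneg)
    let ?y = "x + t *\<^sub>R v"
    have "t *\<^sub>R (hessian f x *v v) = (grad f ?y - grad f x) - (grad f ?y - grad f x - hessian f x *v (?y - x))"
      by (simp add: matrix_vector_mult_scaleR)
    also have "norm \<dots> \<le> K * norm (?y - x) + e' * norm (?y - x)"
      using norm_triangle_ineq4 approx[of x ?y x] t d L[of ?y x]
      by (smt (verit) add_diff_cancel_left' cancel_comm_monoid_add_class.diff_cancel norm_scaleR norm_zero)
    finally have "t * norm (hessian f x *v v) \<le> t * (K * norm v + e' * norm v)"
      using t by (simp add: algebra_simps)
    then show ?thesis
      using t e'(2) by (simp add: mult_le_cancel_left_pos)
  qed
  then show ?thesis by (rule field_le_epsilon)
qed

text \<open>A gradient step of length \<open>1 / (2 * K)\<close> lowers \<open>f\<close> by at least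
  \<open>(norm (grad f x))\<^sup>2 / (4 * K)\<close>, and \<open>f\<close> cannot drop below
  \<open>m\<close>. This lets the energy control the gradients.\<close>

lemma norm_grad_power2_le:
  assumes "C2 f" and L: "\<And>x y. norm (grad f x - grad f y) \<le> K * norm (x - y)" and "0 < K"
    and m: "\<And>y. m \<le> f y"
  shows "(norm (grad f x))\<^sup>2 \<le> 4 * K * (f x - m)"
proof -
  let ?g = "grad f x"
  define h where "h = 1 / (2 * K)"
  have h: "0 < h" using \<open>0 < K\<close> by (simp add: h_def)
  have "((\<lambda>s. f (x + s *\<^sub>R - ?g)) has_real_derivative - ?g \<bullet> grad f (x + s *\<^sub>R - ?g)) (at s)" for s
    by (rule C2_line_derivative[OF assms(1)])
  from MVT2[OF h this] obtain s where s: "0 < s" "s < h"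
    and eq: "f (x + h *\<^sub>R - ?g) - f x = h * (- ?g \<bullet> grad f (x + s *\<^sub>R - ?g))"
    by auto
  have "norm (grad f (x + s *\<^sub>R - ?g) - ?g) \<le> K * (s * norm ?g)"
    using L[of "x + s *\<^sub>R - ?g" x] s by simp
  also have "\<dots> \<le> K * (h * norm ?g)"
    using s \<open>0 < K\<close> by (intro mult_left_mono mult_right_mono) auto
  also have "\<dots> = norm ?g / 2"
    using \<open>0 < K\<close> by (simp add: h_def)
  finally have dg: "norm (grad f (x + s *\<^sub>R - ?g) - ?g) \<le> norm ?g / 2" .
  have "- ?g \<bullet> grad f (x + s *\<^sub>R - ?g) = - (norm ?g)\<^sup>2 - ?g \<bullet> (grad f (x + s *\<^sub>R - ?g) - ?g)"
    by (simp add: power2_norm_eq_inner inner_diff_right)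
  also have "\<dots> \<le> - (norm ?g)\<^sup>2 + norm ?g * (norm ?g / 2)"
    using Cauchy_Schwarz_ineq2[of ?g "grad f (x + s *\<^sub>R - ?g) - ?g"]
      mult_left_mono[OF dg norm_ge_zero[of ?g]] by linarith
  also have "\<dots> = - (norm ?g)\<^sup>2 / 2"
    by (simp add: power2_eq_square)
  finally have "f (x + h *\<^sub>R - ?g) - f x \<le> h * (- (norm ?g)\<^sup>2 / 2)"
    unfolding eq using h by (intro mult_left_mono) auto
  then have "m - f x \<le> h * (- (norm ?g)\<^sup>2 / 2)"
    using m[of "x + h *\<^sub>R - ?g"] by linarith
  then show ?thesis
    using \<open>0 < K\<close> by (simp add: h_def field_simps)
qed

text \<open>Coercivity enters here: it provides the constants \<open>m n\<close> that make the
  shifted energy nonnegative.\<close>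

lemma coercive_bounded_below:
  fixes f :: "real ^ 'd \<Rightarrow> real"
  assumes "coercive f" "continuous_on UNIV f"
  obtains m where "\<And>y. m \<le> f y"
proof -
  have "\<forall>\<^sub>F y in at_infinity. 0 \<le> f y"
    using assms(1) by (auto simp: coercive_def filterlim_at_top)
  then obtain b where b: "\<And>y. b \<le> norm y \<Longrightarrow> 0 \<le> f y"
    by (auto simp: eventually_at_infinity)
  have "compact (f ` cball 0 \<bar>b\<bar>)"
    using assms(2) by (intro compact_continuous_image) (auto intro: continuous_on_subset)
  then have "bounded (f ` cball 0 \<bar>b\<bar>)"
    by (rule compact_imp_bounded)
  then obtain B where B: "\<And>y. norm y \<le> \<bar>b\<bar> \<Longrightarrow> \<bar>f y\<bar> \<le> B"
    by (force simp: bounded_iff)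
  have "min 0 (- B) \<le> f y" for y
    using b[of y] B[of y] by (smt (verit))
  then show ?thesis by (rule that)
qed

section \<open>The graph Laplacian and the weights\<close>

text \<open>Positive semidefinite sign convention: the coupling term of the system is minus the
  Laplacian.\<close>

definition laplacian :: "('n \<times> 'n) set \<Rightarrow> real ^ 'd ^ 'n::finite \<Rightarrow> real ^ 'd ^ 'n" where
  "laplacian E x = (\<chi> n. \<Sum>l\<in>neighbors E n. x $ n - x $ l)"

definition consensus :: "(real ^ 'd ^ 'n) set" where
  "consensus = {x. \<forall>n l. x $ n = x $ l}"

definition mean :: "real ^ 'd ^ 'n::finite \<Rightarrow> real ^ 'd" where
  "mean x = (\<Sum>n\<in>UNIV. x $ n) /\<^sub>R real CARD('n)"

definition const :: "real ^ 'd \<Rightarrow> real ^ 'd ^ 'n" where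
  "const v = (\<chi> n. v)"

lemma const_nth [simp]: "const v $ n = v"
  by (simp add: const_def)

lemma linear_const: "linear (const :: real ^ 'd \<Rightarrow> real ^ 'd ^ 'n::finite)"
  by (rule linearI) (simp_all add: const_def vec_eq_iff)

lemma const_in_consensus [simp]: "const v \<in> consensus"
  by (simp add: consensus_def)

lemma consensusE:
  assumes "x \<in> consensus"
  obtains v where "x = const v"
proof (rule that[of "x $ undefined"])
  show "x = const (x $ undefined)"
    using assms by (auto simp: consensus_def vec_eq_iff)
qed

lemma inner_blocks: "x \<bullet> y = (\<Sum>n\<in>UNIV. x $ n \<bullet> y $ n)"
  for x y :: "real ^ 'd ^ 'n::finite"
  by (rule inner_vec_def)

lemma inner_const: "x \<bullet> const v = (\<Sum>n\<in>UNIV. x $ n) \<bullet> v"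
  by (simp add: inner_blocks inner_sum_left)

lemma norm_const: "(norm (const v :: real ^ 'd ^ 'n::finite))\<^sup>2 = real CARD('n) * (norm v)\<^sup>2"
  by (simp add: power2_norm_eq_inner inner_blocks)

lemma linear_laplacian: "linear (laplacian E)"
  by (rule linearI)
    (simp_all add: laplacian_def vec_eq_iff sum.distrib[symmetric] sum_distrib_left algebra_simps)

lemma laplacian_consensus: "x \<in> consensus \<Longrightarrow> laplacian E x = 0"
  by (auto simp: laplacian_def vec_eq_iff elim: consensusE)

lemma laplacian_const [simp]: "laplacian E (const v) = 0"
  by (simp add: laplacian_consensus)

lemma sum_neighbors: "(\<Sum>n\<in>UNIV. \<Sum>l\<in>neighbors E n. g n l) = (\<Sum>(n, l)\<in>E. g n l)"
  for E :: "('n::finite \<times> 'n) set"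
proof -
  have "Sigma UNIV (neighbors E) = E" by (auto simp: neighbors_def)
  then show ?thesis by (simp add: sum.Sigma)
qed

lemma sum_edges_swap: "sym E \<Longrightarrow> (\<Sum>(n, l)\<in>E. g n l) = (\<Sum>(n, l)\<in>E. g l n)"
  for E :: "('n::finite \<times> 'n) set"
  by (rule sum.reindex_bij_witness[of _ "\<lambda>(n, l). (l, n)" "\<lambda>(n, l). (l, n)"]) (auto dest: symD)

text \<open>The Dirichlet form. \<open>E\<close> contains both orientations of each edge, whence the
  factor 1/2.\<close>

lemma inner_laplacian:
  assumes "sym E"
  shows "x \<bullet> laplacian E y = (\<Sum>(n, l)\<in>E. (x $ n - x $ l) \<bullet> (y $ n - y $ l)) / 2"
proof -
  have "x \<bullet> laplacian E y = (\<Sum>(n, l)\<in>E. x $ n \<bullet> (y $ n - y $ l))"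
    by (simp add: laplacian_def inner_blocks inner_sum_right sum_neighbors)
  moreover have "(\<Sum>(n, l)\<in>E. x $ n \<bullet> (y $ n - y $ l)) = (\<Sum>(n, l)\<in>E. x $ l \<bullet> (y $ l - y $ n))"
    by (rule sum_edges_swap[OF assms])
  ultimately have "2 * (x \<bullet> laplacian E y)
      = (\<Sum>(n, l)\<in>E. x $ n \<bullet> (y $ n - y $ l)) + (\<Sum>(n, l)\<in>E. x $ l \<bullet> (y $ l - y $ n))"
    by simp
  also have "\<dots> = (\<Sum>(n, l)\<in>E. (x $ n - x $ l) \<bullet> (y $ n - y $ l))"
    by (simp add: sum.distrib[symmetric] split_def inner_diff_left inner_diff_right algebra_simps)
  finally show ?thesis by simp
qed

lemma laplacian_selfadjoint: "sym E \<Longrightarrow> x \<bullet> laplacian E y = laplacian E x \<bullet> y"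
  by (simp add: inner_laplacian inner_commute[of "laplacian E x"]) (simp add: inner_commute)

lemma inner_laplacian_nonneg: "sym E \<Longrightarrow> 0 \<le> x \<bullet> laplacian E x"
  by (auto simp: inner_laplacian intro!: sum_nonneg)

lemma inner_laplacian_eq_0:
  assumes "connected_simple_graph E" "x \<bullet> laplacian E x = 0"
  shows "x \<in> consensus"
proof -
  have sym: "sym E" and conn: "E\<^sup>* = UNIV"
    using assms(1) by (auto simp: connected_simple_graph_def)
  have "(\<Sum>(n, l)\<in>E. (x $ n - x $ l) \<bullet> (x $ n - x $ l)) = 0"
    using assms(2) by (simp add: inner_laplacian[OF sym])
  then have "\<forall>p\<in>E. (case p of (n, l) \<Rightarrow> (x $ n - x $ l) \<bullet> (x $ n - x $ l)) = 0"
    by (subst (asm) sum_nonneg_eq_0_iff) auto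
  then have edge: "x $ n = x $ l" if "(n, l) \<in> E" for n l
    using that by fastforce
  have "x $ n = x $ l" if "(n, l) \<in> E\<^sup>*" for n l
    using that by induction (auto dest: edge)
  then show ?thesis
    using conn by (auto simp: consensus_def)
qed

lemma mean_decomposition:
  fixes x :: "real ^ 'd ^ 'n::finite"
  shows "(\<Sum>n\<in>UNIV. (x - const (mean x)) $ n) = 0"
    and "(x - const (mean x)) \<bullet> const v = 0"
proof -
  show 0: "(\<Sum>n\<in>UNIV. (x - const (mean x)) $ n) = 0"
    by (simp add: sum_subtractf mean_def sum_constant_scaleR del: sum_constant)
  show "(x - const (mean x)) \<bullet> const v = 0"
    unfolding inner_const 0 by simp
qed

text \<open>The algebraic connectivity of the graph: a Rayleigh minimiser orthogonal to consensus
  with eigenvalue 0 would have vanishing Dirichlet form, hence be a consensus vector orthogonal to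
  itself.\<close>

lemma laplacian_spectral_gap:
  fixes E :: "('n::finite \<times> 'n) set"
  assumes "connected_simple_graph E"
  obtains c where "0 < c"
    "\<And>y :: real ^ 'd ^ 'n. (\<And>v. y \<bullet> const v = 0) \<Longrightarrow> c * (norm y)\<^sup>2 \<le> y \<bullet> laplacian E y"
proof -
  have sym: "sym E" using assms by (auto simp: connected_simple_graph_def)
  define Y where "Y = {y :: real ^ 'd ^ 'n. \<forall>v. y \<bullet> const v = 0}"
  have Y: "subspace Y"
    unfolding Y_def subspace_def by (auto simp: inner_add_left)
  have inv: "laplacian E y \<in> Y" for y :: "real ^ 'd ^ 'n"
    by (simp add: Y_def laplacian_selfadjoint[OF sym, symmetric])
  have "\<exists>c>0. \<forall>y\<in>Y. c * (norm y)\<^sup>2 \<le> y \<bullet> laplacian E y"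
  proof (cases "Y \<subseteq> {0}")
    case True
    then show ?thesis by (intro exI[of _ 1]) auto
  next
    case False
    then obtain w0 where w0: "w0 \<in> Y" "w0 \<noteq> 0" by auto
    obtain v \<mu> where v: "v \<in> Y" "norm v = 1" "laplacian E v = \<mu> *\<^sub>R v"
      and le: "\<And>y. y \<in> Y \<Longrightarrow> \<mu> * (norm y)\<^sup>2 \<le> y \<bullet> laplacian E y"
      using rayleigh_minimizer[OF linear_laplacian laplacian_selfadjoint[OF sym] Y inv w0] by metis
    have \<mu>: "v \<bullet> laplacian E v = \<mu>"
      using v by (simp add: norm_eq_1)
    have "\<mu> \<noteq> 0"
    proof
      assume "\<mu> = 0"
      then have "v \<in> consensus" using inner_laplacian_eq_0[OF assms] \<mu> by simp
      then obtain u where "v = const u" by (rule consensusE)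
      then have "v \<bullet> v = 0" using v(1) by (auto simp: Y_def)
      then show False using v(2) by simp
    qed
    then have "0 < \<mu>" using inner_laplacian_nonneg[OF sym, of v] \<mu> by simp
    then show ?thesis using le by blast
  qed
  then show ?thesis using that by (auto simp: Y_def)
qed

section \<open>The step-size weights and their ratio\<close>

lemma weight_pos: "- 1 < t \<Longrightarrow> 0 < weight \<tau> t"
  by (simp add: weight_def)

lemma continuous_on_weight_max: "continuous_on S (\<lambda>t. weight \<tau> (max 0 t))"
  unfolding weight_def by (intro continuous_intros) auto

lemma weight_le_1: "0 \<le> t \<Longrightarrow> 0 \<le> \<tau> \<Longrightarrow> weight \<tau> t \<le> 1"
  unfolding weight_def using powr_mono[of "- \<tau>" 0 "t + 1"] by simp

text \<open>A logarithm for \<open>\<tau> = 1\<close> and a power otherwise. Divergence of the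
  primitive says that the step sizes are not integrable, so a rate proportional to \<alpha> acts for
  an infinite total time.\<close>

lemma weight_primitive:
  assumes "\<tau> \<le> 1"
  obtains A where "\<And>t. -1 < t \<Longrightarrow> (A has_real_derivative weight \<tau> t) (at t)" "filterlim A at_top at_top"
proof (cases "\<tau> = 1")
  case True
  have "((\<lambda>t. ln (t + 1)) has_real_derivative weight \<tau> t) (at t)" if "-1 < t" for t
    using that True by (auto intro!: derivative_eq_intros simp: weight_def powr_minus_divide)
  moreover have "filterlim (\<lambda>t::real. ln (t + 1)) at_top at_top"
    by real_asymp
  ultimately show ?thesis using that by blast
next
  case False
  with assms have k: "0 < 1 - \<tau>" by simp
  have "((\<lambda>t. (t + 1) powr (1 - \<tau>) / (1 - \<tau>)) has_real_derivative weight \<tau> t) (at t)" if "-1 < t" for t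
    using that k by (auto intro!: derivative_eq_intros simp: weight_def)
  moreover have "filterlim (\<lambda>t::real. (t + 1) powr (1 - \<tau>) / (1 - \<tau>)) at_top at_top"
    using k by real_asymp
  ultimately show ?thesis using that by blast
qed

lemma weight_ratio:
  assumes "-1 < t"
  shows "weight \<beta> t = weight \<alpha> t * (t + 1) powr (\<alpha> - \<beta>)"
  using assms by (simp add: weight_def powr_add[symmetric])

section \<open>Hyperbolic systems\<close>

text \<open>The image is open in \<open>W\<close> by invariance of domain and closed because
  expansion pulls Cauchy sequences back to Cauchy sequences; \<open>W\<close> is connected.\<close>

lemma expanding_surj_on_subspace:
  fixes h :: "'a::euclidean_space \<Rightarrow> 'a"
  assumes W: "subspace W" and cont: "continuous_on W h" and hW: "h ` W \<subseteq> W"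
    and ex: "\<And>u v. u \<in> W \<Longrightarrow> v \<in> W \<Longrightarrow> norm (u - v) \<le> norm (h u - h v)"
  shows "h ` W = W"
proof -
  have "inj_on h W"
    by (rule inj_onI) (use ex in fastforce)
  then have "openin (top_of_set W) (h ` W)"
    using invariance_of_domain_subspaces[of W W W h] W cont hW by auto
  moreover have "closedin (top_of_set W) (h ` W)"
  proof -
    have "closed (h ` W)"
      unfolding closed_sequential_limits
    proof (intro allI impI, elim conjE)
      fix y l assume y: "\<forall>n. y n \<in> h ` W" and l: "y \<longlonglongrightarrow> l"
      then have "\<forall>n. \<exists>w. w \<in> W \<and> y n = h w" by blast
      then obtain v where v: "\<And>n. v n \<in> W" and yv: "y = (\<lambda>n. h (v n))"
        unfolding choice_iff by (auto simp: fun_eq_iff)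
      have "Cauchy y" using l by (rule LIMSEQ_imp_Cauchy)
      then have "Cauchy v"
        unfolding Cauchy_def dist_norm yv using ex[OF v v] by (meson le_less_trans)
      then obtain v' where v': "v \<longlonglongrightarrow> v'" using Cauchy_convergent convergent_def by blast
      have "v' \<in> W"
        using closed_sequentially[OF closed_subspace[OF W]] v v' by blast
      have "(\<lambda>n. h (v n)) \<longlonglongrightarrow> h v'"
        using continuous_on_tendsto_compose[OF cont v' \<open>v' \<in> W\<close>] v by simp
      then have "l = h v'"
        using l unfolding yv by (rule LIMSEQ_unique[rotated])
      then show "l \<in> h ` W" using \<open>v' \<in> W\<close> by blast
    qed
    then show ?thesis
      using hW by (rule closed_subset[rotated])
  qed
  moreover have "connected W"
    using W by (simp add: convex_connected subspace_imp_convex)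
  moreover have "h ` W \<noteq> {}"
    using subspace_0[OF W] by blast
  ultimately show ?thesis
    unfolding connected_clopen by blast
qed

text \<open>\<open>P w - a *\<^sub>R (w - P w)\<close> is half the gradient of the form
  \<open>Q a\<close> defined below. \<open>expand\<close> says that \<open>Q a\<close> grows along
  differences of solutions, and \<open>center\<close> says the same relative to \<open>X0\<close>,
  which need not be a solution; the defect \<epsilon> is at most \<open>k * e\<close> and tends to
  0.\<close>

locale hyperbolic = lipschitz_ode F K M for F :: "real \<Rightarrow> 'a::euclidean_space \<Rightarrow> 'a" and K M +
  fixes P :: "'a \<Rightarrow> 'a" and W :: "'a set" and X0 :: 'a
    and A \<alpha> \<epsilon> :: "real \<Rightarrow> real" and k e T0 :: real
  assumes W: "subspace W" and P_linear: "linear P" and P_in: "P x \<in> W"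
    and P_orth: "y \<in> W \<Longrightarrow> (x - P x) \<bullet> y = 0"
    and A_deriv: "T0 \<le> t \<Longrightarrow> (A has_real_derivative \<alpha> t) (at t)"
    and A_top: "filterlim A at_top at_top"
    and \<alpha>_pos: "T0 \<le> t \<Longrightarrow> 0 < \<alpha> t" and k_pos: "0 < k"
    and \<epsilon>_nonneg: "T0 \<le> t \<Longrightarrow> 0 \<le> \<epsilon> t" and \<epsilon>_le: "T0 \<le> t \<Longrightarrow> \<epsilon> t \<le> k * e"
    and \<epsilon>_tendsto: "(\<epsilon> \<longlongrightarrow> 0) at_top"
    and expand: "a \<in> {1, 2} \<Longrightarrow> T0 \<le> t \<Longrightarrow>
      \<alpha> t * (2 * k * (norm (x - y))\<^sup>2)
      \<le> 2 * ((P (x - y) - a *\<^sub>R ((x - y) - P (x - y))) \<bullet> (F t x - F t y))"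
    and center: "a \<in> {1, 2} \<Longrightarrow> T0 \<le> t \<Longrightarrow>
      \<alpha> t * (2 * k * (norm (x - X0))\<^sup>2 - \<epsilon> t)
      \<le> 2 * ((P (x - X0) - a *\<^sub>R ((x - X0) - P (x - X0))) \<bullet> F t x)"
begin

definition Q :: "real \<Rightarrow> 'a \<Rightarrow> real" where
  "Q a w = (norm (P w))\<^sup>2 - a * (norm (w - P w))\<^sup>2"

lemma norm_split: "(norm w)\<^sup>2 = (norm (P w))\<^sup>2 + (norm (w - P w))\<^sup>2"
  by (rule norm_power2_decomposition[OF P_orth[OF P_in]])

text \<open>This identity is the purpose of the two weights: an upper bound of \<open>Q 1\<close>
  and a lower bound of \<open>Q 2\<close> together bound the norm.\<close>

lemma norm_Q: "(norm w)\<^sup>2 = 3 * Q 1 w - 2 * Q 2 w"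
  by (simp add: norm_split[of w] Q_def)

lemma Q_bound: "a \<in> {1, 2} \<Longrightarrow> \<bar>Q a w\<bar> \<le> 2 * (norm w)\<^sup>2"
  by (auto simp: norm_split[of w] Q_def abs_le_iff)

lemma P_bounded_linear: "bounded_linear P"
  using P_linear by (simp add: linear_conv_bounded_linear)

lemma P_idem: "w \<in> W \<Longrightarrow> P w = w"
  using P_orth[of "w - P w" w] W P_in[of w] by (simp add: subspace_diff)

lemma P_diff: "P (x - y) = P x - P y"
  by (rule linear_diff[OF P_linear])

lemma continuous_on_Q: "continuous_on S w \<Longrightarrow> continuous_on S (\<lambda>t. Q a (w t))"
  unfolding Q_def by (intro continuous_intros bounded_linear.continuous_on[OF P_bounded_linear])

lemma Q_deriv:
  assumes "(w has_vector_derivative w') (at t)"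
  shows "((\<lambda>t. Q a (w t)) has_real_derivative 2 * ((P (w t) - a *\<^sub>R (w t - P (w t))) \<bullet> w')) (at t)"
proof -
  have Pd: "((\<lambda>t. P (w t)) has_vector_derivative P w') (at t)"
    by (rule bounded_linear.has_vector_derivative[OF P_bounded_linear assms])
  have "((\<lambda>t. Q a (w t)) has_real_derivative
      2 * (P (w t) \<bullet> P w') - a * (2 * ((w t - P (w t)) \<bullet> (w' - P w')))) (at t)"
    unfolding Q_def
    by (intro DERIV_diff DERIV_cmult has_real_derivative_norm_power2 has_vector_derivative_diff Pd assms)
  also have "P (w t) \<bullet> P w' = P (w t) \<bullet> w'"
    using P_orth[OF P_in, of w' "w t"] by (simp add: inner_diff_left inner_diff_right inner_commute)
  also have "(w t - P (w t)) \<bullet> (w' - P w') = (w t - P (w t)) \<bullet> w'"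
    using P_orth[OF P_in, of "w t" w'] by (simp add: inner_diff_right)
  finally show ?thesis
    by (simp add: inner_diff_left algebra_simps)
qed

lemma A_continuous_on: "T0 \<le> s \<Longrightarrow> continuous_on {s..t} A"
  by (intro continuous_at_imp_continuous_on ballI DERIV_isCont[OF A_deriv]) auto

lemma exp_A_top: "filterlim (\<lambda>t. exp (k * A t - k * A s)) at_top at_top"
proof -
  have "filterlim (\<lambda>t. - (k * A s) + k * A t) at_top at_top"
    by (intro filterlim_tendsto_add_at_top[OF tendsto_const]
        filterlim_tendsto_pos_mult_at_top[OF tendsto_const k_pos A_top])
  then show ?thesis
    using filterlim_compose[OF exp_at_top] by (simp add: algebra_simps)
qed

lemma growth_upper:
  assumes "T0 \<le> s" "s \<le> t" "\<And>u. (q has_real_derivative q' u) (at u)"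
    and "\<And>u. s \<le> u \<Longrightarrow> \<alpha> u * (k * (q u - c)) \<le> q' u"
  shows "(q s - c) * exp (k * A t - k * A s) \<le> q t - c"
proof (rule gronwall_lower[where \<alpha> = "\<lambda>u. k * \<alpha> u" and g' = q'])
  show "continuous_on {s..t} (\<lambda>u. q u - c)"
    by (intro continuous_at_imp_continuous_on ballI continuous_diff continuous_const DERIV_isCont[OF assms(3)])
  show "((\<lambda>u. q u - c) has_real_derivative q' u) (at u)" for u
    using DERIV_diff[OF assms(3)[of u] DERIV_const[of c]] by simp
  show "((\<lambda>u. k * A u) has_real_derivative k * \<alpha> u) (at u)" if "s < u" for u
    using A_deriv[of u] assms(1) that by (intro DERIV_cmult) auto
  show "k * \<alpha> u * (q u - c) \<le> q' u" if "s < u" for u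
    using assms(4)[of u] that by (simp add: mult_ac)
qed (use assms A_continuous_on in \<open>auto intro!: continuous_intros\<close>)

text \<open>A nonnegative \<open>q + c\<close> stays nonnegative, and a negative one is forced back
  towards 0 at rate \<open>k\<close> in the clock \<open>A\<close>.\<close>

lemma growth_lower:
  assumes "T0 \<le> s" "s \<le> t" "\<And>u. (q has_real_derivative q' u) (at u)"
    and "\<And>u. s \<le> u \<Longrightarrow> \<alpha> u * (k * (- q u - c)) \<le> q' u"
  shows "(q s + c) * exp (k * A s - k * A t) \<le> q t + c"
proof -
  have "(q s + c) * exp (- k * A t - - k * A s) \<le> q t + c"
  proof (rule gronwall_lower[where \<alpha> = "\<lambda>u. - k * \<alpha> u" and g' = q'])
    show "continuous_on {s..t} (\<lambda>u. q u + c)"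
      by (intro continuous_at_imp_continuous_on ballI continuous_add continuous_const DERIV_isCont[OF assms(3)])
    show "((\<lambda>u. q u + c) has_real_derivative q' u) (at u)" for u
      using DERIV_add[OF assms(3)[of u] DERIV_const[of c]] by simp
    show "((\<lambda>u. - k * A u) has_real_derivative - k * \<alpha> u) (at u)" if "s < u" for u
      using A_deriv[of u] assms(1) that by (intro DERIV_cmult) auto
    show "- k * \<alpha> u * (q u + c) \<le> q' u" if "s < u" for u
      using assms(4)[of u] that by (simp add: algebra_simps)
  qed (use assms A_continuous_on in \<open>auto intro!: continuous_intros\<close>)
  then show ?thesis by simp
qed

text \<open>An excess of \<open>q\<close> over \<open>c\<close> would be amplified by
  \<open>exp (k * A t)\<close>, which is unbounded.\<close>

lemma growth_bounded:
  assumes "T0 \<le> s" "\<And>u. (q has_real_derivative q' u) (at u)"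
    and "\<And>u. s \<le> u \<Longrightarrow> \<alpha> u * (k * (q u - c)) \<le> q' u"
    and bd: "\<And>u. s \<le> u \<Longrightarrow> q u \<le> B"
  shows "q s \<le> c"
proof (rule ccontr)
  assume "\<not> q s \<le> c"
  then have pos: "0 < q s - c" by simp
  have "filterlim (\<lambda>t. (q s - c) * exp (k * A t - k * A s)) at_top at_top"
    using pos exp_A_top[of s]
    by (intro filterlim_tendsto_pos_mult_at_top[OF tendsto_const]) auto
  then have "\<forall>\<^sub>F t in at_top. B - c < (q s - c) * exp (k * A t - k * A s)"
    by (simp add: filterlim_at_top_dense)
  with eventually_ge_at_top[of s]
  have "\<forall>\<^sub>F t in at_top. s \<le> t \<and> B - c < (q s - c) * exp (k * A t - k * A s)"
    by (rule eventually_conj)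
  then obtain t where t: "s \<le> t" "B - c < (q s - c) * exp (k * A t - k * A s)"
    using eventually_happens'[OF trivial_limit_at_top_linorder] by blast
  then show False
    using growth_upper[OF assms(1) t(1) assms(2,3)] bd[of t] by linarith
qed

section \<open>Differences, stability and convergence of bounded solutions\<close>

definition bounded_from :: "real \<Rightarrow> 'a \<Rightarrow> bool" where
  "bounded_from T x \<longleftrightarrow> (\<exists>B. \<forall>t\<ge>T. norm (flow T t x - X0) \<le> B)"

lemma diff_deriv:
  "((\<lambda>t. flow T t x - flow T t y) has_vector_derivative F t (flow T t x) - F t (flow T t y)) (at t)"
  by (intro has_vector_derivative_diff flow_deriv)

text \<open>The absolute value serves two purposes: monotonicity of \<open>Q a\<close> whatever its
  sign, and exponential growth of positive values.\<close>

lemma Q_diff_growth: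
  assumes "a \<in> {1, 2}" "T0 \<le> t"
  shows "\<alpha> t * (k * \<bar>Q a (x - y)\<bar>) \<le> 2 * ((P (x - y) - a *\<^sub>R ((x - y) - P (x - y))) \<bullet> (F t x - F t y))"
proof -
  have "k * \<bar>Q a (x - y)\<bar> \<le> k * (2 * (norm (x - y))\<^sup>2)"
    using Q_bound[OF assms(1)] k_pos by (intro mult_left_mono) auto
  then have "\<alpha> t * (k * \<bar>Q a (x - y)\<bar>) \<le> \<alpha> t * (2 * k * (norm (x - y))\<^sup>2)"
    using \<alpha>_pos[OF assms(2)] by (intro mult_left_mono) auto
  then show ?thesis using expand[OF assms] by (rule order_trans)
qed

lemma Q_center_growth:
  assumes "a \<in> {1, 2}" "T0 \<le> t"
  shows "\<alpha> t * (k * \<bar>Q a (x - X0)\<bar> - \<epsilon> t) \<le> 2 * ((P (x - X0) - a *\<^sub>R ((x - X0) - P (x - X0))) \<bullet> F t x)"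
proof -
  have "k * \<bar>Q a (x - X0)\<bar> \<le> k * (2 * (norm (x - X0))\<^sup>2)"
    using Q_bound[OF assms(1)] k_pos by (intro mult_left_mono) auto
  then have "\<alpha> t * (k * \<bar>Q a (x - X0)\<bar> - \<epsilon> t) \<le> \<alpha> t * (2 * k * (norm (x - X0))\<^sup>2 - \<epsilon> t)"
    using \<alpha>_pos[OF assms(2)] by (intro mult_left_mono) auto
  then show ?thesis using center[OF assms] by (rule order_trans)
qed

lemma Q_diff_mono:
  assumes "a \<in> {1, 2}" "T0 \<le> s" "s \<le> t"
  shows "Q a (flow T s x - flow T s y) \<le> Q a (flow T t x - flow T t y)"
proof (rule DERIV_nonneg_imp_nondecreasing[OF assms(3)])
  fix u assume "s \<le> u" "u \<le> t"
  then have u: "T0 \<le> u" using assms by simp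
  have "0 \<le> \<alpha> u * (k * \<bar>Q a (flow T u x - flow T u y)\<bar>)"
    using \<alpha>_pos[OF u] k_pos by simp
  then show "\<exists>y'. ((\<lambda>t. Q a (flow T t x - flow T t y)) has_real_derivative y') (at u) \<and> 0 \<le> y'"
    using Q_deriv[OF diff_deriv[of T x y u], of a]
      Q_diff_growth[OF assms(1) u, of "flow T u x" "flow T u y"] order_trans by blast
qed

text \<open>A positive value would grow without bound, but two bounded solutions have a bounded
  difference. For \<open>a = 1\<close> this is the cone
  \<open>norm (P w) \<le> norm (w - P w)\<close>, from which the graph property and the
  transversality are drawn.\<close>

lemma Q_diff_nonpos:
  assumes a: "a \<in> {1, 2}" and T: "T0 \<le> T" and b: "bounded_from T x" "bounded_from T y" and "T \<le> t"
  shows "Q a (flow T t x - flow T t y) \<le> 0"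
proof -
  obtain B C where B: "\<And>t. T \<le> t \<Longrightarrow> norm (flow T t x - X0) \<le> B"
    and C: "\<And>t. T \<le> t \<Longrightarrow> norm (flow T t y - X0) \<le> C"
    using b unfolding bounded_from_def by blast
  have "norm (flow T u x - flow T u y) \<le> B + C" if "T \<le> u" for u
    using norm_triangle_ineq4[of "flow T u x - X0" "flow T u y - X0"] B[OF that] C[OF that] by simp
  then have bd: "Q a (flow T u x - flow T u y) \<le> 2 * (B + C)\<^sup>2" if "T \<le> u" for u
    using Q_bound[OF a, of "flow T u x - flow T u y"] power_mono[of "norm (flow T u x - flow T u y)" "B + C" 2] that
    by fastforce
  show ?thesis
  proof (rule growth_bounded[where B = "2 * (B + C)\<^sup>2", OF _ Q_deriv[OF diff_deriv]])
    fix u assume "t \<le> u"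
    then have u: "T0 \<le> u" "T \<le> u" using assms by auto
    have "\<alpha> u * (k * (Q a (flow T u x - flow T u y) - 0)) \<le> \<alpha> u * (k * \<bar>Q a (flow T u x - flow T u y)\<bar>)"
      using \<alpha>_pos[OF u(1)] k_pos by (intro mult_left_mono) auto
    then show "\<alpha> u * (k * (Q a (flow T u x - flow T u y) - 0)) \<le>
       2 * ((P (flow T u x - flow T u y) - a *\<^sub>R (flow T u x - flow T u y - P (flow T u x - flow T u y))) \<bullet>
       (F u (flow T u x) - F u (flow T u y)))"
      using Q_diff_growth[OF a u(1)] by (rule order_trans)
    show "Q a (flow T u x - flow T u y) \<le> 2 * (B + C)\<^sup>2" using bd u by blast
  qed (use assms in auto)
qed

text \<open>\<open>Q 1\<close> of the difference is nonpositive and \<open>Q 2\<close> is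
  nondecreasing, so \<open>- 2 * Q 2\<close> at the initial time bounds the squared norm for ever:
  forward stability within the set of bounded solutions.\<close>

lemma bounded_diff_le:
  assumes T: "T0 \<le> T" and b: "bounded_from T x" "bounded_from T y" and t: "T \<le> t"
  shows "norm (flow T t x - flow T t y) \<le> 2 * norm (x - y)"
proof -
  let ?d = "\<lambda>t. flow T t x - flow T t y"
  have "(norm (?d t))\<^sup>2 = 3 * Q 1 (?d t) - 2 * Q 2 (?d t)" by (rule norm_Q)
  also have "\<dots> \<le> - 2 * Q 2 (?d t)"
    using Q_diff_nonpos[OF _ T b t, of 1] by simp
  also have "\<dots> \<le> - 2 * Q 2 (?d T)"
    using Q_diff_mono[of 2 T t T x y] T t by simp
  also have "\<dots> \<le> 2 * (2 * (norm (x - y))\<^sup>2)"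
    using Q_bound[of 2 "?d T"] by (simp add: abs_le_iff)
  finally show ?thesis
    by - (rule power2_le_imp_le, simp_all add: power_mult_distrib)
qed

lemma e_nonneg: "0 \<le> e"
proof -
  have "0 \<le> k * e" using \<epsilon>_nonneg[of T0] \<epsilon>_le[of T0] by simp
  then show ?thesis using k_pos by (simp add: zero_le_mult_iff)
qed

lemma center_deriv:
  "((\<lambda>t. flow T t x - X0) has_vector_derivative F t (flow T t x)) (at t)"
  using has_vector_derivative_diff[OF flow_deriv has_vector_derivative_const[of X0], of T x t] by simp

lemma Q_center_upper_growth:
  assumes "a \<in> {1, 2}" "T0 \<le> t" "\<epsilon> t \<le> k * c"
  shows "\<alpha> t * (k * (Q a (x - X0) - c)) \<le> 2 * ((P (x - X0) - a *\<^sub>R ((x - X0) - P (x - X0))) \<bullet> F t x)"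
proof -
  have "k * Q a (x - X0) \<le> k * \<bar>Q a (x - X0)\<bar>"
    using k_pos by (intro mult_left_mono) auto
  then have "k * (Q a (x - X0) - c) \<le> k * \<bar>Q a (x - X0)\<bar> - \<epsilon> t"
    using assms(3) by (simp add: right_diff_distrib)
  then have "\<alpha> t * (k * (Q a (x - X0) - c)) \<le> \<alpha> t * (k * \<bar>Q a (x - X0)\<bar> - \<epsilon> t)"
    using \<alpha>_pos[OF assms(2)] by (intro mult_left_mono) auto
  then show ?thesis using Q_center_growth[OF assms(1,2)] by (rule order_trans)
qed

lemma Q_center_lower_growth:
  assumes "a \<in> {1, 2}" "T0 \<le> t" "\<epsilon> t \<le> k * c"
  shows "\<alpha> t * (k * (- Q a (x - X0) - c)) \<le> 2 * ((P (x - X0) - a *\<^sub>R ((x - X0) - P (x - X0))) \<bullet> F t x)"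
proof -
  have "k * - Q a (x - X0) \<le> k * \<bar>Q a (x - X0)\<bar>"
    using k_pos by (intro mult_left_mono) auto
  then have "k * (- Q a (x - X0) - c) \<le> k * \<bar>Q a (x - X0)\<bar> - \<epsilon> t"
    using assms(3) by (simp only: right_diff_distrib)
  then have "\<alpha> t * (k * (- Q a (x - X0) - c)) \<le> \<alpha> t * (k * \<bar>Q a (x - X0)\<bar> - \<epsilon> t)"
    using \<alpha>_pos[OF assms(2)] by (intro mult_left_mono) auto
  then show ?thesis using Q_center_growth[OF assms(1,2)] by (rule order_trans)
qed

text \<open>Once the defect is below \<open>k * c\<close>, boundedness keeps \<open>Q a\<close>
  below \<open>c\<close>, and the lower growth estimate eventually brings it above
  \<open>- 2 * c\<close>.\<close>

lemma Q_center_tendsto_0: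
  assumes a: "a \<in> {1, 2}" and T: "T0 \<le> T" and b: "bounded_from T x"
  shows "((\<lambda>t. Q a (flow T t x - X0)) \<longlongrightarrow> 0) at_top"
proof (rule tendstoI)
  fix \<eta> :: real assume \<eta>: "0 < \<eta>"
  let ?q = "\<lambda>t. Q a (flow T t x - X0)"
  define c where "c = \<eta> / 4"
  have c: "0 < c" using \<eta> by (simp add: c_def)
  obtain B where B: "\<And>t. T \<le> t \<Longrightarrow> norm (flow T t x - X0) \<le> B"
    using b unfolding bounded_from_def by blast
  have bd: "?q t \<le> 2 * B\<^sup>2" if "T \<le> t" for t
    using Q_bound[OF a, of "flow T t x - X0"] power_mono[OF B[OF that] norm_ge_zero, of 2] by linarith
  have "\<forall>\<^sub>F t in at_top. \<epsilon> t < k * c"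
    using order_tendstoD(2)[OF \<epsilon>_tendsto] k_pos c by simp
  then obtain T1' where T1': "\<And>t. T1' \<le> t \<Longrightarrow> \<epsilon> t < k * c"
    by (auto simp: eventually_at_top_linorder)
  define T1 where "T1 = max T T1'"
  have T1: "T0 \<le> t" "T \<le> t" "\<epsilon> t \<le> k * c" if "T1 \<le> t" for t
    using that T T1'[of t] by (auto simp: T1_def)
  have up: "?q s \<le> c" if "T1 \<le> s" for s
    by (rule growth_bounded[where B = "2 * B\<^sup>2", OF _ Q_deriv[OF center_deriv]])
      (use that T1 bd in \<open>auto intro!: Q_center_upper_growth[OF a]\<close>)
  have low: "(?q T1 + c) * exp (k * A T1 - k * A t) \<le> ?q t + c" if "T1 \<le> t" for t
    by (rule growth_lower[OF _ that Q_deriv[OF center_deriv]])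
      (use that T1 in \<open>auto intro!: Q_center_lower_growth[OF a]\<close>)
  have "((\<lambda>t. inverse (exp (k * A t - k * A T1))) \<longlongrightarrow> 0) at_top"
    by (rule tendsto_inverse_0_at_top[OF exp_A_top])
  then have "((\<lambda>t. (?q T1 + c) * exp (k * A T1 - k * A t)) \<longlongrightarrow> (?q T1 + c) * 0) at_top"
    by (intro tendsto_intros) (simp add: exp_minus[symmetric])
  then have "\<forall>\<^sub>F t in at_top. - c < (?q T1 + c) * exp (k * A T1 - k * A t)"
    using order_tendstoD(1)[of _ 0 at_top "- c"] c by simp
  then show "\<forall>\<^sub>F t in at_top. dist (?q t) 0 < \<eta>"
    using eventually_ge_at_top[of T1]
  proof eventually_elim
    case (elim t)
    then show ?case using up[of t] low[of t] c by (simp add: dist_real_def c_def abs_less_iff)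
  qed
qed

lemma bounded_from_tendsto:
  assumes "T0 \<le> T" "bounded_from T x"
  shows "((\<lambda>t. flow T t x) \<longlongrightarrow> X0) at_top"
proof -
  have "((\<lambda>t. 3 * Q 1 (flow T t x - X0) - 2 * Q 2 (flow T t x - X0)) \<longlongrightarrow> 3 * 0 - 2 * 0) at_top"
    by (intro tendsto_diff tendsto_mult tendsto_const Q_center_tendsto_0 assms) auto
  then have "((\<lambda>t. (norm (flow T t x - X0))\<^sup>2) \<longlongrightarrow> 0) at_top"
    by (simp add: norm_Q)
  then have "((\<lambda>t. sqrt ((norm (flow T t x - X0))\<^sup>2)) \<longlongrightarrow> sqrt 0) at_top"
    by (rule tendsto_real_sqrt)
  then have "((\<lambda>t. flow T t x - X0) \<longlongrightarrow> 0) at_top"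
    by (simp add: tendsto_norm_zero_iff)
  then show ?thesis by (simp add: LIM_zero_iff)
qed

section \<open>Shooting and the stable graph\<close>

lemma Q_add:
  assumes "P p = 0" "v \<in> W"
  shows "Q a (p + v) = (norm v)\<^sup>2 - a * (norm p)\<^sup>2"
  using assms by (simp add: Q_def linear_add[OF P_linear] P_idem)

text \<open>For initial values that differ by a vector of \<open>W\<close>, \<open>Q 1\<close> of
  the difference starts as the squared norm and does not decrease, so the \<open>W\<close>-component
  at time \<open>t\<close> is an expanding function of \<open>v\<close>.\<close>

lemma hit_complement:
  assumes T: "T0 \<le> T" "T \<le> t" and p: "P p = 0"
  obtains v where "v \<in> W" "P (flow T t (X0 + p + v) - X0) = 0"
proof -
  let ?h = "\<lambda>v. P (flow T t (X0 + p + v) - X0)"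
  have "?h ` W = W"
  proof (rule expanding_surj_on_subspace[OF W])
    have "continuous_on W (\<lambda>v. flow T t (X0 + p + v))"
      by (rule continuous_on_compose2[OF continuous_on_flow[of UNIV]]) (auto intro!: continuous_intros)
    then show "continuous_on W ?h"
      by (intro bounded_linear.continuous_on[OF P_bounded_linear] continuous_intros)
    show "?h ` W \<subseteq> W" using P_in by blast
    fix u v assume uv: "u \<in> W" "v \<in> W"
    let ?d = "\<lambda>s. flow T s (X0 + p + u) - flow T s (X0 + p + v)"
    have "P (u - v) = u - v"
      using uv W by (intro P_idem subspace_diff)
    then have "(norm (u - v))\<^sup>2 = Q 1 (?d T)"
      by (simp add: Q_def)
    also have "\<dots> \<le> Q 1 (?d t)"
      using Q_diff_mono[of 1 T t T "X0 + p + u" "X0 + p + v"] T by simp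
    also have "\<dots> \<le> (norm (P (?d t)))\<^sup>2"
      by (simp add: Q_def)
    also have "P (?d t) = ?h u - ?h v"
      by (simp add: P_diff[symmetric])
    finally show "norm (u - v) \<le> norm (?h u - ?h v)"
      by (rule power2_le_imp_le) simp
  qed
  moreover have "0 \<in> W" by (rule subspace_0[OF W])
  ultimately show ?thesis using that by (metis (no_types, lifting) imageE)
qed

text \<open>The hitting times recede to infinity and a limit of the initial values is taken. The
  bound adds \<open>3 * e\<close> from \<open>Q 1\<close> to
  \<open>2 * (e + 2 * (norm p)\<^sup>2)\<close> from \<open>Q 2\<close>, combined by
  \<open>norm_Q\<close>.\<close>

lemma stable_point_exists:
  assumes T: "T0 \<le> T" and p: "P p = 0"
  obtains v where "v \<in> W"
    "\<And>t. T \<le> t \<Longrightarrow> (norm (flow T t (X0 + p + v) - X0))\<^sup>2 \<le> 5 * e + 4 * (norm p)\<^sup>2"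
proof -
  let ?w = "\<lambda>v t. flow T t (X0 + p + v) - X0"
  have "\<forall>n. \<exists>v. v \<in> W \<and> P (?w v (T + real n)) = 0"
  proof
    fix n
    show "\<exists>v. v \<in> W \<and> P (?w v (T + real n)) = 0"
      using hit_complement[OF T _ p, of "T + real n"] by auto
  qed
  then obtain v where vW: "\<And>n. v n \<in> W" and v0: "\<And>n. P (?w (v n) (T + real n)) = 0"
    unfolding choice_iff by blast
  \<comment> \<open>If \<open>Q 1\<close> exceeded \<open>e\<close> before the hitting time it would
    still do so there, but the vanishing \<open>W\<close>-component makes it nonpositive.\<close>
  have Q1: "Q 1 (?w (v n) t) \<le> e" if t: "T \<le> t" "t \<le> T + real n" for n t
  proof (rule ccontr)
    assume "\<not> Q 1 (?w (v n) t) \<le> e"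
    then have "0 < (Q 1 (?w (v n) t) - e) * exp (k * A (T + real n) - k * A t)"
      by simp
    also have "\<dots> \<le> Q 1 (?w (v n) (T + real n)) - e"
    proof (rule growth_upper[OF _ t(2) Q_deriv[OF center_deriv]])
      fix u assume "t \<le> u"
      then show "\<alpha> u * (k * (Q 1 (?w (v n) u) - e)) \<le>
        2 * ((P (?w (v n) u) - 1 *\<^sub>R (?w (v n) u - P (?w (v n) u))) \<bullet> F u (flow T u (X0 + p + v n)))"
        using \<epsilon>_le[of u] T t by (intro Q_center_upper_growth) auto
    qed (use T t in auto)
    also have "\<dots> \<le> - e"
      using v0[of n] by (simp add: Q_def)
    finally show False using e_nonneg by simp
  qed
  \<comment> \<open>At time \<open>T\<close> the bound on \<open>Q 1\<close> confines the shooting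
    parameters to a compact set that does not depend on the hitting time.\<close>
  have "v n \<in> cball 0 (sqrt (e + (norm p)\<^sup>2)) \<inter> W" for n
  proof -
    have "(norm (v n))\<^sup>2 \<le> e + (norm p)\<^sup>2"
      using Q1[of T n] Q_add[OF p vW[of n], of 1] by (simp add: add.assoc)
    then show ?thesis using vW by (simp add: real_le_rsqrt)
  qed
  moreover have "compact (cball 0 (sqrt (e + (norm p)\<^sup>2)) \<inter> W)"
    by (intro compact_Int_closed compact_cball closed_subspace W)
  ultimately obtain l r where l: "l \<in> W" and r: "strict_mono (r :: nat \<Rightarrow> nat)" and lim: "(v \<circ> r) \<longlonglongrightarrow> l"
    unfolding compact_def by blast
  have Q1l: "Q 1 (?w l t) \<le> e" if t: "T \<le> t" for t
  proof -
    have "continuous_on UNIV (\<lambda>v. flow T t (X0 + p + v))"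
      by (rule continuous_on_compose2[OF continuous_on_flow[of UNIV]]) (auto intro!: continuous_intros)
    then have "continuous_on UNIV (\<lambda>v. Q 1 (?w v t))"
      by (intro continuous_on_Q continuous_intros)
    then have "(\<lambda>n. Q 1 (?w ((v \<circ> r) n) t)) \<longlonglongrightarrow> Q 1 (?w l t)"
      using lim by (rule continuous_on_tendsto_compose) auto
    moreover have "\<forall>\<^sub>F n in sequentially. Q 1 (?w ((v \<circ> r) n) t) \<le> e"
    proof -
      obtain N where N: "t - T \<le> real N" using real_arch_simple by blast
      show ?thesis
        unfolding eventually_sequentially
      proof (intro exI[of _ N] allI impI)
        fix n assume "N \<le> n"
        then have "N \<le> r n" using seq_suble[OF r, of n] by simp
        then show "Q 1 (?w ((v \<circ> r) n) t) \<le> e" using Q1[of t "r n"] N t by simp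
      qed
    qed
    ultimately show ?thesis by (rule tendsto_upperbound) simp
  qed
  \<comment> \<open>At time \<open>T\<close> the form \<open>Q 2\<close> equals
    \<open>(norm l)\<^sup>2 - 2 * (norm p)\<^sup>2\<close>; the summand \<open>e\<close> covers the
    defect.\<close>
  define c where "c = e + 2 * (norm p)\<^sup>2"
  have Q2l: "- c \<le> Q 2 (?w l t)" if t: "T \<le> t" for t
  proof -
    have "0 \<le> Q 2 (?w l T) + c"
      using Q_add[OF p l, of 2] e_nonneg by (simp add: c_def add.assoc)
    then have "0 \<le> (Q 2 (?w l T) + c) * exp (k * A T - k * A t)" by simp
    also have "\<dots> \<le> Q 2 (?w l t) + c"
    proof (rule growth_lower[OF T t Q_deriv[OF center_deriv]])
      fix u assume "T \<le> u"
      then have "T0 \<le> u" using T by simp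
      moreover have "k * e \<le> k * c" using k_pos by (intro mult_left_mono) (auto simp: c_def)
      ultimately show "\<alpha> u * (k * (- Q 2 (?w l u) - c)) \<le>
        2 * ((P (?w l u) - 2 *\<^sub>R (?w l u - P (?w l u))) \<bullet> F u (flow T u (X0 + p + l)))"
        using \<epsilon>_le[of u] by (intro Q_center_lower_growth) auto
    qed
    finally show ?thesis by simp
  qed
  show ?thesis
  proof (rule that[OF l])
    fix t assume t: "T \<le> t"
    show "(norm (?w l t))\<^sup>2 \<le> 5 * e + 4 * (norm p)\<^sup>2"
      using Q1l[OF t] Q2l[OF t] unfolding norm_Q c_def by simp
  qed
qed

text \<open>\<open>\<phi>\<close> picks a bounded solution over each \<open>p\<close>; the cone
  condition shows that there is no other choice and that \<open>\<phi>\<close> is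
  1-Lipschitz.\<close>

lemma stable_graph:
  assumes T: "T0 \<le> T"
  obtains \<phi> where "\<And>p. P p = 0 \<Longrightarrow> \<phi> p \<in> W" "\<And>p. P p = 0 \<Longrightarrow> bounded_from T (X0 + p + \<phi> p)"
    "\<And>x. bounded_from T x \<Longrightarrow> x = X0 + ((x - X0) - P (x - X0)) + \<phi> ((x - X0) - P (x - X0))"
    "continuous_on {p. P p = 0} \<phi>"
proof -
  have "\<exists>v. v \<in> W \<and> bounded_from T (X0 + p + v)" if p: "P p = 0" for p
  proof -
    obtain v where v: "v \<in> W" "\<And>t. T \<le> t \<Longrightarrow> (norm (flow T t (X0 + p + v) - X0))\<^sup>2 \<le> 5 * e + 4 * (norm p)\<^sup>2"
      using stable_point_exists[OF T p] by blast
    then have "bounded_from T (X0 + p + v)"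
      unfolding bounded_from_def using real_le_rsqrt by blast
    then show ?thesis using v by blast
  qed
  then obtain \<phi> where \<phi>: "\<And>p. P p = 0 \<Longrightarrow> \<phi> p \<in> W \<and> bounded_from T (X0 + p + \<phi> p)"
    by metis
  have lip: "norm (v - v') \<le> norm (p - p')"
    if "P p = 0" "P p' = 0" "v \<in> W" "v' \<in> W"
      "bounded_from T (X0 + p + v)" "bounded_from T (X0 + p' + v')" for p p' v v'
  proof -
    have "(norm (v - v'))\<^sup>2 - 1 * (norm (p - p'))\<^sup>2 = Q 1 ((p - p') + (v - v'))"
      using that W by (intro Q_add[symmetric] subspace_diff) (auto simp: P_diff)
    also have "(p - p') + (v - v') = flow T T (X0 + p + v) - flow T T (X0 + p' + v')"
      by simp
    also have "Q 1 \<dots> \<le> 0"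
      by (rule Q_diff_nonpos) (use that T in auto)
    finally show ?thesis
      by - (rule power2_le_imp_le, simp_all)
  qed
  show ?thesis
  proof (rule that)
    show "\<phi> p \<in> W" "bounded_from T (X0 + p + \<phi> p)" if "P p = 0" for p
      using \<phi>[OF that] by auto
    fix x assume x: "bounded_from T x"
    define v where "v = P (x - X0)"
    define p where "p = (x - X0) - v"
    have vW: "v \<in> W"
      unfolding v_def by (rule P_in)
    then have p0: "P p = 0"
      by (simp add: p_def P_diff[of _ v] P_idem flip: v_def)
    have xe: "x = X0 + p + v" by (simp add: p_def)
    have "norm (v - \<phi> p) \<le> norm (p - p)"
      by (rule lip) (use p0 vW x xe \<phi> in auto)
    then show "x = X0 + ((x - X0) - P (x - X0)) + \<phi> ((x - X0) - P (x - X0))"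
      using xe unfolding v_def[symmetric] p_def[symmetric] by simp
  next
    have "1-lipschitz_on {p. P p = 0} \<phi>"
      using \<phi> by (intro lipschitz_onI) (auto simp: dist_norm intro!: lip)
    then show "continuous_on {p. P p = 0} \<phi>"
      by (rule lipschitz_on_continuous_on)
  qed
qed

end

section \<open>The energy of the distributed flow\<close>

lemma norm_le_componentwise:
  fixes x y :: "real ^ 'd ^ 'n::finite"
  assumes "0 \<le> K" "\<And>n. norm (x $ n) \<le> K * norm (y $ n)"
  shows "norm x \<le> K * norm y"
proof -
  have "norm x \<le> L2_set (\<lambda>n. K * norm (y $ n)) UNIV"
    unfolding norm_vec_def[of x] using assms by (intro L2_set_mono) auto
  also have "\<dots> = K * norm y"
    using assms(1) by (simp add: L2_set_right_distrib norm_vec_def)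
  finally show ?thesis .
qed

lemma norm_power2_blocks: "(norm x)\<^sup>2 = (\<Sum>n\<in>UNIV. (norm (x $ n))\<^sup>2)"
  for x :: "real ^ 'd ^ 'n::finite"
  by (simp add: power2_norm_eq_inner inner_blocks)

lemma has_vector_derivative_blocks:
  fixes x :: "real \<Rightarrow> real ^ 'd ^ 'n::finite"
  shows "(x has_vector_derivative D) (at t within S) \<longleftrightarrow>
    (\<forall>n. ((\<lambda>s. x s $ n) has_vector_derivative D $ n) (at t within S))"
proof
  assume "(x has_vector_derivative D) (at t within S)"
  then show "\<forall>n. ((\<lambda>s. x s $ n) has_vector_derivative D $ n) (at t within S)"
    by (intro allI bounded_linear.has_vector_derivative[OF bounded_linear_vec_nth])
next
  assume x: "\<forall>n. ((\<lambda>s. x s $ n) has_vector_derivative D $ n) (at t within S)"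
  show "(x has_vector_derivative D) (at t within S)"
    unfolding has_vector_derivative_def
  proof (subst has_derivative_componentwise_within, rule ballI)
    fix i :: "real ^ 'd ^ 'n" assume "i \<in> Basis"
    then obtain n b where i: "i = axis n b" by (auto simp: Basis_vec_def)
    have "((\<lambda>s. x s $ n) has_derivative (\<lambda>h. h *\<^sub>R D $ n)) (at t within S)"
      using x by (simp add: has_vector_derivative_def)
    then have "((\<lambda>s. x s $ n \<bullet> b) has_derivative (\<lambda>h. (h *\<^sub>R D $ n) \<bullet> b)) (at t within S)"
      by (rule has_derivative_inner_left)
    then show "((\<lambda>s. x s \<bullet> i) has_derivative (\<lambda>h. (h *\<^sub>R D) \<bullet> i)) (at t within S)"
      by (simp add: i inner_axis)
  qed
qed

text \<open>\<open>max 0 t\<close> freezes the weights before time 0, away from the singularity of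
  the powers at -1, so that the field is Lipschitz uniformly on the whole time axis. The slot
  \<open>G\<close> takes the gradients, their clipped version, or the linearisation along a
  solution.\<close>

definition network_field :: "('n::finite \<times> 'n) set \<Rightarrow> real \<Rightarrow> real \<Rightarrow>
    (real \<Rightarrow> real ^ 'd ^ 'n \<Rightarrow> real ^ 'd ^ 'n) \<Rightarrow> real \<Rightarrow> real ^ 'd ^ 'n \<Rightarrow> real ^ 'd ^ 'n" where
  "network_field E \<tau>\<^sub>\<alpha> \<tau>\<^sub>\<beta> G t x =
     - (weight \<tau>\<^sub>\<beta> (max 0 t) *\<^sub>R laplacian E x) - weight \<tau>\<^sub>\<alpha> (max 0 t) *\<^sub>R G t x"

lemma network_field_diff:
  "network_field E \<tau>\<^sub>\<alpha> \<tau>\<^sub>\<beta> G t x - network_field E \<tau>\<^sub>\<alpha> \<tau>\<^sub>\<beta> G' t y =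
     - (weight \<tau>\<^sub>\<beta> (max 0 t) *\<^sub>R laplacian E (x - y)) - weight \<tau>\<^sub>\<alpha> (max 0 t) *\<^sub>R (G t x - G' t y)"
  by (simp add: network_field_def linear_diff[OF linear_laplacian] algebra_simps)

text \<open>The \<open>itself\<close> argument fixes the block dimension, which the type of
  \<open>E\<close> does not determine.\<close>

definition laplacian_bound :: "('n::finite \<times> 'n) set \<Rightarrow> 'd::finite itself \<Rightarrow> real" where
  "laplacian_bound E _ = onorm (laplacian E :: real ^ 'd ^ 'n \<Rightarrow> _)"

lemma norm_laplacian_le: "norm (laplacian E x) \<le> laplacian_bound E TYPE('d) * norm x"
  for x :: "real ^ 'd ^ 'n::finite"
  unfolding laplacian_bound_def using linear_laplacian by (intro onorm) (simp add: linear_conv_bounded_linear)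

lemma laplacian_bound_nonneg: "0 \<le> laplacian_bound E TYPE('d::finite)"
  unfolding laplacian_bound_def using linear_laplacian
  by (intro onorm_pos_le) (simp add: linear_conv_bounded_linear)

lemma network_field_lipschitz_ode:
  fixes G :: "real \<Rightarrow> real ^ 'd ^ 'n::finite \<Rightarrow> real ^ 'd ^ 'n"
  assumes "0 \<le> \<tau>\<^sub>\<alpha>" "0 \<le> \<tau>\<^sub>\<beta>" "0 < K"
    and cont: "continuous_on UNIV (\<lambda>(t, x). G t x)"
    and lip: "\<And>t x y. norm (G t x - G t y) \<le> K * norm (x - y)"
    and bd: "\<And>t. norm (G t 0) \<le> M"
  shows "lipschitz_ode (network_field E \<tau>\<^sub>\<alpha> \<tau>\<^sub>\<beta> G) (laplacian_bound E TYPE('d) + K) M"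
proof
  have bl: "bounded_linear (laplacian E :: real ^ 'd ^ 'n \<Rightarrow> _)"
    using linear_laplacian by (simp add: linear_conv_bounded_linear)
  show "continuous_on UNIV (\<lambda>(t, x). network_field E \<tau>\<^sub>\<alpha> \<tau>\<^sub>\<beta> G t x)"
    unfolding network_field_def split_def
    by (intro continuous_intros continuous_on_compose2[OF continuous_on_weight_max[of UNIV]]
        bounded_linear.continuous_on[OF bl] cont[unfolded split_def]) auto
  have w: "0 < weight \<tau>\<^sub>\<alpha> (max 0 t)" "weight \<tau>\<^sub>\<alpha> (max 0 t) \<le> 1"
    "0 < weight \<tau>\<^sub>\<beta> (max 0 t)" "weight \<tau>\<^sub>\<beta> (max 0 t) \<le> 1" for t
    using assms(1,2) by (auto intro!: weight_pos weight_le_1)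
  show "norm (network_field E \<tau>\<^sub>\<alpha> \<tau>\<^sub>\<beta> G t x - network_field E \<tau>\<^sub>\<alpha> \<tau>\<^sub>\<beta> G t y)
      \<le> (laplacian_bound E TYPE('d) + K) * norm (x - y)" for t x y
  proof -
    have "norm (network_field E \<tau>\<^sub>\<alpha> \<tau>\<^sub>\<beta> G t x - network_field E \<tau>\<^sub>\<alpha> \<tau>\<^sub>\<beta> G t y)
      \<le> norm (weight \<tau>\<^sub>\<beta> (max 0 t) *\<^sub>R laplacian E (x - y)) + norm (weight \<tau>\<^sub>\<alpha> (max 0 t) *\<^sub>R (G t x - G t y))"
      unfolding network_field_diff by (metis norm_minus_cancel norm_triangle_ineq4)
    also have "\<dots> \<le> 1 * norm (laplacian E (x - y)) + 1 * norm (G t x - G t y)"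
      using w[of t] unfolding norm_scaleR by (intro add_mono mult_right_mono) auto
    also have "\<dots> \<le> (laplacian_bound E TYPE('d) + K) * norm (x - y)"
      using norm_laplacian_le[of E "x - y"] lip[of t x y] by (simp add: algebra_simps)
    finally show ?thesis .
  qed
  show "norm (network_field E \<tau>\<^sub>\<alpha> \<tau>\<^sub>\<beta> G t 0) \<le> M" for t
  proof -
    have "norm (network_field E \<tau>\<^sub>\<alpha> \<tau>\<^sub>\<beta> G t 0) = weight \<tau>\<^sub>\<alpha> (max 0 t) * norm (G t 0)"
      using w(1)[of t] by (simp add: network_field_def linear_0[OF linear_laplacian])
    also have "\<dots> \<le> 1 * norm (G t 0)"
      using w[of t] by (intro mult_right_mono) auto
    finally show ?thesis using bd[of t] by simp
  qed
  show "0 < laplacian_bound E TYPE('d) + K"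
    using laplacian_bound_nonneg[of E, where 'd='d] assms(3) by linarith
qed

locale distributed_flow =
  fixes E :: "('n::finite \<times> 'n) set" and f :: "'n \<Rightarrow> real ^ 'd::finite \<Rightarrow> real"
    and \<tau>\<^sub>\<alpha> \<tau>\<^sub>\<beta> K lam :: real and m :: "'n \<Rightarrow> real"
  assumes graph: "connected_simple_graph E"
    and C2: "\<And>n. C2 (f n)"
    and K_gt_0: "0 < K" and grad_lip: "\<And>n x y. norm (grad (f n) x - grad (f n) y) \<le> K * norm (x - y)"
    and f_ge: "\<And>n y. m n \<le> f n y"
    and \<tau>\<^sub>\<beta>: "0 \<le> \<tau>\<^sub>\<beta>" and \<tau>_less: "\<tau>\<^sub>\<beta> < \<tau>\<^sub>\<alpha>" and \<tau>\<^sub>\<alpha>: "\<tau>\<^sub>\<alpha> \<le> 1"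
    and lam_pos: "0 < lam"
    and gap: "\<And>y :: real ^ 'd ^ 'n. (\<And>v. y \<bullet> const v = 0) \<Longrightarrow> lam * (norm y)\<^sup>2 \<le> y \<bullet> laplacian E y"
begin

lemma sym: "sym E"
  using graph by (auto simp: connected_simple_graph_def)

definition gradients :: "real ^ 'd ^ 'n \<Rightarrow> real ^ 'd ^ 'n" where
  "gradients x = (\<chi> n. grad (f n) (x $ n))"

lemma gradients_lip: "norm (gradients x - gradients y) \<le> K * norm (x - y)"
  using K_gt_0 grad_lip by (intro norm_le_componentwise) (auto simp: gradients_def)

lemma continuous_on_gradients: "continuous_on S gradients"
proof -
  have "K-lipschitz_on S gradients"
    using K_gt_0 gradients_lip by (intro lipschitz_onI) (auto simp: dist_norm)
  then show ?thesis by (rule lipschitz_on_continuous_on)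
qed

sublocale lipschitz_ode "network_field E \<tau>\<^sub>\<alpha> \<tau>\<^sub>\<beta> (\<lambda>_. gradients)"
  "laplacian_bound E TYPE('d) + K" "norm (gradients 0)"
proof (rule network_field_lipschitz_ode)
  show "continuous_on UNIV (\<lambda>(t, x). gradients x)"
    unfolding split_def by (intro continuous_on_compose2[OF continuous_on_gradients[of UNIV]] continuous_intros) auto
qed (use \<tau>\<^sub>\<beta> \<tau>_less K_gt_0 gradients_lip in auto)

lemma dgf_solution_flow:
  assumes "dgf_solution E f \<tau>\<^sub>\<alpha> \<tau>\<^sub>\<beta> t\<^sub>0 x" "0 \<le> t\<^sub>0" "t\<^sub>0 \<le> t"
  shows "x t = flow t\<^sub>0 t (x t\<^sub>0)"
proof (rule flow_unique_ray[OF _ assms(3)])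
  fix s assume s: "t\<^sub>0 \<le> s"
  have "network_field E \<tau>\<^sub>\<alpha> \<tau>\<^sub>\<beta> (\<lambda>_. gradients) s (x s) $ n
    = weight \<tau>\<^sub>\<beta> s *\<^sub>R (\<Sum>l\<in>neighbors E n. x s $ l - x s $ n) - weight \<tau>\<^sub>\<alpha> s *\<^sub>R grad (f n) (x s $ n)" for n
  proof -
    have "(\<Sum>l\<in>neighbors E n. x s $ l - x s $ n) = - (\<Sum>l\<in>neighbors E n. x s $ n - x s $ l)"
      by (simp add: sum_negf[symmetric])
    then show ?thesis
      using s assms(2) by (simp add: network_field_def gradients_def laplacian_def)
  qed
  then show "(x has_vector_derivative network_field E \<tau>\<^sub>\<alpha> \<tau>\<^sub>\<beta> (\<lambda>_. gradients) s (x s)) (at s within {t\<^sub>0..})"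
    using assms(1) s unfolding has_vector_derivative_blocks dgf_solution_def by simp
qed auto

definition \<kappa> :: real where "\<kappa> = \<tau>\<^sub>\<alpha> - \<tau>\<^sub>\<beta>"

lemma \<kappa>_pos: "0 < \<kappa>"
  using \<tau>_less by (simp add: \<kappa>_def)

definition \<gamma> :: "real \<Rightarrow> real" where "\<gamma> t = (t + 1) powr \<kappa>"

lemma \<gamma>_pos: "0 \<le> t \<Longrightarrow> 0 < \<gamma> t"
  by (simp add: \<gamma>_def)

lemma \<gamma>_top: "filterlim \<gamma> at_top at_top"
  unfolding \<gamma>_def using \<kappa>_pos by real_asymp

lemma \<gamma>_deriv: "0 \<le> t \<Longrightarrow> (\<gamma> has_real_derivative \<kappa> * (t + 1) powr (\<kappa> - 1)) (at t)"
  unfolding \<gamma>_def by (auto intro!: derivative_eq_intros)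

text \<open>The gradient of \<open>energy t\<close> below; the field is
  \<open>- weight \<tau>\<^sub>\<alpha> t\<close> times it.\<close>

definition D :: "real \<Rightarrow> real ^ 'd ^ 'n \<Rightarrow> real ^ 'd ^ 'n" where
  "D t x = \<gamma> t *\<^sub>R laplacian E x + gradients x"

lemma field_eq_D: "0 \<le> t \<Longrightarrow> network_field E \<tau>\<^sub>\<alpha> \<tau>\<^sub>\<beta> (\<lambda>_. gradients) t x = - (weight \<tau>\<^sub>\<alpha> t *\<^sub>R D t x)"
  using weight_ratio[of t \<tau>\<^sub>\<beta> \<tau>\<^sub>\<alpha>]
  by (simp add: network_field_def D_def \<gamma>_def \<kappa>_def scaleR_add_right)

lemma flow_deriv_D: "0 \<le> t \<Longrightarrow>
  ((\<lambda>t. flow s t x) has_vector_derivative - (weight \<tau>\<^sub>\<alpha> t *\<^sub>R D t (flow s t x))) (at t)"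
  using flow_deriv[of s x t] by (simp add: field_eq_D)

definition excess :: "real ^ 'd ^ 'n \<Rightarrow> real" where
  "excess x = (\<Sum>n\<in>UNIV. f n (x $ n) - m n)"

definition energy :: "real \<Rightarrow> real ^ 'd ^ 'n \<Rightarrow> real" where
  "energy t x = excess x + \<gamma> t / 2 * (x \<bullet> laplacian E x)"

text \<open>The exponential compensates the growth of \<gamma>: the energy gain that dissipation
  does not absorb is at most \<open>4 * K / lam * \<gamma>' / \<gamma>\<^sup>2\<close> times the
  energy, and this rate is minus the derivative of \<open>4 * K / lam / \<gamma>\<close>.\<close>

definition lyapunov :: "real \<Rightarrow> real ^ 'd ^ 'n \<Rightarrow> real" where
  "lyapunov t x = energy t x * exp (4 * K / lam / \<gamma> t)"

lemma excess_nonneg: "0 \<le> excess x"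
  unfolding excess_def using f_ge by (intro sum_nonneg) (simp add: algebra_simps)

lemma excess_le_energy: "0 \<le> t \<Longrightarrow> excess x \<le> energy t x"
  unfolding energy_def using inner_laplacian_nonneg[OF sym, of x] \<gamma>_pos[of t] by simp

lemma energy_nonneg: "0 \<le> t \<Longrightarrow> 0 \<le> energy t x"
  using excess_le_energy excess_nonneg order_trans by blast

lemma energy_le_lyapunov: "0 \<le> t \<Longrightarrow> energy t x \<le> lyapunov t x"
proof -
  assume t: "0 \<le> t"
  have "1 \<le> exp (4 * K / lam / \<gamma> t)"
    using K_gt_0 lam_pos \<gamma>_pos[OF t] by simp
  then show ?thesis
    unfolding lyapunov_def using energy_nonneg[OF t, of x] by (simp add: mult_le_cancel_left1)
qed

lemma disagreement:
  fixes x :: "real ^ 'd ^ 'n"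
  defines "y \<equiv> x - const (mean x)"
  shows "laplacian E y = laplacian E x" and "y \<bullet> laplacian E y = x \<bullet> laplacian E x"
    and "lam * (norm y)\<^sup>2 \<le> x \<bullet> laplacian E x"
proof -
  show Ly: "laplacian E y = laplacian E x"
    by (simp add: y_def linear_diff[OF linear_laplacian])
  show yy: "y \<bullet> laplacian E y = x \<bullet> laplacian E x"
    unfolding Ly using laplacian_selfadjoint[OF sym, of "const (mean x)" x]
    by (simp add: y_def inner_diff_left)
  show "lam * (norm y)\<^sup>2 \<le> x \<bullet> laplacian E x"
    unfolding yy[symmetric] unfolding y_def by (rule gap, rule mean_decomposition(2))
qed

text \<open>On an eigenvector with nonzero eigenvalue this says that the eigenvalue is at least
  \<open>lam\<close>; in general it follows from the spectral gap and Cauchy-Schwarz applied to the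
  disagreement.\<close>

lemma inner_laplacian_le: "lam * (x \<bullet> laplacian E x) \<le> (norm (laplacian E x))\<^sup>2"
  for x :: "real ^ 'd ^ 'n"
proof -
  define y where "y = x - const (mean x)"
  note dis = disagreement[of x, folded y_def]
  have "lam * (norm y)\<^sup>2 \<le> y \<bullet> laplacian E x"
    using dis by simp
  also have cs: "\<dots> \<le> norm y * norm (laplacian E x)"
    by (rule norm_cauchy_schwarz)
  finally have "norm y * (lam * norm y) \<le> norm y * norm (laplacian E x)"
    by (simp add: power2_eq_square mult_ac)
  then have "lam * norm y \<le> norm (laplacian E x)"
    by (cases "y = 0") (simp_all add: mult_le_cancel_left)
  then have "lam * norm y * norm (laplacian E x) \<le> norm (laplacian E x) * norm (laplacian E x)"
    by (rule mult_right_mono) simp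
  moreover have "lam * (y \<bullet> laplacian E x) \<le> lam * (norm y * norm (laplacian E x))"
    using lam_pos cs by (intro mult_left_mono) auto
  ultimately show ?thesis
    using dis by (simp add: power2_eq_square mult.assoc)
qed

lemma norm_gradients_le: "(norm (gradients x))\<^sup>2 \<le> 4 * K * excess x"
proof -
  have "(norm (gradients x))\<^sup>2 = (\<Sum>n\<in>UNIV. (norm (grad (f n) (x $ n)))\<^sup>2)"
    by (simp add: norm_power2_blocks gradients_def)
  also have "\<dots> \<le> (\<Sum>n\<in>UNIV. 4 * K * (f n (x $ n) - m n))"
    by (intro sum_mono norm_grad_power2_le C2 grad_lip K_gt_0 f_ge)
  finally show ?thesis by (simp add: excess_def sum_distrib_left)
qed

text \<open>\<open>\<gamma> t *\<^sub>R laplacian E x\<close> is the difference of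
  \<open>D t x\<close> and the gradients, so control of these two makes the Dirichlet form of order
  \<open>1 / (\<gamma> t)\<^sup>2\<close>.\<close>

lemma laplacian_le_D:
  assumes "0 \<le> t"
  shows "(\<gamma> t)\<^sup>2 * lam * (x \<bullet> laplacian E x) \<le> 2 * (norm (D t x))\<^sup>2 + 2 * (norm (gradients x))\<^sup>2"
proof -
  have "(\<gamma> t)\<^sup>2 * (lam * (x \<bullet> laplacian E x)) \<le> (\<gamma> t)\<^sup>2 * (norm (laplacian E x))\<^sup>2"
    by (intro mult_left_mono inner_laplacian_le) auto
  also have "\<dots> = (norm (D t x - gradients x))\<^sup>2"
    by (simp add: D_def power_mult_distrib)
  also have "\<dots> \<le> (norm (D t x) + norm (gradients x))\<^sup>2"
    by (intro power_mono norm_triangle_ineq4) auto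
  also have "\<dots> \<le> 2 * (norm (D t x))\<^sup>2 + 2 * (norm (gradients x))\<^sup>2"
    using sum_squares_bound[of "norm (D t x)" "norm (gradients x)"]
    by (simp add: power2_sum)
  finally show ?thesis by (simp add: mult.assoc)
qed

lemma excess_deriv:
  assumes "(x has_vector_derivative x') (at t)"
  shows "((\<lambda>t. excess (x t)) has_real_derivative x' \<bullet> gradients (x t)) (at t)"
proof -
  have "((\<lambda>t. f n (x t $ n) - m n) has_real_derivative x' $ n \<bullet> grad (f n) (x t $ n)) (at t)" for n
  proof -
    have "(f n has_derivative (\<lambda>h. h \<bullet> grad (f n) (x t $ n))) (at (x t $ n))"
      using C2_GDERIV[OF C2] by (simp add: gderiv_def)
    moreover have "((\<lambda>t. x t $ n) has_derivative (\<lambda>h. h *\<^sub>R x' $ n)) (at t)"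
      using assms unfolding has_vector_derivative_blocks by (simp add: has_vector_derivative_def)
    ultimately have "((\<lambda>t. f n (x t $ n)) has_derivative (\<lambda>h. (h *\<^sub>R x' $ n) \<bullet> grad (f n) (x t $ n))) (at t)"
      by (rule has_derivative_compose[rotated])
    then have "((\<lambda>t. f n (x t $ n)) has_real_derivative x' $ n \<bullet> grad (f n) (x t $ n)) (at t)"
      by (simp add: has_field_derivative_def mult.commute[of _ "x' $ n \<bullet> _"])
    from DERIV_diff[OF this DERIV_const[of "m n"]] show ?thesis by simp
  qed
  then have "((\<lambda>t. \<Sum>n\<in>UNIV. f n (x t $ n) - m n) has_real_derivative
      (\<Sum>n\<in>UNIV. x' $ n \<bullet> grad (f n) (x t $ n))) (at t)"
    by (intro DERIV_sum) auto
  then show ?thesis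
    by (simp add: excess_def inner_blocks gradients_def)
qed

text \<open>Dissipation plus one term of the wrong sign, due to the explicit time dependence of
  \<gamma>.\<close>

lemma energy_deriv:
  assumes t: "0 \<le> t"
  shows "((\<lambda>t. energy t (flow s t x)) has_real_derivative
     - weight \<tau>\<^sub>\<alpha> t * (norm (D t (flow s t x)))\<^sup>2
     + \<kappa> * (t + 1) powr (\<kappa> - 1) / 2 * (flow s t x \<bullet> laplacian E (flow s t x))) (at t)"
proof -
  let ?x = "\<lambda>t. flow s t x" and ?x' = "- (weight \<tau>\<^sub>\<alpha> t *\<^sub>R D t (flow s t x))"
  have x': "(?x has_vector_derivative ?x') (at t)"
    by (rule flow_deriv_D[OF t])
  have bl: "bounded_linear (laplacian E :: real ^ 'd ^ 'n \<Rightarrow> _)"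
    using linear_laplacian by (simp add: linear_conv_bounded_linear)
  have Lx': "((\<lambda>t. laplacian E (?x t)) has_vector_derivative laplacian E ?x') (at t)"
    by (rule bounded_linear.has_vector_derivative[OF bl x'])
  have "((\<lambda>t. ?x t \<bullet> laplacian E (?x t)) has_vector_derivative
      ?x t \<bullet> laplacian E ?x' + ?x' \<bullet> laplacian E (?x t)) (at t)"
    by (rule bounded_bilinear.has_vector_derivative[OF bounded_bilinear_inner x' Lx'])
  moreover have "?x t \<bullet> laplacian E ?x' = ?x' \<bullet> laplacian E (?x t)"
    by (simp add: laplacian_selfadjoint[OF sym, of _ ?x'] inner_commute)
  ultimately have q: "((\<lambda>t. ?x t \<bullet> laplacian E (?x t)) has_real_derivative
      2 * (?x' \<bullet> laplacian E (?x t))) (at t)"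
    by (simp add: has_real_derivative_iff_has_vector_derivative)
  have "((\<lambda>t. energy t (?x t)) has_real_derivative
     ?x' \<bullet> gradients (?x t) + (\<gamma> t / 2 * (2 * (?x' \<bullet> laplacian E (?x t)))
       + \<kappa> * (t + 1) powr (\<kappa> - 1) / 2 * (?x t \<bullet> laplacian E (?x t)))) (at t)"
    unfolding energy_def
    by (intro DERIV_add excess_deriv x' DERIV_mult'[OF _ q] DERIV_cdivide \<gamma>_deriv t)
  also have "?x' \<bullet> gradients (?x t) + (\<gamma> t / 2 * (2 * (?x' \<bullet> laplacian E (?x t)))
       + \<kappa> * (t + 1) powr (\<kappa> - 1) / 2 * (?x t \<bullet> laplacian E (?x t)))
     = ?x' \<bullet> D t (?x t) + \<kappa> * (t + 1) powr (\<kappa> - 1) / 2 * (?x t \<bullet> laplacian E (?x t))"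
    by (simp add: D_def inner_add_right)
  also have "?x' \<bullet> D t (?x t) = - weight \<tau>\<^sub>\<alpha> t * (norm (D t (?x t)))\<^sup>2"
    by (simp add: power2_norm_eq_inner)
  finally show ?thesis .
qed

text \<open>From this time on the growth of \<gamma> uses up at most half of the
  dissipation.\<close>

definition T1 :: real where
  "T1 = (SOME T. 0 \<le> T \<and> (\<forall>t\<ge>T. 2 * \<kappa> / lam \<le> \<gamma> t))"

lemma T1: "0 \<le> T1" "T1 \<le> t \<Longrightarrow> 2 * \<kappa> / lam \<le> \<gamma> t"
proof -
  have "\<forall>\<^sub>F t in at_top. 2 * \<kappa> / lam \<le> \<gamma> t"
    using \<gamma>_top by (simp add: filterlim_at_top)
  then obtain T where "\<And>t. T \<le> t \<Longrightarrow> 2 * \<kappa> / lam \<le> \<gamma> t"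
    by (auto simp: eventually_at_top_linorder)
  then have "\<exists>T. 0 \<le> T \<and> (\<forall>t\<ge>T. 2 * \<kappa> / lam \<le> \<gamma> t)"
    by (intro exI[of _ "max 0 T"]) auto
  from someI_ex[OF this] show "0 \<le> T1" "T1 \<le> t \<Longrightarrow> 2 * \<kappa> / lam \<le> \<gamma> t"
    unfolding T1_def by blast+
qed

text \<open>The logarithmic derivative of \<gamma> is \<kappa>/(t+1), and 1/(t+1) is at most the
  weight since \<open>\<tau>\<^sub>\<alpha> \<le> 1\<close>; the remaining factor 1/\<gamma> is
  small after \<open>T1\<close>.\<close>

lemma \<gamma>_deriv_le:
  assumes "T1 \<le> t"
  shows "\<kappa> * (t + 1) powr (\<kappa> - 1) / (\<gamma> t)\<^sup>2 \<le> lam * weight \<tau>\<^sub>\<alpha> t / 2"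
proof -
  have t: "0 \<le> t" using assms T1(1) by simp
  have "(t + 1) powr (\<kappa> - 1) = \<gamma> t * (t + 1) powr (- 1)"
    using powr_add[of "t + 1" \<kappa> "- 1"] by (simp add: \<gamma>_def)
  also have "\<dots> \<le> \<gamma> t * weight \<tau>\<^sub>\<alpha> t"
    unfolding weight_def using t \<tau>\<^sub>\<alpha> \<gamma>_pos[OF t] by (intro mult_left_mono powr_mono) auto
  finally have le: "(t + 1) powr (\<kappa> - 1) \<le> \<gamma> t * weight \<tau>\<^sub>\<alpha> t" .
  have "2 * \<kappa> \<le> lam * \<gamma> t"
    using T1(2)[OF assms] lam_pos by (simp add: pos_divide_le_eq mult.commute)
  have "\<kappa> * (t + 1) powr (\<kappa> - 1) \<le> \<kappa> * (\<gamma> t * weight \<tau>\<^sub>\<alpha> t)"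
    using le \<kappa>_pos by (intro mult_left_mono) auto
  also have "\<dots> = (2 * \<kappa>) * (\<gamma> t * weight \<tau>\<^sub>\<alpha> t / 2)"
    by simp
  also have "\<dots> \<le> (lam * \<gamma> t) * (\<gamma> t * weight \<tau>\<^sub>\<alpha> t / 2)"
    using \<open>2 * \<kappa> \<le> lam * \<gamma> t\<close> \<gamma>_pos[OF t] weight_pos[of t \<tau>\<^sub>\<alpha>] t by (intro mult_right_mono) auto
  also have "\<dots> = (lam * weight \<tau>\<^sub>\<alpha> t / 2) * (\<gamma> t)\<^sup>2"
    by (simp add: power2_eq_square)
  finally show ?thesis
    using \<gamma>_pos[OF t] by (simp add: pos_divide_le_eq)
qed

text \<open>The Dirichlet form in the wrong-sign term is bounded by dissipation and gradients. Half
  of the dissipation absorbs the first part; the exponential factor absorbs the second, since the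
  energy bounds the gradients.\<close>

lemma lyapunov_deriv:
  assumes "T1 \<le> t"
  obtains y where "((\<lambda>t. lyapunov t (flow s t x)) has_real_derivative y) (at t)"
    "y \<le> - (weight \<tau>\<^sub>\<alpha> t / 2 * (norm (D t (flow s t x)))\<^sup>2)"
proof -
  have t: "0 \<le> t" using assms T1(1) by simp
  let ?x = "flow s t x"
  let ?\<gamma>' = "\<kappa> * (t + 1) powr (\<kappa> - 1)"
  let ?e = "energy t ?x" and ?d = "(norm (D t ?x))\<^sup>2" and ?l = "?x \<bullet> laplacian E ?x"
  let ?e' = "- weight \<tau>\<^sub>\<alpha> t * ?d + ?\<gamma>' / 2 * ?l"
  define C where "C = 4 * K / lam"
  define r where "r = ?\<gamma>' / (\<gamma> t)\<^sup>2"
  define X where "X = exp (C / \<gamma> t)"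
  have r: "0 \<le> r" "r \<le> lam * weight \<tau>\<^sub>\<alpha> t / 2"
    using \<gamma>_deriv_le[OF assms] \<kappa>_pos by (auto simp: r_def)
  have g0: "\<gamma> t \<noteq> 0" using \<gamma>_pos[OF t] by simp
  have X': "((\<lambda>t. exp (C / \<gamma> t)) has_real_derivative X * (- (C * r))) (at t)"
    unfolding X_def r_def using \<gamma>_deriv[OF t] g0
    by (auto intro!: derivative_eq_intros simp: power2_eq_square)
  have d: "((\<lambda>t. lyapunov t (flow s t x)) has_real_derivative ?e' * X + X * (- (C * r)) * ?e) (at t)"
    using DERIV_mult[OF energy_deriv[OF t, of s x] X']
    by (simp add: lyapunov_def C_def[symmetric] X_def[symmetric])
  have "(norm (gradients ?x))\<^sup>2 \<le> 4 * K * ?e"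
  proof (rule order_trans[OF norm_gradients_le])
    show "4 * K * excess ?x \<le> 4 * K * ?e"
      using K_gt_0 by (intro mult_left_mono excess_le_energy t) auto
  qed
  then have "(\<gamma> t)\<^sup>2 * lam * ?l \<le> 2 * ?d + 8 * K * ?e"
    using laplacian_le_D[OF t, of ?x] by linarith
  then have "r / lam / 2 * ((\<gamma> t)\<^sup>2 * lam * ?l) \<le> r / lam / 2 * (2 * ?d + 8 * K * ?e)"
    using r lam_pos by (intro mult_left_mono) auto
  moreover have "r / lam / 2 * ((\<gamma> t)\<^sup>2 * lam * ?l) = ?\<gamma>' / 2 * ?l"
    using g0 lam_pos by (simp add: r_def)
  moreover have "r / lam / 2 * (2 * ?d + 8 * K * ?e) = r / lam * ?d + C * r * ?e"
    using lam_pos by (simp add: C_def field_simps)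
  moreover have "r / lam * ?d \<le> weight \<tau>\<^sub>\<alpha> t / 2 * ?d"
    using r lam_pos by (intro mult_right_mono) (auto simp: field_simps)
  ultimately have le: "?e' - C * r * ?e \<le> - (weight \<tau>\<^sub>\<alpha> t / 2 * ?d)"
    by linarith
  have X: "1 \<le> X"
    unfolding X_def C_def using K_gt_0 lam_pos \<gamma>_pos[OF t] by simp
  have "?e' * X + X * (- (C * r)) * ?e = X * (?e' - C * r * ?e)"
    by (simp add: algebra_simps)
  also have "\<dots> \<le> X * (- (weight \<tau>\<^sub>\<alpha> t / 2 * ?d))"
    using le X by (intro mult_left_mono) auto
  also have "\<dots> \<le> 1 * (- (weight \<tau>\<^sub>\<alpha> t / 2 * ?d))"
    using X weight_pos[of t \<tau>\<^sub>\<alpha>] t by (intro mult_right_mono_neg) auto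
  finally show ?thesis using that[OF d] by simp
qed

lemma lyapunov_antimono:
  assumes "T1 \<le> t" "t \<le> u"
  shows "lyapunov u (flow s u x) \<le> lyapunov t (flow s t x)"
proof (rule DERIV_nonpos_imp_nonincreasing[OF assms(2)])
  fix v assume "t \<le> v" "v \<le> u"
  then have v: "T1 \<le> v" "0 \<le> v" using assms T1(1) by auto
  obtain y where y: "((\<lambda>t. lyapunov t (flow s t x)) has_real_derivative y) (at v)"
    "y \<le> - (weight \<tau>\<^sub>\<alpha> v / 2 * (norm (D v (flow s v x)))\<^sup>2)"
    using lyapunov_deriv[OF v(1)] by blast
  moreover have "0 \<le> weight \<tau>\<^sub>\<alpha> v / 2 * (norm (D v (flow s v x)))\<^sup>2"
    using weight_pos[of v \<tau>\<^sub>\<alpha>] v by simp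
  ultimately show "\<exists>y. ((\<lambda>t. lyapunov t (flow s t x)) has_real_derivative y) (at v) \<and> y \<le> 0"
    by (intro exI[of _ y]) linarith
qed

text \<open>Speed is \<alpha> times \<open>norm D\<close> and the decay at least \<alpha>/2 times
  its square. Where \<open>norm D\<close> is at least \<open>c\<close>, the loss is thus at least
  \<open>c / 2\<close> times the distance covered, however long that takes.\<close>

lemma lyapunov_drop:
  assumes "T1 \<le> t" "t \<le> u" "0 \<le> c" and D: "\<And>v. t \<le> v \<Longrightarrow> v \<le> u \<Longrightarrow> c \<le> norm (D v (flow s v x))"
  shows "lyapunov u (flow s u x) + c / 2 * norm (flow s u x - flow s t x) \<le> lyapunov t (flow s t x)"
proof -
  \<comment> \<open>Testing with the fixed direction of the total displacement replaces arc
    length.\<close>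
  define n where "n = sgn (flow s u x - flow s t x)"
  have n1: "norm n \<le> 1" by (simp add: n_def norm_sgn)
  have nn: "n \<bullet> (flow s u x - flow s t x) = norm (flow s u x - flow s t x)"
    by (cases "flow s u x - flow s t x = 0")
      (simp_all add: n_def sgn_div_norm dot_square_norm power2_eq_square)
  let ?h = "\<lambda>v. lyapunov v (flow s v x) + c / 2 * (n \<bullet> flow s v x)"
  have "?h u \<le> ?h t"
  proof (rule DERIV_nonpos_imp_nonincreasing[OF assms(2)])
    fix v assume v: "t \<le> v" "v \<le> u"
    then have v': "T1 \<le> v" "0 \<le> v" using assms T1(1) by auto
    let ?w = "weight \<tau>\<^sub>\<alpha> v" and ?D = "D v (flow s v x)"
    obtain y where y: "((\<lambda>t. lyapunov t (flow s t x)) has_real_derivative y) (at v)"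
      "y \<le> - (?w / 2 * (norm ?D)\<^sup>2)"
      using lyapunov_deriv[OF v'(1)] by blast
    have "((\<lambda>v. n \<bullet> flow s v x) has_real_derivative n \<bullet> - (?w *\<^sub>R ?D)) (at v)"
      using bounded_linear.has_vector_derivative[OF bounded_linear_inner_right flow_deriv_D[OF v'(2)], of n s x]
      by (simp add: has_real_derivative_iff_has_vector_derivative)
    from DERIV_add[OF y(1) DERIV_cmult[OF this, of "c / 2"]]
    have "(?h has_real_derivative y + c / 2 * (n \<bullet> - (?w *\<^sub>R ?D))) (at v)" .
    moreover have "y + c / 2 * (n \<bullet> - (?w *\<^sub>R ?D)) \<le> 0"
    proof -
      have w: "0 < ?w" using v' by (intro weight_pos) auto
      have "- (n \<bullet> ?D) \<le> norm n * norm ?D"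
        using Cauchy_Schwarz_ineq2[of n ?D] by linarith
      also have "\<dots> \<le> 1 * norm ?D"
        using n1 by (intro mult_right_mono) auto
      finally have "- (n \<bullet> ?D) \<le> norm ?D" by simp
      then have "c / 2 * (?w * - (n \<bullet> ?D)) \<le> c / 2 * (?w * norm ?D)"
        using w assms(3) by (intro mult_left_mono) auto
      also have "\<dots> \<le> norm ?D / 2 * (?w * norm ?D)"
        using D[OF v] w by (intro mult_right_mono) auto
      finally have "c / 2 * (n \<bullet> - (?w *\<^sub>R ?D)) \<le> ?w / 2 * (norm ?D)\<^sup>2"
        by (simp add: power2_eq_square mult_ac)
      then show ?thesis using y(2) by linarith
    qed
    ultimately show "\<exists>y. (?h has_real_derivative y) (at v) \<and> y \<le> 0" by blast
  qed
  moreover have "c / 2 * (n \<bullet> flow s u x) - c / 2 * (n \<bullet> flow s t x)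
      = c / 2 * norm (flow s u x - flow s t x)"
    by (simp add: nn[symmetric] inner_diff_right right_diff_distrib)
  ultimately show ?thesis by linarith
qed

section \<open>Consensus and the limit of the Lyapunov function\<close>

lemma laplacian_energy_le: "0 \<le> t \<Longrightarrow> \<gamma> t / 2 * (x \<bullet> laplacian E x) \<le> energy t x"
  using excess_nonneg[of x] by (simp add: energy_def)

lemma component_diff_le: "norm (x $ n - x $ l) \<le> 2 * sqrt (x \<bullet> laplacian E x / lam)"
  for x :: "real ^ 'd ^ 'n"
proof -
  define y where "y = x - const (mean x)"
  have "norm y \<le> sqrt (x \<bullet> laplacian E x / lam)"
    using lam_pos disagreement(3)[of x, folded y_def]
    by (intro real_le_rsqrt) (simp add: pos_le_divide_eq mult.commute)
  moreover have "norm (x $ n - x $ l) \<le> norm (y $ n) + norm (y $ l)"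
    using norm_triangle_ineq4[of "y $ n" "y $ l"] by (simp add: y_def)
  moreover have "norm (y $ n) \<le> norm y" "norm (y $ l) \<le> norm y"
    by (simp_all add: Finite_Cartesian_Product.norm_nth_le)
  ultimately show ?thesis by linarith
qed

text \<open>The Lyapunov function keeps \<gamma>/2 times the Dirichlet form bounded, while \<gamma>
  tends to infinity.\<close>

lemma flow_consensus: "((\<lambda>t. flow s t x $ n - flow s t x $ l) \<longlongrightarrow> 0) at_top"
proof (rule Lim_null_comparison)
  define B where "B = lyapunov T1 (flow s T1 x)"
  show "\<forall>\<^sub>F t in at_top. norm (flow s t x $ n - flow s t x $ l) \<le> 2 * sqrt (2 * B / lam * inverse (\<gamma> t))"
    using eventually_ge_at_top[of T1]
  proof eventually_elim
    case (elim t)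
    then have t: "0 \<le> t" using T1(1) by simp
    let ?x = "flow s t x"
    have "\<gamma> t / 2 * (?x \<bullet> laplacian E ?x) \<le> B"
      using laplacian_energy_le[OF t, of ?x] energy_le_lyapunov[OF t, of ?x]
        lyapunov_antimono[of T1 t s x] elim by (simp add: B_def)
    then have "?x \<bullet> laplacian E ?x / lam \<le> 2 * B / lam * inverse (\<gamma> t)"
      using \<gamma>_pos[OF t] lam_pos by (simp add: field_simps)
    then have "2 * sqrt (?x \<bullet> laplacian E ?x / lam) \<le> 2 * sqrt (2 * B / lam * inverse (\<gamma> t))"
      by simp
    then show ?case using component_diff_le[of ?x n l] by linarith
  qed
  have "((\<lambda>t. 2 * sqrt (2 * B / lam * inverse (\<gamma> t))) \<longlongrightarrow> 2 * sqrt (2 * B / lam * 0)) at_top"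
    by (intro tendsto_intros tendsto_inverse_0_at_top \<gamma>_top)
  then show "((\<lambda>t. 2 * sqrt (2 * B / lam * inverse (\<gamma> t))) \<longlongrightarrow> 0) at_top" by simp
qed

lemma flow_tendsto_const:
  assumes "((\<lambda>t. flow s t x $ n) \<longlongrightarrow> v) at_top"
  shows "((\<lambda>t. flow s t x) \<longlongrightarrow> const v) at_top"
proof (rule vec_tendstoI)
  fix l
  have "((\<lambda>t. (flow s t x $ l - flow s t x $ n) + flow s t x $ n) \<longlongrightarrow> 0 + v) at_top"
    by (intro tendsto_add flow_consensus assms)
  then show "((\<lambda>t. flow s t x $ l) \<longlongrightarrow> const v $ l) at_top" by simp
qed

lemma continuous_on_excess: "continuous_on S excess"
proof -
  have c: "continuous_on UNIV (f n)" for n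
    using C2[of n] by (auto simp: C2_def intro: differentiable_imp_continuous_on)
  then show ?thesis
    unfolding excess_def
    by (intro continuous_on_sum continuous_on_diff continuous_on_const continuous_on_compose2[OF c]
        continuous_on_component continuous_on_id) auto
qed

lemma excess_flow_tendsto:
  assumes "((\<lambda>t. flow s t x) \<longlongrightarrow> z) at_top"
  shows "((\<lambda>t. excess (flow s t x)) \<longlongrightarrow> excess z) at_top"
  using continuous_on_tendsto_compose[OF continuous_on_excess[of UNIV] assms] by simp

text \<open>The Lyapunov function is nonincreasing and dominates \<open>excess\<close>, so it cannot
  fall below the limit of \<open>excess\<close>.\<close>

lemma excess_limit_le_lyapunov:
  assumes lim: "((\<lambda>t. flow s t x) \<longlongrightarrow> z) at_top" and t: "T1 \<le> t"
  shows "excess z \<le> lyapunov t (flow s t x)"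
proof (rule tendsto_upperbound[OF excess_flow_tendsto[OF lim]])
  show "\<forall>\<^sub>F u in at_top. excess (flow s u x) \<le> lyapunov t (flow s t x)"
    using eventually_ge_at_top[of t]
  proof eventually_elim
    case (elim u)
    then have "0 \<le> u" using t T1(1) by simp
    then show ?case
      using excess_le_energy[of u "flow s u x"] energy_le_lyapunov[of u "flow s u x"]
        lyapunov_antimono[OF t elim, of s x] by linarith
  qed
qed simp

text \<open>If the Lyapunov function stayed \<eta> above the limit of \<open>excess\<close>, the
  surplus would have to sit in the Laplacian term. As \<gamma> grows this forces
  \<open>norm D\<close> to be at least 1, and the resulting decay at rate \<alpha>/2 has a divergent
  integral.\<close>

lemma lyapunov_limit:
  assumes lim: "((\<lambda>t. flow s t x) \<longlongrightarrow> z) at_top" and \<eta>: "0 < \<eta>"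
  shows "\<forall>\<^sub>F t in at_top. lyapunov t (flow s t x) < excess z + \<eta>"
proof (rule ccontr)
  assume neg: "\<not> ?thesis"
  let ?x = "\<lambda>t. flow s t x"
  have ge: "excess z + \<eta> \<le> lyapunov t (?x t)" if "T1 \<le> t" for t
  proof (rule ccontr)
    assume "\<not> excess z + \<eta> \<le> lyapunov t (?x t)"
    then have "lyapunov u (?x u) < excess z + \<eta>" if "t \<le> u" for u
      using lyapunov_antimono[OF \<open>T1 \<le> t\<close> that, of s x] by linarith
    then have "\<forall>\<^sub>F u in at_top. lyapunov u (?x u) < excess z + \<eta>"
      by (rule eventually_mono[OF eventually_ge_at_top[of t]])
    then show False using neg by blast
  qed
  define B where "B = lyapunov T1 (?x T1)"
  define C where "C = 4 * K / lam"
  have C: "0 < C" using K_gt_0 lam_pos by (simp add: C_def)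
  have B: "0 \<le> energy t (?x t)" "energy t (?x t) \<le> B" if "T1 \<le> t" for t
  proof -
    have t: "0 \<le> t" using that T1(1) by linarith
    show "0 \<le> energy t (?x t)" by (rule energy_nonneg[OF t])
    show "energy t (?x t) \<le> B"
      unfolding B_def by (rule order_trans[OF energy_le_lyapunov[OF t] lyapunov_antimono[OF order_refl that]])
  qed
  \<comment> \<open>Of the surplus \<eta>, one quarter is allotted to the convergence of
    \<open>excess\<close> and one to the exponential factor, which leaves half for the Laplacian
    term.\<close>
  define b where "b = excess z + \<eta> / 4"
  have ev1: "\<forall>\<^sub>F t in at_top. excess (?x t) < b"
    using order_tendstoD(2)[OF excess_flow_tendsto[OF lim], of b] \<eta> by (simp add: b_def)
  have "((\<lambda>t. B * (exp (C * inverse (\<gamma> t)) - 1)) \<longlongrightarrow> B * (exp (C * 0) - 1)) at_top"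
    by (intro tendsto_intros tendsto_inverse_0_at_top \<gamma>_top)
  then have ev2: "\<forall>\<^sub>F t in at_top. B * (exp (C * inverse (\<gamma> t)) - 1) < \<eta> / 4"
    by (rule order_tendstoD(2)) (use \<eta> in simp)
  \<comment> \<open>Threshold at which \<open>lam * \<gamma> t * \<eta> \<le> 2 * (norm D)\<^sup>2 +
    8 * K * b\<close> yields \<open>1 \<le> (norm D)\<^sup>2\<close>.\<close>
  have ev3: "\<forall>\<^sub>F t in at_top. (2 + 8 * K * b) / (lam * \<eta>) \<le> \<gamma> t"
    using \<gamma>_top by (simp add: filterlim_at_top)
  have "\<forall>\<^sub>F t in at_top. T1 \<le> t \<and> 1 \<le> (norm (D t (?x t)))\<^sup>2"
    using ev1 ev2 ev3 eventually_ge_at_top[of T1]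
  proof eventually_elim
    case (elim t)
    have t: "0 \<le> t" using elim(4) T1(1) by simp
    let ?l = "?x t \<bullet> laplacian E (?x t)"
    have "lyapunov t (?x t) - energy t (?x t) = energy t (?x t) * (exp (C * inverse (\<gamma> t)) - 1)"
      by (simp add: lyapunov_def C_def algebra_simps divide_inverse)
    also have "\<dots> \<le> B * (exp (C * inverse (\<gamma> t)) - 1)"
      using B[OF elim(4)] C \<gamma>_pos[OF t] by (intro mult_right_mono) auto
    finally have "excess z + \<eta> - \<eta> / 4 \<le> energy t (?x t)"
      using elim(2) ge[OF elim(4)] by linarith
    then have "\<eta> / 2 \<le> \<gamma> t / 2 * ?l"
      using elim(1) by (simp add: energy_def b_def)
    then have "lam * \<gamma> t * (\<eta> / 2) \<le> lam * \<gamma> t * (\<gamma> t / 2 * ?l)"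
      using lam_pos \<gamma>_pos[OF t] by (intro mult_left_mono) auto
    then have "lam * \<gamma> t * \<eta> \<le> (\<gamma> t)\<^sup>2 * lam * ?l"
      by (simp add: power2_eq_square mult_ac)
    also have "\<dots> \<le> 2 * (norm (D t (?x t)))\<^sup>2 + 2 * (4 * K * excess (?x t))"
      using laplacian_le_D[OF t, of "?x t"] norm_gradients_le[of "?x t"] by linarith
    also have "4 * K * excess (?x t) \<le> 4 * K * b"
      using elim(1) K_gt_0 by simp
    finally have "lam * \<gamma> t * \<eta> \<le> 2 * (norm (D t (?x t)))\<^sup>2 + 8 * K * b" by simp
    moreover have "2 + 8 * K * b \<le> lam * \<gamma> t * \<eta>"
      using elim(3) lam_pos \<eta> by (simp add: pos_divide_le_eq mult_ac)
    ultimately show ?case using elim(4) by simp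
  qed
  then obtain T where T: "\<And>t. T \<le> t \<Longrightarrow> T1 \<le> t \<and> 1 \<le> (norm (D t (?x t)))\<^sup>2"
    by (auto simp: eventually_at_top_linorder)
  obtain A where A: "\<And>t. -1 < t \<Longrightarrow> (A has_real_derivative weight \<tau>\<^sub>\<alpha> t) (at t)"
    and A_top: "filterlim A at_top at_top"
    using weight_primitive[OF \<tau>\<^sub>\<alpha>] by blast
  have dec: "lyapunov t (?x t) + A t / 2 \<le> lyapunov T (?x T) + A T / 2" if "T \<le> t" for t
  proof (rule DERIV_nonpos_imp_nonincreasing[OF that])
    fix v assume "T \<le> v" "v \<le> t"
    then have v: "T1 \<le> v" "1 \<le> (norm (D v (?x v)))\<^sup>2" "0 \<le> v" using T[of v] T1(1) by auto
    obtain y where y: "((\<lambda>t. lyapunov t (flow s t x)) has_real_derivative y) (at v)"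
      "y \<le> - (weight \<tau>\<^sub>\<alpha> v / 2 * (norm (D v (?x v)))\<^sup>2)"
      using lyapunov_deriv[OF v(1)] by blast
    have "weight \<tau>\<^sub>\<alpha> v / 2 * 1 \<le> weight \<tau>\<^sub>\<alpha> v / 2 * (norm (D v (?x v)))\<^sup>2"
      using v weight_pos[of v \<tau>\<^sub>\<alpha>] by (intro mult_left_mono) auto
    then have "y + weight \<tau>\<^sub>\<alpha> v / 2 \<le> 0" using y(2) by simp
    then show "\<exists>y. ((\<lambda>t. lyapunov t (?x t) + A t / 2) has_real_derivative y) (at v) \<and> y \<le> 0"
      using DERIV_add[OF y(1) DERIV_cdivide[OF A[of v], of 2]] v by auto
  qed
  have "\<forall>\<^sub>F t in at_top. 2 * lyapunov T (?x T) + A T < A t"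
    using A_top by (simp add: filterlim_at_top_dense)
  then obtain t where t: "T \<le> t" "2 * lyapunov T (?x T) + A T < A t"
    using eventually_happens'[OF trivial_limit_at_top_linorder eventually_conj[OF eventually_ge_at_top]] by blast
  have "0 \<le> lyapunov t (?x t)"
    using ge[of t] T[OF t(1)] excess_nonneg[of z] \<eta> by linarith
  then show False using dec[OF t(1)] t(2) by linarith
qed

end

section \<open>Hyperbolicity near the saddle point\<close>

text \<open>\<open>real CARD('n) * \<nu>\<close> is the margin of the summed Hessian, so \<nu> is
  the margin on consensus vectors, whose squared norm carries the factor \<open>CARD('n)\<close>.
  The first bound in \<open>T0\<close> lets the damping of disagreement absorb the cross terms; the
  second keeps the defect at \<open>X0\<close> below \<nu>/2 times
  \<open>\<delta>\<^sup>2 / 20\<close>, for which the shooting solution stays within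
  \<delta>/2.\<close>

locale saddle_flow = distributed_flow E f \<tau>\<^sub>\<alpha> \<tau>\<^sub>\<beta> K lam m
  for E :: "('n::finite \<times> 'n) set" and f :: "'n \<Rightarrow> real ^ 'd::finite \<Rightarrow> real" and \<tau>\<^sub>\<alpha> \<tau>\<^sub>\<beta> K lam m +
  fixes xs :: "real ^ 'd" and V :: "(real ^ 'd) set" and P :: "real ^ 'd ^ 'n \<Rightarrow> real ^ 'd ^ 'n"
    and \<nu> \<delta> T0 :: real and A :: "real \<Rightarrow> real"
  assumes crit: "(\<Sum>n\<in>UNIV. grad (f n) xs) = 0"
    and V: "subspace V" and V_inv: "v \<in> V \<Longrightarrow> (\<Sum>n\<in>UNIV. hessian (f n) xs *v v) \<in> V"
    and V_neg: "v \<in> V \<Longrightarrow> v \<bullet> (\<Sum>n\<in>UNIV. hessian (f n) xs *v v) \<le> - (real CARD('n) * \<nu>) * (norm v)\<^sup>2"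
    and V_pos: "(\<And>v. v \<in> V \<Longrightarrow> w \<bullet> v = 0) \<Longrightarrow>
      (real CARD('n) * \<nu>) * (norm w)\<^sup>2 \<le> w \<bullet> (\<Sum>n\<in>UNIV. hessian (f n) xs *v w)"
    and \<nu>_pos: "0 < \<nu>"
    and P_lin: "linear P" and P_range: "P x \<in> const ` V"
    and P_orthogonal: "y \<in> const ` V \<Longrightarrow> (x - P x) \<bullet> y = 0"
    and \<delta>_pos: "0 < \<delta>"
    and approx: "norm v \<le> \<delta> \<Longrightarrow> norm w \<le> \<delta> \<Longrightarrow>
      norm (grad (f n) (xs + v) - grad (f n) (xs + w) - hessian (f n) xs *v (v - w)) \<le> \<nu> / 16 * norm (v - w)"
    and A': "0 \<le> t \<Longrightarrow> (A has_real_derivative weight \<tau>\<^sub>\<alpha> t) (at t)" and A_at_top: "filterlim A at_top at_top"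
    and T0_ge: "T1 \<le> T0"
    and T0: "T0 \<le> t \<Longrightarrow> 32 * K\<^sup>2 / \<nu> + 4 * K + 2 * \<nu> \<le> lam * \<gamma> t"
      "T0 \<le> t \<Longrightarrow> 4 * (norm (gradients (const xs)))\<^sup>2 / (lam * \<gamma> t) \<le> \<nu> / 2 * (\<delta>\<^sup>2 / 20)"
begin

abbreviation X0 :: "real ^ 'd ^ 'n" where "X0 \<equiv> const xs"

lemma T0_nonneg: "0 \<le> T0"
  using T1(1) T0_ge by simp

definition hess :: "real ^ 'd ^ 'n \<Rightarrow> real ^ 'd ^ 'n" where
  "hess w = (\<chi> n. hessian (f n) xs *v w $ n)"

lemma hess_add: "hess (v + w) = hess v + hess w"
  by (simp add: hess_def vec_eq_iff[of "_ :: real ^ 'd ^ 'n"] matrix_vector_right_distrib)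

lemma hess_diff: "hess (v - w) = hess v - hess w"
  by (simp add: hess_def vec_eq_iff[of "_ :: real ^ 'd ^ 'n"] matrix_vector_mult_diff_distrib)

lemma norm_hess: "norm (hess w) \<le> K * norm w"
  using K_gt_0 by (intro norm_le_componentwise)
    (auto simp: hess_def intro!: hessian_lipschitz_bound C2 grad_lip)

text \<open>Only the consensus part of the Hessian form is definite; it splits along \<open>V\<close>.\<close>

lemma hess_consensus:
  assumes a: "1 \<le> a"
  shows "(P (const u) - a *\<^sub>R (const u - P (const u))) \<bullet> hess (const u) \<le> - \<nu> * (norm (const u :: real ^ 'd ^ 'n))\<^sup>2"
proof -
  define H where "H v = (\<Sum>n\<in>UNIV. hessian (f n) xs *v v)" for v
  obtain p where p: "p \<in> V" "P (const u) = const p"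
    using P_range[of "const u"] by blast
  define q where "q = u - p"
  have u: "u = p + q" by (simp add: q_def)
  have cq: "const u - P (const u) = (const q :: real ^ 'd ^ 'n)"
    by (simp add: p q_def linear_diff[OF linear_const])
  have q: "q \<bullet> v = 0" if "v \<in> V" for v
  proof -
    have "real CARD('n) * (q \<bullet> v) = const q \<bullet> (const v :: real ^ 'd ^ 'n)"
      by (simp add: inner_blocks)
    also have "\<dots> = 0"
      using P_orthogonal[of "const v" "const u"] that unfolding cq by simp
    finally show ?thesis by simp
  qed
  have Hq: "H (p + q) = H p + H q"
    by (simp add: H_def matrix_vector_right_distrib sum.distrib)
  have Hs: "v \<bullet> H w = H v \<bullet> w" for v w
    unfolding H_def inner_sum_right inner_sum_left using hessian_selfadjoint[OF C2] by (intro sum.cong) auto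
  have Hp: "H p \<in> V" unfolding H_def by (rule V_inv[OF p(1)])
  \<comment> \<open>\<open>V\<close> is invariant under the symmetric \<open>H\<close>, so the form
    has no mixed terms between \<open>p\<close> and \<open>q\<close>.\<close>
  have cross: "q \<bullet> H p = 0" "p \<bullet> H q = 0"
    using q[OF Hp] Hs[of p q] by (simp_all add: inner_commute)
  have pq: "p \<bullet> q = 0" using q[OF p(1)] by (simp add: inner_commute)
  have "(P (const u) - a *\<^sub>R (const u - P (const u))) \<bullet> hess (const u) = const (p - a *\<^sub>R q) \<bullet> hess (const u)"
    unfolding cq unfolding p(2) by (simp add: linear_diff[OF linear_const] linear_scale[OF linear_const])
  also have "\<dots> = (p - a *\<^sub>R q) \<bullet> H u"
    by (simp add: inner_blocks hess_def H_def inner_sum_right)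
  also have "\<dots> = p \<bullet> H p - a * (q \<bullet> H q)"
    using cross by (simp add: u Hq inner_diff_left inner_add_right)
  also have "\<dots> \<le> - (real CARD('n) * \<nu>) * (norm p)\<^sup>2 - 1 * ((real CARD('n) * \<nu>) * (norm q)\<^sup>2)"
  proof (intro diff_mono)
    show "p \<bullet> H p \<le> - (real CARD('n) * \<nu>) * (norm p)\<^sup>2"
      unfolding H_def by (rule V_neg[OF p(1)])
    have "(real CARD('n) * \<nu>) * (norm q)\<^sup>2 \<le> q \<bullet> H q"
      unfolding H_def by (rule V_pos) (rule q)
    then show "1 * ((real CARD('n) * \<nu>) * (norm q)\<^sup>2) \<le> a * (q \<bullet> H q)"
      using a \<nu>_pos by (intro mult_mono) auto
  qed
  also have "\<dots> = - (real CARD('n) * \<nu>) * (norm u)\<^sup>2"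
    using pq by (simp add: u power2_norm_eq_inner inner_add_left inner_add_right inner_commute algebra_simps)
  also have "\<dots> = - \<nu> * (norm (const u :: real ^ 'd ^ 'n))\<^sup>2"
    by (simp add: norm_const)
  finally show ?thesis .
qed

lemma norm_split': "(norm w)\<^sup>2 = (norm (P w))\<^sup>2 + (norm (w - P w))\<^sup>2"
  by (rule norm_power2_decomposition[OF P_orthogonal[OF P_range]])

lemma reflect_norm_le:
  assumes a: "a \<in> {1, 2}"
  shows "norm (P w - a *\<^sub>R (w - P w)) \<le> 2 * norm w"
proof -
  have "norm (P w - a *\<^sub>R (w - P w)) \<le> 2 * norm w" if "a = 1 \<or> a = 2"
  proof -
    have o: "P w \<bullet> (w - P w) = 0"
      using P_orthogonal[OF P_range, of w w] by (simp add: inner_commute)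
    have "(norm (P w - a *\<^sub>R (w - P w)))\<^sup>2 = (norm (P w))\<^sup>2 + a\<^sup>2 * (norm (w - P w))\<^sup>2"
      using o unfolding power2_norm_eq_inner
      by (simp add: inner_diff_left[of "P w"] inner_diff_right[of _ "P w"] inner_commute[of "w - P w" "P w"] power2_eq_square)
    also have "\<dots> \<le> 4 * (norm (P w))\<^sup>2 + 4 * (norm (w - P w))\<^sup>2"
      using that by (intro add_mono mult_right_mono) auto
    also have "\<dots> = (2 * norm w)\<^sup>2"
      by (simp add: norm_split'[of w] power_mult_distrib)
    finally show ?thesis by (rule power2_le_imp_le) simp
  qed
  then show ?thesis using a by simp
qed

lemma P_disagreement:
  assumes "\<And>v. y \<bullet> const v = 0"
  shows "P y = 0"
proof -
  obtain v where v: "P y = const v" using P_range[of y] by blast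
  have "(y - P y) \<bullet> P y = 0" by (rule P_orthogonal[OF P_range])
  then have "P y \<bullet> P y = 0" using assms[of v] by (simp add: inner_diff_left v)
  then show ?thesis by simp
qed

text \<open>Split \<open>w\<close> into its consensus part \<open>c\<close> and the disagreement
  \<open>y\<close>. The Hessian form is definite on \<open>c\<close>, the coupling damps
  \<open>y\<close> at rate \<open>lam * \<gamma> t\<close>, and all other terms involve
  \<open>y\<close> or the small \<open>r\<close>. Part of the damping is kept on the left; it will
  absorb the gradient at \<open>X0\<close>.\<close>

lemma expansion:
  assumes a: "a \<in> {1, 2}" and t: "T0 \<le> t" and r: "norm r \<le> \<nu> / 16 * norm w"
  shows "weight \<tau>\<^sub>\<alpha> t * (\<nu> * (norm w)\<^sup>2 + lam * \<gamma> t * (norm (w - const (mean w)))\<^sup>2)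
    \<le> 2 * ((P w - a *\<^sub>R (w - P w)) \<bullet> (- (weight \<tau>\<^sub>\<beta> t *\<^sub>R laplacian E w) - weight \<tau>\<^sub>\<alpha> t *\<^sub>R (hess w + r)))"
proof -
  have t0: "0 \<le> t" using t T0_nonneg by simp
  have a1: "1 \<le> a" "a \<le> 2" using a by auto
  define c :: "real ^ 'd ^ 'n" where "c = const (mean w)"
  define y where "y = w - c"
  have w: "w = c + y" by (simp add: y_def)
  have yc: "y \<bullet> const v = 0" for v
    unfolding y_def c_def by (rule mean_decomposition(2))
  have Py: "P y = 0" by (rule P_disagreement[OF yc])
  have Pw: "P w = P c" unfolding w by (simp add: linear_add[OF P_lin] Py)
  define R where "R = P w - a *\<^sub>R (w - P w)"
  define Rc where "Rc = P c - a *\<^sub>R (c - P c)"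
  have R: "R = Rc - a *\<^sub>R y"
    by (simp add: R_def Rc_def Pw w[symmetric] y_def scaleR_diff_right)
  have ncy: "(norm w)\<^sup>2 = (norm c)\<^sup>2 + (norm y)\<^sup>2"
  proof -
    have "y \<bullet> c = 0" unfolding c_def by (rule yc)
    then have "(c + y) \<bullet> (c + y) = c \<bullet> c + y \<bullet> y"
      by (simp add: inner_add_left inner_add_right inner_commute)
    then show ?thesis unfolding w[symmetric] by (simp add: power2_norm_eq_inner)
  qed
  have RL: "R \<bullet> laplacian E w = - a * (w \<bullet> laplacian E w)"
  proof -
    obtain v where v: "P w = const v" using P_range[of w] by blast
    have "P w \<bullet> laplacian E w = 0"
      using laplacian_selfadjoint[OF sym, of "P w" w] by (simp add: v)
    then show ?thesis by (simp add: R_def inner_diff_left)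
  qed
  have wLw: "lam * (norm y)\<^sup>2 \<le> w \<bullet> laplacian E w"
    unfolding y_def c_def by (rule disagreement(3))
  have "Rc \<bullet> hess c \<le> - \<nu> * (norm c)\<^sup>2"
    unfolding Rc_def c_def by (rule hess_consensus[OF a1(1)])
  moreover have "Rc \<bullet> hess y \<le> 2 * norm c * (K * norm y)"
  proof -
    have "Rc \<bullet> hess y \<le> norm Rc * norm (hess y)" by (rule norm_cauchy_schwarz)
    also have "\<dots> \<le> 2 * norm c * (K * norm y)"
      unfolding Rc_def using reflect_norm_le[OF a, of c] norm_hess[of y] by (intro mult_mono) auto
    finally show ?thesis .
  qed
  moreover have "- (a * (y \<bullet> hess c)) \<le> 2 * (norm y * (K * norm c))"
  proof -
    have "- (y \<bullet> hess c) \<le> norm y * norm (hess c)"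
      using Cauchy_Schwarz_ineq2[of y "hess c"] by linarith
    also have "\<dots> \<le> norm y * (K * norm c)"
      by (intro mult_left_mono norm_hess) auto
    finally have "a * - (y \<bullet> hess c) \<le> a * (norm y * (K * norm c))"
      using a1 by (intro mult_left_mono) auto
    also have "\<dots> \<le> 2 * (norm y * (K * norm c))"
      using a1 K_gt_0 by (intro mult_right_mono) auto
    finally show ?thesis by simp
  qed
  moreover have "- (a * (y \<bullet> hess y)) \<le> 2 * (norm y * (K * norm y))"
  proof -
    have "- (y \<bullet> hess y) \<le> norm y * norm (hess y)"
      using Cauchy_Schwarz_ineq2[of y "hess y"] by linarith
    also have "\<dots> \<le> norm y * (K * norm y)"
      by (intro mult_left_mono norm_hess) auto
    finally have "a * - (y \<bullet> hess y) \<le> a * (norm y * (K * norm y))"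
      using a1 by (intro mult_left_mono) auto
    also have "\<dots> \<le> 2 * (norm y * (K * norm y))"
      using a1 K_gt_0 by (intro mult_right_mono) auto
    finally show ?thesis by simp
  qed
  moreover have "R \<bullet> hess w = Rc \<bullet> hess c + Rc \<bullet> hess y - a * (y \<bullet> hess c) - a * (y \<bullet> hess y)"
    unfolding R w hess_add by (simp add: inner_diff_left inner_add_right algebra_simps)
  ultimately have Rh: "R \<bullet> hess w \<le> - \<nu> * (norm c)\<^sup>2 + 4 * K * norm c * norm y + 2 * K * (norm y)\<^sup>2"
    by (simp add: power2_eq_square mult_ac)
  have "R \<bullet> r \<le> norm R * norm r" by (rule norm_cauchy_schwarz)
  also have "\<dots> \<le> (2 * norm w) * (\<nu> / 16 * norm w)"
    unfolding R_def using reflect_norm_le[OF a, of w] r by (intro mult_mono) auto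
  finally have Rr: "R \<bullet> r \<le> \<nu> / 8 * ((norm c)\<^sup>2 + (norm y)\<^sup>2)"
    unfolding ncy[symmetric] by (simp add: power2_eq_square)
  \<comment> \<open>Young's inequality, spending only half of \<nu> on \<open>c\<close>; the
    resulting coefficient of \<open>(norm y)\<^sup>2\<close> is the leading one in
    \<open>T0\<close>.\<close>
  have amgm: "8 * K * norm c * norm y \<le> \<nu> / 2 * (norm c)\<^sup>2 + 32 * K\<^sup>2 / \<nu> * (norm y)\<^sup>2"
  proof -
    have "0 \<le> (\<nu> * norm c - 8 * K * norm y)\<^sup>2 / (2 * \<nu>)" using \<nu>_pos by simp
    also have "\<dots> = \<nu> / 2 * (norm c)\<^sup>2 + 32 * K\<^sup>2 / \<nu> * (norm y)\<^sup>2 - 8 * K * norm c * norm y"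
      using \<nu>_pos by (simp add: power2_eq_square field_simps)
    finally show ?thesis by simp
  qed
  have Ty: "(32 * K\<^sup>2 / \<nu> + 4 * K + 2 * \<nu>) * (norm y)\<^sup>2 \<le> lam * \<gamma> t * (norm y)\<^sup>2"
    using T0(1)[OF t] by (intro mult_right_mono) auto
  \<comment> \<open>Of the double damping on the right, one copy pays for all terms in
    \<open>y\<close>; the other survives.\<close>
  have main: "\<nu> * ((norm c)\<^sup>2 + (norm y)\<^sup>2) + lam * \<gamma> t * (norm y)\<^sup>2
     \<le> 2 * (lam * \<gamma> t * (norm y)\<^sup>2) - 2 * (R \<bullet> hess w) - 2 * (R \<bullet> r)"
    using Rh Rr amgm Ty mult_nonneg_nonneg[OF less_imp_le[OF \<nu>_pos] zero_le_power2[of "norm y"]]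
      mult_nonneg_nonneg[OF less_imp_le[OF \<nu>_pos] zero_le_power2[of "norm c"]]
    by (simp add: algebra_simps)
  have "lam * \<gamma> t * (norm y)\<^sup>2 \<le> \<gamma> t * (w \<bullet> laplacian E w)"
    using mult_left_mono[OF wLw less_imp_le[OF \<gamma>_pos[OF t0]]] by (simp add: mult_ac)
  also have "\<dots> \<le> a * (\<gamma> t * (w \<bullet> laplacian E w))"
    using mult_right_mono[OF a1(1), of "\<gamma> t * (w \<bullet> laplacian E w)"] \<gamma>_pos[OF t0]
      inner_laplacian_nonneg[OF sym, of w] by simp
  finally have "\<nu> * (norm w)\<^sup>2 + lam * \<gamma> t * (norm y)\<^sup>2
     \<le> 2 * (a * (\<gamma> t * (w \<bullet> laplacian E w)) - R \<bullet> hess w - R \<bullet> r)"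
    using main unfolding ncy by simp
  then have "weight \<tau>\<^sub>\<alpha> t * (\<nu> * (norm w)\<^sup>2 + lam * \<gamma> t * (norm y)\<^sup>2)
     \<le> weight \<tau>\<^sub>\<alpha> t * (2 * (a * (\<gamma> t * (w \<bullet> laplacian E w)) - R \<bullet> hess w - R \<bullet> r))"
    using weight_pos[of t \<tau>\<^sub>\<alpha>] t0 by (intro mult_left_mono) auto
  also have "\<dots> = 2 * (R \<bullet> (- (weight \<tau>\<^sub>\<beta> t *\<^sub>R laplacian E w) - weight \<tau>\<^sub>\<alpha> t *\<^sub>R (hess w + r)))"
    using weight_ratio[of t \<tau>\<^sub>\<beta> \<tau>\<^sub>\<alpha>] t0 RL
    by (simp add: inner_diff_right inner_add_right \<gamma>_def \<kappa>_def algebra_simps)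
  finally show ?thesis
    unfolding R_def y_def c_def .
qed

section \<open>Freezing the nonlinearity outside a ball\<close>

definition clip :: "real ^ 'd \<Rightarrow> real ^ 'd" where
  "clip = closest_point (cball 0 \<delta>)"

lemma clip_self: "norm w \<le> \<delta> \<Longrightarrow> clip w = w"
  unfolding clip_def by (rule closest_point_self) simp

lemma norm_clip: "norm (clip w) \<le> \<delta>"
  using closest_point_in_set[of "cball 0 \<delta>" w] \<delta>_pos by (simp add: clip_def)

lemma clip_lip: "norm (clip v - clip w) \<le> norm (v - w)"
  using closest_point_lipschitz[of "cball 0 \<delta>" v w] \<delta>_pos by (simp add: clip_def dist_norm)

text \<open>Blockwise Taylor remainder of the gradients at the clipped displacement. Only the
  remainder is clipped, since the linear part satisfies the estimates globally.\<close>

definition remainder :: "real ^ 'd ^ 'n \<Rightarrow> real ^ 'd ^ 'n" where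
  "remainder w = (\<chi> n. grad (f n) (xs + clip (w $ n)) - grad (f n) xs - hessian (f n) xs *v clip (w $ n))"

lemma remainder_lip: "norm (remainder v - remainder w) \<le> \<nu> / 16 * norm (v - w)"
proof (rule norm_le_componentwise)
  fix n
  have "norm (remainder v $ n - remainder w $ n) = norm (grad (f n) (xs + clip (v $ n))
      - grad (f n) (xs + clip (w $ n)) - hessian (f n) xs *v (clip (v $ n) - clip (w $ n)))"
    by (simp add: remainder_def matrix_vector_mult_diff_distrib algebra_simps)
  also have "\<dots> \<le> \<nu> / 16 * norm (clip (v $ n) - clip (w $ n))"
    by (intro approx norm_clip)
  also have "\<dots> \<le> \<nu> / 16 * norm (v $ n - w $ n)"
    using \<nu>_pos by (intro mult_left_mono clip_lip) auto
  finally show "norm ((remainder v - remainder w) $ n) \<le> \<nu> / 16 * norm ((v - w) $ n)" by simp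
qed (use \<nu>_pos in simp)

text \<open>Outside the \<open>\<delta>\<close>-ball the nonlinearity is frozen, so that the hyperbolicity estimates hold
  globally.\<close>

definition clipped :: "real ^ 'd ^ 'n \<Rightarrow> real ^ 'd ^ 'n" where
  "clipped x = gradients X0 + hess (x - X0) + remainder (x - X0)"

lemma clipped_eq: "norm (x - X0) \<le> \<delta> \<Longrightarrow> clipped x = gradients x"
proof -
  assume "norm (x - X0) \<le> \<delta>"
  then have "norm ((x - X0) $ n) \<le> \<delta>" for n
    using Finite_Cartesian_Product.norm_nth_le[of "x - X0" n] by linarith
  then show ?thesis
    by (simp add: vec_eq_iff[of "_ :: real ^ 'd ^ 'n"] clipped_def gradients_def hess_def remainder_def clip_self)
qed

lemma clipped_diff: "clipped x - clipped y = hess (x - y) + (remainder (x - X0) - remainder (y - X0))"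
proof -
  have "hess (x - y) = hess (x - X0) - hess (y - X0)" by (simp add: hess_diff[symmetric])
  then show ?thesis by (simp add: clipped_def)
qed

lemma clipped_lip: "norm (clipped x - clipped y) \<le> (K + \<nu> / 16) * norm (x - y)"
  unfolding clipped_diff
  using norm_triangle_ineq[of "hess (x - y)" "remainder (x - X0) - remainder (y - X0)"]
    norm_hess[of "x - y"] remainder_lip[of "x - X0" "y - X0"]
  by (simp add: algebra_simps)

lemma clipped_ode: "lipschitz_ode (network_field E \<tau>\<^sub>\<alpha> \<tau>\<^sub>\<beta> (\<lambda>_. clipped))
    (laplacian_bound E TYPE('d) + (K + \<nu> / 16)) (norm (clipped 0))"
proof (rule network_field_lipschitz_ode)
  have "(K + \<nu> / 16)-lipschitz_on UNIV clipped"
    using K_gt_0 \<nu>_pos clipped_lip by (intro lipschitz_onI) (auto simp: dist_norm)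
  then have "continuous_on UNIV clipped" by (rule lipschitz_on_continuous_on)
  then show "continuous_on UNIV (\<lambda>(t, x). clipped x)"
    unfolding split_def by (rule continuous_on_compose2) (auto intro!: continuous_intros)
qed (use \<tau>\<^sub>\<beta> \<tau>_less K_gt_0 \<nu>_pos clipped_lip in auto)

text \<open>Taking \<open>k = \<nu> / 2\<close> turns the required \<open>2 * k\<close> into the
  \<nu> of \<open>expansion\<close>. That estimate gives \<open>expand\<close> by dropping the
  disagreement term, and \<open>center\<close> by spending it on the gradients at
  \<open>X0\<close>.\<close>

sublocale hyp: hyperbolic "network_field E \<tau>\<^sub>\<alpha> \<tau>\<^sub>\<beta> (\<lambda>_. clipped)"
  "laplacian_bound E TYPE('d) + (K + \<nu> / 16)" "norm (clipped 0)" P "const ` V" X0 A "weight \<tau>\<^sub>\<alpha>"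
  "\<lambda>t. 4 * (norm (gradients X0))\<^sup>2 / (lam * \<gamma> t)" "\<nu> / 2" "\<delta>\<^sup>2 / 20" T0
proof (intro hyperbolic.intro clipped_ode hyperbolic_axioms.intro)
  let ?g = "gradients X0"
  have nn: "0 \<le> t" if "T0 \<le> t" for t using that T0_nonneg by simp
  show "subspace (const ` V :: (real ^ 'd ^ 'n) set)"
    by (rule linear_subspace_image[OF linear_const V])
  show "linear P" "\<And>x. P x \<in> const ` V" "\<And>y x. y \<in> const ` V \<Longrightarrow> (x - P x) \<bullet> y = 0"
    by (fact P_lin P_range P_orthogonal)+
  show "\<And>t. T0 \<le> t \<Longrightarrow> (A has_real_derivative weight \<tau>\<^sub>\<alpha> t) (at t)"
    using A' nn by blast
  show "filterlim A at_top at_top" by (rule A_at_top)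
  show "0 < weight \<tau>\<^sub>\<alpha> t" if "T0 \<le> t" for t
    using nn[OF that] by (intro weight_pos) auto
  show "0 < \<nu> / 2" using \<nu>_pos by simp
  show "0 \<le> 4 * (norm ?g)\<^sup>2 / (lam * \<gamma> t)" if "T0 \<le> t" for t
    using \<gamma>_pos[OF nn[OF that]] lam_pos by simp
  show "4 * (norm ?g)\<^sup>2 / (lam * \<gamma> t) \<le> \<nu> / 2 * (\<delta>\<^sup>2 / 20)" if "T0 \<le> t" for t
    by (rule T0(2)[OF that])
  have "((\<lambda>t. 4 * (norm ?g)\<^sup>2 / lam * inverse (\<gamma> t)) \<longlongrightarrow> 4 * (norm ?g)\<^sup>2 / lam * 0) at_top"
    by (intro tendsto_intros tendsto_inverse_0_at_top \<gamma>_top)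
  then show "((\<lambda>t. 4 * (norm ?g)\<^sup>2 / (lam * \<gamma> t)) \<longlongrightarrow> 0) at_top"
    by (simp add: divide_inverse mult.assoc)
  have ex: "weight \<tau>\<^sub>\<alpha> t * (\<nu> * (norm (x - y))\<^sup>2 + lam * \<gamma> t * (norm ((x - y) - const (mean (x - y))))\<^sup>2)
     \<le> 2 * ((P (x - y) - a *\<^sub>R ((x - y) - P (x - y))) \<bullet>
        (network_field E \<tau>\<^sub>\<alpha> \<tau>\<^sub>\<beta> (\<lambda>_. clipped) t x - network_field E \<tau>\<^sub>\<alpha> \<tau>\<^sub>\<beta> (\<lambda>_. clipped) t y))"
    if "a \<in> {1, 2}" "T0 \<le> t" for a t and x y :: "real ^ 'd ^ 'n"
    unfolding network_field_diff clipped_diff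
    using expansion[OF that, of "remainder (x - X0) - remainder (y - X0)" "x - y"]
      remainder_lip[of "x - X0" "y - X0"] nn[OF that(2)] by simp
  have pos: "0 \<le> lam * \<gamma> t * (norm w)\<^sup>2" if "T0 \<le> t" for t and w :: "real ^ 'd ^ 'n"
    using lam_pos \<gamma>_pos[OF nn[OF that]] by simp
  show "weight \<tau>\<^sub>\<alpha> t * (2 * (\<nu> / 2) * (norm (x - y))\<^sup>2)
     \<le> 2 * ((P (x - y) - a *\<^sub>R ((x - y) - P (x - y))) \<bullet>
        (network_field E \<tau>\<^sub>\<alpha> \<tau>\<^sub>\<beta> (\<lambda>_. clipped) t x - network_field E \<tau>\<^sub>\<alpha> \<tau>\<^sub>\<beta> (\<lambda>_. clipped) t y))"
    if "a \<in> {1, 2}" "T0 \<le> t" for a t and x y :: "real ^ 'd ^ 'n"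
  proof (rule order_trans[OF _ ex[OF that]])
    show "weight \<tau>\<^sub>\<alpha> t * (2 * (\<nu> / 2) * (norm (x - y))\<^sup>2) \<le>
      weight \<tau>\<^sub>\<alpha> t * (\<nu> * (norm (x - y))\<^sup>2 + lam * \<gamma> t * (norm ((x - y) - const (mean (x - y))))\<^sup>2)"
      using pos[OF that(2), of "(x - y) - const (mean (x - y))"] weight_pos[of t \<tau>\<^sub>\<alpha>] nn[OF that(2)]
      by (intro mult_left_mono) auto
  qed
  show "weight \<tau>\<^sub>\<alpha> t * (2 * (\<nu> / 2) * (norm (x - X0))\<^sup>2 - 4 * (norm ?g)\<^sup>2 / (lam * \<gamma> t))
     \<le> 2 * ((P (x - X0) - a *\<^sub>R ((x - X0) - P (x - X0))) \<bullet> network_field E \<tau>\<^sub>\<alpha> \<tau>\<^sub>\<beta> (\<lambda>_. clipped) t x)"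
    if a: "a \<in> {1, 2}" and t: "T0 \<le> t" for a t and x :: "real ^ 'd ^ 'n"
  proof -
    define w where "w = x - X0"
    define y where "y = w - const (mean w)"
    define R where "R = P w - a *\<^sub>R (w - P w)"
    define l where "l = lam * \<gamma> t"
    have l: "0 < l" using lam_pos \<gamma>_pos[OF nn[OF t]] by (simp add: l_def)
    have wt: "0 < weight \<tau>\<^sub>\<alpha> t" using nn[OF t] by (intro weight_pos) auto
    \<comment> \<open>Criticality of \<open>xs\<close> says precisely that the gradient vector at
      \<open>X0\<close> is orthogonal to consensus, so it meets only the damped
      disagreement.\<close>
    have gc: "?g \<bullet> const v = 0" for v
      unfolding inner_const using crit by (simp add: gradients_def)
    have fX0: "network_field E \<tau>\<^sub>\<alpha> \<tau>\<^sub>\<beta> (\<lambda>_. clipped) t X0 = - (weight \<tau>\<^sub>\<alpha> t *\<^sub>R ?g)"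
      using clipped_eq[of X0] \<delta>_pos nn[OF t] by (simp add: network_field_def)
    obtain v where v: "P w = const v" using P_range[of w] by blast
    have "R \<bullet> ?g = - a * (y \<bullet> ?g)"
      using gc[of v] gc[of "mean w"] by (simp add: R_def v y_def inner_commute[of _ ?g] inner_diff_right)
    then have "R \<bullet> - (weight \<tau>\<^sub>\<alpha> t *\<^sub>R ?g) = weight \<tau>\<^sub>\<alpha> t * (a * (y \<bullet> ?g))"
      by simp
    moreover have "- (a * (y \<bullet> ?g)) \<le> 2 * (norm y * norm ?g)"
    proof -
      have "a * - (y \<bullet> ?g) \<le> a * (norm y * norm ?g)"
        using Cauchy_Schwarz_ineq2[of y ?g] a by (intro mult_left_mono) auto
      also have "\<dots> \<le> 2 * (norm y * norm ?g)"
        using a by (intro mult_right_mono) auto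
      finally show ?thesis by simp
    qed
    \<comment> \<open>Completing the square against the damping \<open>l\<close> produces the defect
      \<open>4 * (norm ?g)\<^sup>2 / l\<close>.\<close>
    moreover have "4 * (norm y * norm ?g) \<le> l * (norm y)\<^sup>2 + 4 * (norm ?g)\<^sup>2 / l"
    proof -
      have "0 \<le> (l * norm y - 2 * norm ?g)\<^sup>2 / l" using l by simp
      also have "\<dots> = l * (norm y)\<^sup>2 + 4 * (norm ?g)\<^sup>2 / l - 4 * (norm y * norm ?g)"
        using l by (simp add: power2_eq_square field_simps)
      finally show ?thesis by simp
    qed
    ultimately have low: "- (weight \<tau>\<^sub>\<alpha> t * (l * (norm y)\<^sup>2 + 4 * (norm ?g)\<^sup>2 / l)) \<le> 2 * (R \<bullet> - (weight \<tau>\<^sub>\<alpha> t *\<^sub>R ?g))"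
    proof -
      assume 1: "R \<bullet> - (weight \<tau>\<^sub>\<alpha> t *\<^sub>R ?g) = weight \<tau>\<^sub>\<alpha> t * (a * (y \<bullet> ?g))"
        and 2: "- (a * (y \<bullet> ?g)) \<le> 2 * (norm y * norm ?g)"
        and 3: "4 * (norm y * norm ?g) \<le> l * (norm y)\<^sup>2 + 4 * (norm ?g)\<^sup>2 / l"
      have "- (l * (norm y)\<^sup>2 + 4 * (norm ?g)\<^sup>2 / l) \<le> 2 * (a * (y \<bullet> ?g))"
        using 2 3 by linarith
      then have "weight \<tau>\<^sub>\<alpha> t * - (l * (norm y)\<^sup>2 + 4 * (norm ?g)\<^sup>2 / l) \<le> weight \<tau>\<^sub>\<alpha> t * (2 * (a * (y \<bullet> ?g)))"
        using wt by (intro mult_left_mono) auto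
      then show ?thesis unfolding 1 by (simp only: mult_minus_right mult.left_commute)
    qed
    have "weight \<tau>\<^sub>\<alpha> t * (\<nu> * (norm w)\<^sup>2 + l * (norm y)\<^sup>2)
      \<le> 2 * (R \<bullet> (network_field E \<tau>\<^sub>\<alpha> \<tau>\<^sub>\<beta> (\<lambda>_. clipped) t x - - (weight \<tau>\<^sub>\<alpha> t *\<^sub>R ?g)))"
      using ex[OF a t, of x X0] unfolding fX0 w_def[symmetric] y_def[symmetric] R_def[symmetric] l_def[symmetric] .
    then have "weight \<tau>\<^sub>\<alpha> t * (\<nu> * (norm w)\<^sup>2 + l * (norm y)\<^sup>2) + 2 * (R \<bullet> - (weight \<tau>\<^sub>\<alpha> t *\<^sub>R ?g))
      \<le> 2 * (R \<bullet> network_field E \<tau>\<^sub>\<alpha> \<tau>\<^sub>\<beta> (\<lambda>_. clipped) t x)"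
      by (simp add: inner_diff_right inner_add_right)
    with low have "weight \<tau>\<^sub>\<alpha> t * (\<nu> * (norm w)\<^sup>2 + l * (norm y)\<^sup>2) - weight \<tau>\<^sub>\<alpha> t * (l * (norm y)\<^sup>2 + 4 * (norm ?g)\<^sup>2 / l)
      \<le> 2 * (R \<bullet> network_field E \<tau>\<^sub>\<alpha> \<tau>\<^sub>\<beta> (\<lambda>_. clipped) t x)"
      by linarith
    then show ?thesis
      unfolding w_def[symmetric] R_def[symmetric] l_def[symmetric] by (simp add: right_diff_distrib distrib_left)
  qed
qed

end

section \<open>The stable set\<close>

text \<open>Adding the constant \<open>c\<^sup>2\<close> to the squared norm makes the inequality
  homogeneous, with rate \<open>2 * K + 1\<close>. The conclusion is linear in \<open>c\<close>, as
  the linearisation error needs.\<close>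

lemma inhomogeneous_growth:
  fixes x :: "real \<Rightarrow> 'a::real_inner"
  assumes "a \<le> b" "continuous_on {a..b} x" "x a = 0" "0 \<le> c" "0 \<le> K"
    and x': "\<And>t. a < t \<Longrightarrow> t < b \<Longrightarrow> (x has_vector_derivative x' t) (at t)"
    and le: "\<And>t. a < t \<Longrightarrow> t < b \<Longrightarrow> norm (x' t) \<le> K * norm (x t) + c"
  shows "norm (x b) \<le> c * exp ((2 * K + 1) * (b - a))"
proof -
  let ?g = "\<lambda>t. (norm (x t))\<^sup>2 + c\<^sup>2"
  have cont: "continuous_on {a..b} ?g"
    using assms by (intro continuous_intros)
  have d: "(?g has_real_derivative 2 * (x t \<bullet> x' t)) (at t)" if "a < t" "t < b" for t
    using DERIV_add[OF has_real_derivative_norm_power2[OF x'[OF that]] DERIV_const[of "c\<^sup>2"]] by simp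
  have "?g b \<le> ?g a * exp ((2 * K + 1) * b - (2 * K + 1) * a)"
  proof (rule gronwall_upper[where \<alpha> = "\<lambda>_. 2 * K + 1", OF \<open>a \<le> b\<close> cont _ d])
    show "2 * (x t \<bullet> x' t) \<le> (2 * K + 1) * ?g t" if t: "a < t" "t < b" for t
    proof -
      have "x t \<bullet> x' t \<le> norm (x t) * norm (x' t)" by (rule norm_cauchy_schwarz)
      also have "\<dots> \<le> norm (x t) * (K * norm (x t) + c)"
        using le[OF t] by (intro mult_left_mono) auto
      finally have "2 * (x t \<bullet> x' t) \<le> 2 * K * (norm (x t))\<^sup>2 + 2 * norm (x t) * c"
        by (simp add: power2_eq_square algebra_simps)
      also have "2 * norm (x t) * c \<le> (norm (x t))\<^sup>2 + c\<^sup>2"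
        by (rule sum_squares_bound)
      finally show ?thesis
        using mult_nonneg_nonneg[OF \<open>0 \<le> K\<close> zero_le_power2[of c]] by (simp add: algebra_simps)
    qed
  qed (auto intro!: continuous_intros derivative_eq_intros)
  then have "(norm (x b))\<^sup>2 + c\<^sup>2 \<le> c\<^sup>2 * exp ((2 * K + 1) * (b - a))"
    by (simp add: \<open>x a = 0\<close> right_diff_distrib)
  then have "(norm (x b))\<^sup>2 \<le> c\<^sup>2 * exp ((2 * K + 1) * (b - a))"
    using zero_le_power2[of c] by linarith
  also have "\<dots> \<le> c\<^sup>2 * (exp ((2 * K + 1) * (b - a)))\<^sup>2"
  proof (intro mult_left_mono)
    have "1 \<le> exp ((2 * K + 1) * (b - a))" using \<open>0 \<le> K\<close> \<open>a \<le> b\<close> by simp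
    then show "exp ((2 * K + 1) * (b - a)) \<le> (exp ((2 * K + 1) * (b - a)))\<^sup>2"
      by (simp add: power2_eq_square mult_le_cancel_left1)
  qed simp
  finally show ?thesis
    using \<open>0 \<le> c\<close> by - (rule power2_le_imp_le, simp_all add: power_mult_distrib)
qed

text \<open>\<open>v\<close> is the first time at which the level \<open>b\<close> is reached, and
  \<open>u\<close> the last time up to \<open>v\<close> at level \<open>a\<close>.\<close>

lemma crossing_interval:
  fixes n :: "real \<Rightarrow> real"
  assumes cont: "continuous_on {s..t} n" and "n s \<le> a" "a \<le> b" "b \<le> n t" "s \<le> t"
  obtains u v where "s \<le> u" "u \<le> v" "n u = a" "n v = b" "\<And>w. u \<le> w \<Longrightarrow> w \<le> v \<Longrightarrow> a \<le> n w \<and> n w \<le> b"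
proof -
  have sub: "continuous_on {x..y} n" if "s \<le> x" "y \<le> t" for x y
    using cont by (rule continuous_on_subset) (use that in auto)
  have cp: "compact ({x..y} \<inter> n -` {c})" if "s \<le> x" "y \<le> t" for x y c
    using continuous_closed_preimage[OF sub[OF that] closed_atLeastAtMost closed_singleton]
    by (auto simp: compact_eq_bounded_closed bounded_Int)
  define B where "B = {s..t} \<inter> n -` {b}"
  have "compact B"
    unfolding B_def by (rule cp) auto
  moreover have "B \<noteq> {}"
    using IVT'[of n s b t] assms by (auto simp: B_def)
  ultimately obtain v where v: "v \<in> B" "\<And>w. w \<in> B \<Longrightarrow> v \<le> w"
    using compact_attains_inf by metis
  have vb: "s \<le> v" "v \<le> t" "n v = b" using v(1) by (auto simp: B_def)
  have le: "n w \<le> b" if w: "s \<le> w" "w \<le> v" for w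
  proof (rule ccontr)
    assume "\<not> n w \<le> b"
    then obtain w' where w': "s \<le> w'" "w' \<le> w" "n w' = b"
      using IVT'[of n s b w] assms w sub[of s w] vb by auto
    then have "v \<le> w'" using v(2)[of w'] w vb by (auto simp: B_def)
    then have "w' = w" using w w' by linarith
    then show False using w' \<open>\<not> n w \<le> b\<close> by simp
  qed
  define C where "C = {s..v} \<inter> n -` {a}"
  have "compact C"
    unfolding C_def by (rule cp) (use vb in auto)
  moreover have "C \<noteq> {}"
    using IVT'[of n s a v] assms sub[of s v] vb by (auto simp: C_def)
  ultimately obtain u where u: "u \<in> C" "\<And>w. w \<in> C \<Longrightarrow> w \<le> u"
    using compact_attains_sup by metis
  have ua: "s \<le> u" "u \<le> v" "n u = a" using u(1) by (auto simp: C_def)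
  have ge: "a \<le> n w" if w: "u \<le> w" "w \<le> v" for w
  proof (rule ccontr)
    assume "\<not> a \<le> n w"
    then obtain w' where w': "w \<le> w'" "w' \<le> v" "n w' = a"
      using IVT'[of n w a v] assms w sub[of w v] vb ua by auto
    then have "w' \<le> u" using u(2)[of w'] w ua by (auto simp: C_def)
    then have "w' = w" using w w' by linarith
    then show False using w' \<open>\<not> a \<le> n w\<close> by simp
  qed
  show ?thesis using that[of u v] ua vb le ge by force
qed

text \<open>Points of \<open>S\<close> near \<open>z\<close> are separated modulo \<open>B\<close>,
  so the projection along \<open>B\<close>, composed with \<open>g\<close>, is injective between
  spaces of equal dimension. Invariance of domain makes it an open embedding, whose inverse
  parametrises the graph.\<close>

lemma local_continuous_graph:
  fixes g :: "'a::euclidean_space \<Rightarrow> 'a"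
  assumes B: "subspace B" and Wp: "subspace Wp" and dim: "dim B + dim Wp = DIM('a)"
    and g: "continuous_on Wp g" "inj_on g Wp" and U: "open U" and z: "z \<in> S" "z \<in> U"
    and S: "S \<inter> U = g ` Wp \<inter> U"
    and tr: "\<And>x y. x \<in> S \<inter> U \<Longrightarrow> y \<in> S \<inter> U \<Longrightarrow> x - y \<in> B \<Longrightarrow> x = y"
  shows "\<exists>U. open U \<and> z \<in> U \<and> continuous_graph (dim Wp) (S \<inter> U)"
proof -
  obtain PB where PB: "linear PB" "\<And>x. PB x \<in> B" and PBo: "\<And>x y. y \<in> B \<Longrightarrow> (x - PB x) \<bullet> y = 0"
    using orthogonal_projection[OF B] by blast
  define A where "A = {y. \<forall>x\<in>B. orthogonal x y}"
  have A: "subspace A"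
    unfolding A_def subspace_def by (auto simp: orthogonal_def inner_add_right)
  have dimA: "dim A = dim Wp"
    using dim_subspace_orthogonal_to_vectors[OF B subspace_UNIV] dim by (simp add: A_def)
  define \<pi> where "\<pi> x = x - PB x" for x
  have \<pi>A: "\<pi> x \<in> A" for x
    using PBo by (auto simp: A_def \<pi>_def orthogonal_def inner_commute)
  have PBlin: "bounded_linear PB" using PB(1) by (simp add: linear_conv_bounded_linear)
  have \<pi>_cont: "continuous_on T \<pi>" for T
    unfolding \<pi>_def by (intro continuous_intros bounded_linear.continuous_on[OF PBlin])
  have AB0: "y = 0" if "y \<in> A" "y \<in> B" for y
    using that by (auto simp: A_def orthogonal_def)
  have \<pi>_add: "\<pi> (u + b) = u" if "u \<in> A" "b \<in> B" for u b
  proof -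
    have "\<pi> (u + b) - u \<in> A" using \<pi>A that A by (intro subspace_diff)
    moreover have "\<pi> (u + b) - u = b - PB (u + b)" by (simp add: \<pi>_def)
    moreover have "b - PB (u + b) \<in> B" using that PB B by (intro subspace_diff)
    ultimately show ?thesis using AB0[of "\<pi> (u + b) - u"] by simp
  qed
  define Op where "Op = Wp \<inter> g -` U"
  have Op: "openin (top_of_set Wp) Op"
    unfolding Op_def using g(1) U by (rule continuous_openin_preimage_gen)
  have gOp: "g ` Op = S \<inter> U" using S by (auto simp: Op_def)
  let ?h = "\<lambda>p. \<pi> (g p)"
  have h_cont: "continuous_on Op ?h"
    using continuous_on_compose2[OF \<pi>_cont[of UNIV] continuous_on_subset[OF g(1), of Op]]
    by (auto simp: Op_def)
  have h_inj: "inj_on ?h Op"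
  proof (rule inj_onI)
    fix p q assume pq: "p \<in> Op" "q \<in> Op" "?h p = ?h q"
    have "g p - g q = PB (g p) - PB (g q)" using pq(3) by (simp add: \<pi>_def algebra_simps)
    also have "\<dots> \<in> B" using PB B by (intro subspace_diff)
    finally have "g p = g q" using pq gOp by (intro tr) auto
    then show "p = q" using g(2) pq by (auto simp: Op_def inj_on_def)
  qed
  have h_open: "openin (top_of_set A) (?h ` O')" if O': "openin (top_of_set Op) O'" for O'
  proof (rule invariance_of_domain_subspaces[OF _ Wp A])
    show "openin (top_of_set Wp) O'" using O' Op by (rule openin_trans)
    have sub: "O' \<subseteq> Op" using O' by (simp add: openin_imp_subset)
    show "continuous_on O' ?h" "inj_on ?h O'"
      using continuous_on_subset[OF h_cont sub] inj_on_subset[OF h_inj sub] by auto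
  qed (use dimA \<pi>A in auto)
  define D0 where "D0 = ?h ` Op"
  have D0: "openin (top_of_set A) D0"
    unfolding D0_def by (rule h_open) simp
  have hD0: "openin (top_of_set D0) (?h ` O')" if O': "openin (top_of_set Op) O'" for O'
  proof (rule openin_subset_trans[OF h_open[OF O']])
    show "?h ` O' \<subseteq> D0" using openin_imp_subset[OF O'] by (auto simp: D0_def)
    show "D0 \<subseteq> A" using \<pi>A by (auto simp: D0_def)
  qed
  obtain k where k: "homeomorphism Op D0 ?h k"
    using homeomorphism_injective_open_map[OF h_cont D0_def[symmetric] h_inj hD0] by blast
  have "z \<in> g ` Op" using gOp z by simp
  then have "\<pi> z \<in> D0" by (auto simp: D0_def)
  then obtain r where r: "0 < r" "ball (\<pi> z) r \<inter> A \<subseteq> D0"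
    using D0 unfolding openin_contains_ball by meson
  \<comment> \<open>Restricting to a ball makes the domain connected; \<open>U'\<close> cuts
    \<open>S\<close> down to the points over it.\<close>
  define D where "D = A \<inter> ball (\<pi> z) r"
  define U' where "U' = U \<inter> \<pi> -` ball (\<pi> z) r"
  define \<psi> where "\<psi> u = PB (g (k u))" for u
  have DD0: "D \<subseteq> D0" using r by (auto simp: D_def)
  have kD: "k u \<in> Op" "\<pi> (g (k u)) = u" if "u \<in> D" for u
    using that DD0 k by (auto simp: homeomorphism_def)
  have kh: "k (?h p) = p" if "p \<in> Op" for p
    using that k by (auto simp: homeomorphism_def)
  have "open U'"
    unfolding U'_def by (rule open_Int[OF U open_vimage[OF open_ball \<pi>_cont]])
  moreover have "z \<in> U'" using z r by (simp add: U'_def)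
  moreover have "continuous_graph (dim Wp) (S \<inter> U')"
    unfolding continuous_graph_def
  proof (rule exI[of _ A], rule exI[of _ B], rule exI[of _ D], rule exI[of _ \<psi>], intro conjI)
    show "A \<inter> B = {0}" using AB0 subspace_0[OF A] subspace_0[OF B] by auto
    show "{a + b |a b. a \<in> A \<and> b \<in> B} = UNIV"
    proof -
      have "x = \<pi> x + PB x" for x by (simp add: \<pi>_def)
      then show ?thesis using \<pi>A PB(2) by blast
    qed
    show "openin (top_of_set A) D" by (simp add: D_def openin_open_Int)
    show "connected D"
      unfolding D_def using A by (intro convex_connected convex_Int subspace_imp_convex convex_ball)
    show "D \<noteq> {}" using r \<pi>A[of z] by (auto simp: D_def)
    have "continuous_on D k"
      using k continuous_on_subset[OF _ DD0] by (auto simp: homeomorphism_def)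
    then have "continuous_on D (\<lambda>u. g (k u))"
      by (rule continuous_on_compose2[OF g(1)]) (use kD in \<open>auto simp: Op_def\<close>)
    then show "continuous_on D \<psi>"
      unfolding \<psi>_def by (rule bounded_linear.continuous_on[OF PBlin])
    show "\<psi> ` D \<subseteq> B" using PB(2) by (auto simp: \<psi>_def)
    have dec: "u + \<psi> u = g (k u)" if "u \<in> D" for u
    proof -
      have "\<pi> (g (k u)) + PB (g (k u)) = g (k u)" by (simp add: \<pi>_def)
      then show ?thesis unfolding kD(2)[OF that] by (simp add: \<psi>_def)
    qed
    show "S \<inter> U' = {u + \<psi> u |u. u \<in> D}"
    proof (intro equalityI subsetI)
      fix x assume x: "x \<in> S \<inter> U'"
      then have "x \<in> g ` Op" using gOp by (auto simp: U'_def)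
      then obtain p where p: "p \<in> Op" "x = g p" by blast
      have "\<pi> x \<in> D" using x \<pi>A by (auto simp: D_def U'_def)
      moreover have "x = \<pi> x + \<psi> (\<pi> x)"
        using dec[OF \<open>\<pi> x \<in> D\<close>] kh[OF p(1)] p(2) by simp
      ultimately show "x \<in> {u + \<psi> u |u. u \<in> D}" by blast
    next
      fix x assume "x \<in> {u + \<psi> u |u. u \<in> D}"
      then obtain u where u: "u \<in> D" "x = g (k u)" using dec by auto
      then have "x \<in> S \<inter> U" using kD(1)[OF u(1)] gOp by blast
      moreover have "\<pi> x \<in> ball (\<pi> z) r" using kD(2)[OF u(1)] u by (simp add: D_def)
      ultimately show "x \<in> S \<inter> U'" by (simp add: U'_def)
    qed
  qed (use A B dimA in auto)
  ultimately show ?thesis by blast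
qed

context saddle_flow
begin

text \<open>Inside the \<delta>-ball the two fields agree, so a solution that stays there solves
  both equations.\<close>

lemma flow_eq_hyp_flow:
  assumes T: "0 \<le> T" and near: "\<And>t. T \<le> t \<Longrightarrow> norm (flow T t x - X0) \<le> \<delta>" and t: "T \<le> t"
  shows "flow T t x = hyp.flow T t x"
proof -
  have "((\<lambda>t. flow T t x) has_vector_derivative network_field E \<tau>\<^sub>\<alpha> \<tau>\<^sub>\<beta> (\<lambda>_. clipped) s (flow T s x)) (at s within {T..})"
    if "T \<le> s" for s
    using has_vector_derivative_at_within[OF flow_deriv[of T x s], of "{T..}"] clipped_eq[OF near[OF that]]
    by (simp add: network_field_def)
  from hyp.flow_unique_ray[OF this t order_refl] show ?thesis by simp
qed

lemma hyp_flow_eq_flow: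
  assumes T: "0 \<le> T" and near: "\<And>t. T \<le> t \<Longrightarrow> norm (hyp.flow T t x - X0) \<le> \<delta>" and t: "T \<le> t"
  shows "hyp.flow T t x = flow T t x"
proof -
  have "((\<lambda>t. hyp.flow T t x) has_vector_derivative network_field E \<tau>\<^sub>\<alpha> \<tau>\<^sub>\<beta> (\<lambda>_. gradients) s (hyp.flow T s x)) (at s within {T..})"
    if "T \<le> s" for s
    using has_vector_derivative_at_within[OF hyp.flow_deriv[of T x s], of "{T..}"] clipped_eq[OF near[OF that]]
    by (simp add: network_field_def)
  from flow_unique_ray[OF this t order_refl] show ?thesis by simp
qed

lemma bounded_from_near:
  assumes "0 \<le> T" "\<And>t. T \<le> t \<Longrightarrow> norm (flow T t x - X0) \<le> \<delta>"
  shows "hyp.bounded_from T x"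
  unfolding hyp.bounded_from_def using assms(2) flow_eq_hyp_flow[OF assms] by auto

lemma near_tendsto:
  assumes T: "T0 \<le> T" and near: "\<And>t. T \<le> t \<Longrightarrow> norm (hyp.flow T t x - X0) \<le> \<delta>"
  shows "((\<lambda>t. flow T t x) \<longlongrightarrow> X0) at_top"
proof -
  have T': "0 \<le> T" using T T0_nonneg by simp
  have "hyp.bounded_from T x"
    unfolding hyp.bounded_from_def using near by blast
  then have "((\<lambda>t. hyp.flow T t x) \<longlongrightarrow> X0) at_top"
    by (rule hyp.bounded_from_tendsto[OF T])
  then show ?thesis
  proof (rule Lim_transform_eventually)
    show "\<forall>\<^sub>F t in at_top. hyp.flow T t x = flow T t x"
      using eventually_ge_at_top[of T] by eventually_elim (rule hyp_flow_eq_flow[OF T' near])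
  qed
qed

text \<open>The shooting solution over \<open>p = 0\<close>: with
  \<open>e = \<delta>\<^sup>2 / 20\<close> the bound \<open>5 * e\<close> is
  \<open>\<delta>\<^sup>2 / 4\<close>, inside the region where the fields agree. This makes the
  stable set nonempty.\<close>

lemma stable_point_near:
  assumes T: "T0 \<le> T"
  obtains x where "((\<lambda>t. flow T t x) \<longlongrightarrow> X0) at_top"
proof -
  have "P 0 = 0" by (rule linear_0[OF P_lin])
  from hyp.stable_point_exists[OF T this]
  obtain v where v: "\<And>t. T \<le> t \<Longrightarrow> (norm (hyp.flow T t (X0 + 0 + v) - X0))\<^sup>2 \<le> 5 * (\<delta>\<^sup>2 / 20) + 4 * (norm (0::real ^ 'd ^ 'n))\<^sup>2"
    by blast
  have "norm (hyp.flow T t (X0 + 0 + v) - X0) \<le> \<delta>" if "T \<le> t" for t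
  proof (rule power2_le_imp_le)
    show "(norm (hyp.flow T t (X0 + 0 + v) - X0))\<^sup>2 \<le> \<delta>\<^sup>2"
    proof -
      have "(norm (hyp.flow T t (X0 + 0 + v) - X0))\<^sup>2 \<le> \<delta>\<^sup>2 / 4" using v[OF that] by simp
      then show ?thesis using zero_le_power2[of \<delta>] by linarith
    qed
  qed (use \<delta>_pos in simp)
  from near_tendsto[OF T this] show ?thesis by (rule that)
qed

text \<open>Cauchy-Schwarz in the estimate \<open>center\<close>. On this annulus the defect takes
  at most a tenth of \<open>\<nu> * (norm w)\<^sup>2\<close>, which leaves 9/40 of
  \<open>\<nu> * norm w\<close>, at least 9/80 of \<open>\<nu> * \<delta>\<close>.\<close>

lemma D_lower_bound:
  assumes t: "T0 \<le> t" and x: "\<delta> / 2 \<le> norm (x - X0)" "norm (x - X0) \<le> \<delta>"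
  shows "\<nu> * \<delta> / 10 \<le> norm (D t x)"
proof -
  have t0: "0 \<le> t" using t T0_nonneg by simp
  define w where "w = x - X0"
  define eps where "eps = 4 * (norm (gradients X0))\<^sup>2 / (lam * \<gamma> t)"
  have wt: "0 < weight \<tau>\<^sub>\<alpha> t" using t0 by (intro weight_pos) auto
  have F: "network_field E \<tau>\<^sub>\<alpha> \<tau>\<^sub>\<beta> (\<lambda>_. clipped) t x = - (weight \<tau>\<^sub>\<alpha> t *\<^sub>R D t x)"
    unfolding field_eq_D[OF t0, symmetric] using clipped_eq[OF x(2)] by (simp add: network_field_def)
  let ?R = "P w - 1 *\<^sub>R (w - P w)"
  have "weight \<tau>\<^sub>\<alpha> t * (\<nu> * (norm w)\<^sup>2 - eps) \<le> 2 * (?R \<bullet> - (weight \<tau>\<^sub>\<alpha> t *\<^sub>R D t x))"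
    using hyp.center[of 1 t x] t unfolding F w_def[symmetric] eps_def by simp
  also have "\<dots> = weight \<tau>\<^sub>\<alpha> t * (2 * - (?R \<bullet> D t x))" by simp
  finally have "\<nu> * (norm w)\<^sup>2 - eps \<le> 2 * - (?R \<bullet> D t x)"
    using wt by (simp only: mult_le_cancel_left_pos)
  also have "- (?R \<bullet> D t x) \<le> norm ?R * norm (D t x)"
    using Cauchy_Schwarz_ineq2[of ?R "D t x"] by linarith
  also have "\<dots> \<le> 2 * norm w * norm (D t x)"
    using reflect_norm_le[of 1 w] by (intro mult_right_mono) auto
  finally have 1: "\<nu> * (norm w)\<^sup>2 - eps \<le> 4 * norm w * norm (D t x)" by simp
  have "eps \<le> \<nu> / 2 * (\<delta>\<^sup>2 / 20)"
    unfolding eps_def by (rule T0(2)[OF t])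
  also have "\<dots> = \<nu> / 10 * (\<delta> / 2)\<^sup>2" by (simp add: power2_eq_square)
  also have "\<dots> \<le> \<nu> / 10 * (norm w)\<^sup>2"
    using x(1) \<delta>_pos \<nu>_pos unfolding w_def by (intro mult_left_mono power_mono) auto
  finally have "\<nu> * (norm w)\<^sup>2 * (9 / 10) \<le> 4 * norm w * norm (D t x)"
    using 1 by simp
  then have "norm w * (\<nu> * norm w * (9 / 40)) \<le> norm w * norm (D t x)"
    by (simp add: power2_eq_square mult_ac)
  moreover have "0 < norm w" using x(1) \<delta>_pos unfolding w_def by linarith
  ultimately have "\<nu> * norm w * (9 / 40) \<le> norm (D t x)"
    by (simp only: mult_le_cancel_left_pos)
  moreover have "\<nu> * (\<delta> / 2) * (9 / 40) \<le> \<nu> * norm w * (9 / 40)"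
    using x(1) \<nu>_pos unfolding w_def by (intro mult_right_mono mult_left_mono) auto
  moreover have "0 < \<nu> * \<delta>" using \<nu>_pos \<delta>_pos by simp
  ultimately show ?thesis by linarith
qed

text \<open>Leaving the \<open>\<delta>\<close>-ball costs a fixed amount of energy, which a solution converging to the
  saddle point does not have.\<close>

lemma no_escape:
  assumes T: "T0 \<le> T" and lim: "((\<lambda>t. flow T t x) \<longlongrightarrow> X0) at_top"
    and x: "norm (x - X0) \<le> \<delta> / 2" and en: "lyapunov T x < excess X0 + \<nu> * \<delta>\<^sup>2 / 40"
    and t: "T \<le> t"
  shows "norm (flow T t x - X0) \<le> \<delta>"
proof (rule ccontr)
  assume neg: "\<not> norm (flow T t x - X0) \<le> \<delta>"
  let ?n = "\<lambda>s. norm (flow T s x - X0)"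
  have "continuous_on {T..t} ?n"
    by (intro continuous_intros continuous_on_flow_time)
  moreover have "?n T \<le> \<delta> / 2" "\<delta> / 2 \<le> \<delta>" "\<delta> \<le> ?n t"
    using x \<delta>_pos neg by auto
  ultimately obtain u v where uv: "T \<le> u" "u \<le> v" "?n u = \<delta> / 2" "?n v = \<delta>"
    and between: "\<And>w. u \<le> w \<Longrightarrow> w \<le> v \<Longrightarrow> \<delta> / 2 \<le> ?n w \<and> ?n w \<le> \<delta>"
    using t by (rule crossing_interval) blast
  have T1u: "T1 \<le> u" "T1 \<le> v" "T1 \<le> T" using uv T T0_ge by auto
  \<comment> \<open>Crossing the annulus covers a distance of at least \<delta>/2 at a loss of
    \<open>\<nu> * \<delta> / 20\<close> per unit length; the product is the energy margin in
    \<open>en\<close>.\<close>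
  have "lyapunov v (flow T v x) + \<nu> * \<delta> / 10 / 2 * norm (flow T v x - flow T u x) \<le> lyapunov u (flow T u x)"
  proof (rule lyapunov_drop[OF T1u(1) uv(2)])
    show "\<nu> * \<delta> / 10 \<le> norm (D w (flow T w x))" if "u \<le> w" "w \<le> v" for w
      using between[OF that] that uv T by (intro D_lower_bound) auto
  qed (use \<nu>_pos \<delta>_pos in auto)
  moreover have "\<delta> / 2 \<le> norm (flow T v x - flow T u x)"
    using norm_triangle_ineq2[of "flow T v x - X0" "flow T u x - X0"] uv by simp
  then have "\<nu> * \<delta> / 10 / 2 * (\<delta> / 2) \<le> \<nu> * \<delta> / 10 / 2 * norm (flow T v x - flow T u x)"
    using \<nu>_pos \<delta>_pos by (intro mult_left_mono) auto
  moreover have "\<nu> * \<delta> / 10 / 2 * (\<delta> / 2) = \<nu> * \<delta>\<^sup>2 / 40"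
    by (simp add: power2_eq_square)
  moreover have "excess X0 \<le> lyapunov v (flow T v x)"
    by (rule excess_limit_le_lyapunov[OF lim T1u(2)])
  moreover have "lyapunov u (flow T u x) \<le> lyapunov T x"
    using lyapunov_antimono[OF T1u(3) uv(1), of T x] by simp
  ultimately show False using en by linarith
qed

lemma continuous_on_lyapunov: "continuous_on S (lyapunov t)"
proof -
  have bl: "bounded_linear (laplacian E :: real ^ 'd ^ 'n \<Rightarrow> _)"
    using linear_laplacian by (simp add: linear_conv_bounded_linear)
  have "continuous_on S (\<lambda>x. energy t x * exp (4 * K / lam / \<gamma> t))"
    unfolding energy_def
    by (intro continuous_intros continuous_on_excess bounded_linear.continuous_on[OF bl])
  then show ?thesis by (simp add: lyapunov_def[abs_def])
qed

lemma stable_set_locally: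
  assumes t0: "0 \<le> t0" and lim: "((\<lambda>t. flow t0 t z) \<longlongrightarrow> X0) at_top"
  obtains T \<rho> where "T0 \<le> T" "t0 \<le> T" "0 < \<rho>"
    "\<And>x. norm (x - flow t0 T z) < \<rho> \<Longrightarrow> ((\<lambda>t. flow T t x) \<longlongrightarrow> X0) at_top \<longleftrightarrow> hyp.bounded_from T x"
proof -
  let ?\<eta> = "\<nu> * \<delta>\<^sup>2 / 40"
  have \<eta>: "0 < ?\<eta>" using \<nu>_pos \<delta>_pos by simp
  have "\<forall>\<^sub>F t in at_top. norm (flow t0 t z - X0) < \<delta> / 8"
    using tendstoD[OF lim, of "\<delta> / 8"] \<delta>_pos by (simp add: dist_norm)
  then obtain T' where T': "\<And>t. T' \<le> t \<Longrightarrow> norm (flow t0 t z - X0) < \<delta> / 8"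
    by (auto simp: eventually_at_top_linorder)
  have "\<forall>\<^sub>F t in at_top. lyapunov t (flow t0 t z) < excess X0 + ?\<eta>"
    by (rule lyapunov_limit[OF lim \<eta>])
  then obtain T'' where T'': "\<And>t. T'' \<le> t \<Longrightarrow> lyapunov t (flow t0 t z) < excess X0 + ?\<eta>"
    by (auto simp: eventually_at_top_linorder)
  define T where "T = max (max T0 t0) (max T' T'')"
  have T: "T0 \<le> T" "t0 \<le> T" "T' \<le> T" "T'' \<le> T" by (auto simp: T_def)
  have T_nonneg: "0 \<le> T" using T T0_nonneg by simp
  define zT where "zT = flow t0 T z"
  have zt: "norm (flow T t zT - X0) < \<delta> / 8" if "T \<le> t" for t
    using T'[of t] that T by (simp add: zT_def)
  have zt': "norm (flow T t zT - X0) \<le> \<delta>" if "T \<le> t" for t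
    using zt[OF that] \<delta>_pos by simp
  have "open {x. lyapunov T x < excess X0 + ?\<eta>}"
    by (intro open_Collect_less continuous_on_lyapunov continuous_on_const)
  moreover have "zT \<in> {x. lyapunov T x < excess X0 + ?\<eta>}"
    using T''[OF T(4)] by (simp add: zT_def)
  ultimately obtain r where r: "0 < r" "ball zT r \<subseteq> {x. lyapunov T x < excess X0 + ?\<eta>}"
    by (metis open_contains_ball)
  \<comment> \<open>A distance \<delta>/4 from \<open>zT\<close> gives 3\<delta>/8 from
    \<open>X0\<close>, within the \<delta>/2 of \<open>no_escape\<close>; doubled by
    \<open>bounded_diff_le\<close> it gives 5\<delta>/8.\<close>
  define \<rho> where "\<rho> = min r (\<delta> / 4)"
  have zb: "hyp.bounded_from T zT"
    by (rule bounded_from_near[OF T_nonneg zt'])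
  show ?thesis
  proof (rule that[OF T(1,2)])
    show "0 < \<rho>" using r \<delta>_pos by (simp add: \<rho>_def)
    fix x assume "norm (x - flow t0 T z) < \<rho>"
    then have x: "norm (x - zT) < r" "norm (x - zT) < \<delta> / 4" by (auto simp: \<rho>_def zT_def)
    show "((\<lambda>t. flow T t x) \<longlongrightarrow> X0) at_top \<longleftrightarrow> hyp.bounded_from T x"
    proof
      assume l: "((\<lambda>t. flow T t x) \<longlongrightarrow> X0) at_top"
      have "norm (x - X0) \<le> \<delta> / 2"
        using norm_triangle_ineq[of "x - zT" "zT - X0"] x(2) zt[of T] \<delta>_pos by simp
      moreover have "lyapunov T x < excess X0 + ?\<eta>"
      proof -
        have "x \<in> ball zT r" using x(1) by (simp add: dist_norm norm_minus_commute)
        then show ?thesis using r(2) by blast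
      qed
      ultimately show "hyp.bounded_from T x"
        using no_escape[OF T(1) l] by (intro bounded_from_near T_nonneg)
    next
      assume b: "hyp.bounded_from T x"
      have "norm (hyp.flow T t x - X0) \<le> \<delta>" if t: "T \<le> t" for t
      proof -
        have "hyp.flow T t zT = flow T t zT"
          by (rule flow_eq_hyp_flow[OF T_nonneg zt' t, symmetric])
        then have "norm (hyp.flow T t zT - X0) < \<delta> / 8" using zt[OF t] by simp
        moreover have "norm (hyp.flow T t x - hyp.flow T t zT) \<le> 2 * norm (x - zT)"
          by (rule hyp.bounded_diff_le[OF T(1) b zb t])
        ultimately show ?thesis
          using x(2) norm_triangle_ineq[of "hyp.flow T t x - hyp.flow T t zT" "hyp.flow T t zT - X0"] \<delta>_pos
          by simp
      qed
      then show "((\<lambda>t. flow T t x) \<longlongrightarrow> X0) at_top" by (rule near_tendsto[OF T(1)])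
    qed
  qed
qed

end

section \<open>Linearisation along a solution\<close>

lemma continuous_on_matrix_vector_mult:
  fixes A :: "'a::topological_space \<Rightarrow> real ^ 'm ^ 'n"
  assumes "continuous_on S A" "continuous_on S v"
  shows "continuous_on S (\<lambda>x. A x *v v x)"
  unfolding matrix_vector_mult_def
  by (intro continuous_on_vec_lambda continuous_on_sum continuous_on_mult continuous_on_component assms)

context saddle_flow
begin

text \<open>Linearisation of \<open>gradients\<close> along the curve \<open>x\<close>, shaped to
  fit the slot \<open>G\<close> of \<open>network_field\<close>.\<close>

definition variational :: "(real \<Rightarrow> real ^ 'd ^ 'n) \<Rightarrow> real \<Rightarrow> real ^ 'd ^ 'n \<Rightarrow> real ^ 'd ^ 'n" where
  "variational x t v = (\<chi> n. hessian (f n) (x t $ n) *v v $ n)"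

lemma norm_variational: "norm (variational x t v) \<le> K * norm v"
  using K_gt_0 by (intro norm_le_componentwise)
    (auto simp: variational_def intro!: hessian_lipschitz_bound C2 grad_lip)

lemma variational_add: "variational x t (v + w) = variational x t v + variational x t w"
  by (simp add: variational_def vec_eq_iff[of "_ :: real ^ 'd ^ 'n"] matrix_vector_right_distrib)

lemma variational_scale: "variational x t (c *\<^sub>R v) = c *\<^sub>R variational x t v"
  by (simp add: variational_def vec_eq_iff[of "_ :: real ^ 'd ^ 'n"] matrix_vector_mult_scaleR)

lemma variational_diff: "variational x t (v - w) = variational x t v - variational x t w"
  using variational_add[of x t v "- 1 *\<^sub>R w"] variational_scale[of x t "- 1" w] by simp

lemma variational_ode:
  assumes "continuous_on UNIV x"
  shows "lipschitz_ode (network_field E \<tau>\<^sub>\<alpha> \<tau>\<^sub>\<beta> (variational x)) (laplacian_bound E TYPE('d) + K) 0"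
proof (rule network_field_lipschitz_ode)
  have H: "continuous_on UNIV (hessian (f n))" for n
    using C2[of n] by (simp add: C2_def)
  have "continuous_on UNIV (\<lambda>p :: real \<times> (real ^ 'd ^ 'n). x (fst p) $ n)" for n
    by (intro continuous_on_component continuous_on_compose2[OF assms] continuous_on_fst continuous_on_id) auto
  then have "continuous_on UNIV (\<lambda>p :: real \<times> (real ^ 'd ^ 'n). hessian (f n) (x (fst p) $ n))" for n
    by (rule continuous_on_compose2[OF H]) auto
  then show "continuous_on UNIV (\<lambda>(t, v). variational x t v)"
    unfolding variational_def split_def
    by (intro continuous_on_vec_lambda continuous_on_matrix_vector_mult continuous_on_component
        continuous_on_snd continuous_on_id)
  show "norm (variational x t v - variational x t w) \<le> K * norm (v - w)" for t v w
    using norm_variational[of x t "v - w"] by (simp add: variational_diff)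
  show "norm (variational x t 0) \<le> 0" for t
    using norm_variational[of x t 0] by simp
qed (use \<tau>\<^sub>\<beta> \<tau>_less K_gt_0 in auto)

lemma network_field_variational_linear: "linear (network_field E \<tau>\<^sub>\<alpha> \<tau>\<^sub>\<beta> (variational x) t)"
  by (rule linearI)
    (simp_all add: network_field_def variational_add variational_scale linear_add[OF linear_laplacian]
      linear_scale[OF linear_laplacian] algebra_simps)

lemma variational_flow_linear:
  assumes "continuous_on UNIV x"
  shows "linear (lipschitz_ode.flow (network_field E \<tau>\<^sub>\<alpha> \<tau>\<^sub>\<beta> (variational x)) s t)"
proof -
  interpret lin: lipschitz_ode "network_field E \<tau>\<^sub>\<alpha> \<tau>\<^sub>\<beta> (variational x)" "laplacian_bound E TYPE('d) + K" 0
    by (rule variational_ode[OF assms])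
  show ?thesis
  proof (rule linearI)
    fix v w and c :: real
    have "lin.solution (\<lambda>t. lin.flow s t v + lin.flow s t w)"
      unfolding lin.solution_def linear_add[OF network_field_variational_linear]
      by (intro allI has_vector_derivative_add lin.flow_deriv)
    from lin.flow_unique[OF this, of t s] show "lin.flow s t (v + w) = lin.flow s t v + lin.flow s t w"
      by simp
    have "lin.solution (\<lambda>t. c *\<^sub>R lin.flow s t v)"
      unfolding lin.solution_def linear_scale[OF network_field_variational_linear]
      by (intro allI bounded_linear.has_vector_derivative[OF bounded_linear_scaleR_right] lin.flow_deriv)
    from lin.flow_unique[OF this, of t s] show "lin.flow s t (c *\<^sub>R v) = c *\<^sub>R lin.flow s t v"
      by simp
  qed
qed

text \<open>Strict differentiability of the evolution map at \<open>z\<close>: both points vary,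
  because transversality compares two points of the stable set, neither of which need be
  \<open>z\<close>.\<close>

lemma flow_variational_approx:
  assumes st: "s \<le> t" and e: "0 < e"
  obtains \<rho> where "0 < \<rho>" "\<And>x y. norm (x - z) < \<rho> \<Longrightarrow> norm (y - z) < \<rho> \<Longrightarrow>
    norm ((flow s t x - flow s t y)
      - lipschitz_ode.flow (network_field E \<tau>\<^sub>\<alpha> \<tau>\<^sub>\<beta> (variational (\<lambda>t. flow s t z))) s t (x - y))
    \<le> e * norm (x - y)"
proof -
  let ?z = "\<lambda>t. flow s t z"
  interpret lin: lipschitz_ode "network_field E \<tau>\<^sub>\<alpha> \<tau>\<^sub>\<beta> (variational ?z)" "laplacian_bound E TYPE('d) + K" 0
    by (rule variational_ode[OF continuous_on_flow_time])
  define k where "k = laplacian_bound E TYPE('d) + K"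
  have k: "0 < k" unfolding k_def by (rule K_pos)
  define M where "M = exp (k * (t - s))"
  define M' where "M' = exp ((2 * k + 1) * (t - s))"
  have M: "0 < M" "0 < M'" by (simp_all add: M_def M'_def)
  have dist_le: "norm (flow s u x - flow s u y) \<le> M * norm (x - y)" if "s \<le> u" "u \<le> t" for u x y
  proof -
    have "norm (flow s u x - flow s u y) \<le> exp (k * \<bar>u - s\<bar>) * norm (x - y)"
      unfolding k_def by (rule flow_dist)
    also have "\<dots> \<le> M * norm (x - y)"
      unfolding M_def using that k by (intro mult_right_mono) auto
    finally show ?thesis .
  qed
  \<comment> \<open>\<open>M\<close> bounds the growth of differences of solutions and
    \<open>M'\<close> that of the accumulated error; dividing by both makes the final factor
    \<open>e\<close>.\<close>
  define e' where "e' = e / (M * M')"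
  have e': "0 < e'" using e M by (simp add: e'_def)
  have "bounded (?z ` {s..t})"
    by (rule compact_imp_bounded[OF compact_continuous_image[OF continuous_on_flow_time compact_Icc]])
  then obtain R where "\<forall>x\<in>?z ` {s..t}. norm x \<le> R"
    unfolding bounded_iff by blast
  then have R: "norm (?z u) \<le> R" if "s \<le> u" "u \<le> t" for u
    using that by simp
  define ok where "ok n d \<longleftrightarrow> 0 < d \<and> (\<forall>c x y. norm c \<le> R \<longrightarrow> norm (x - c) \<le> d \<longrightarrow> norm (y - c) \<le> d \<longrightarrow>
       norm (grad (f n) x - grad (f n) y - hessian (f n) c *v (x - y)) \<le> e' * norm (x - y))" for n d
  have "\<forall>n. \<exists>d. ok n d"
  proof
    fix n
    show "\<exists>d. ok n d"
      unfolding ok_def by (rule C2_grad_approx[OF C2[of n] e', of R]) blast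
  qed
  then obtain d where ok: "\<And>n. ok n (d n)"
    unfolding choice_iff by blast
  then have d: "\<And>n. 0 < d n" and approx_d: "\<And>n c x y. norm c \<le> R \<Longrightarrow> norm (x - c) \<le> d n \<Longrightarrow>
      norm (y - c) \<le> d n \<Longrightarrow> norm (grad (f n) x - grad (f n) y - hessian (f n) c *v (x - y)) \<le> e' * norm (x - y)"
    by (auto simp: ok_def)
  define \<rho> where "\<rho> = Min (range d) / M"
  have \<rho>: "0 < \<rho>" using d M by (simp add: \<rho>_def)
  show ?thesis
  proof (rule that[OF \<rho>])
    fix x y assume x: "norm (x - z) < \<rho>" and y: "norm (y - z) < \<rho>"
    have close: "norm (flow s u w $ n - ?z u $ n) \<le> d n" if "norm (w - z) < \<rho>" "s \<le> u" "u \<le> t" for w u n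
    proof -
      have "norm (flow s u w $ n - ?z u $ n) \<le> norm (flow s u w - ?z u)"
        using Finite_Cartesian_Product.norm_nth_le[of "flow s u w - ?z u" n] by simp
      also have "\<dots> \<le> M * norm (w - z)" by (rule dist_le[OF that(2,3)])
      also have "\<dots> \<le> M * \<rho>" using that(1) M by simp
      also have "\<dots> = Min (range d)" using M by (simp add: \<rho>_def)
      also have "\<dots> \<le> d n" by simp
      finally show ?thesis .
    qed
    define c where "c = e' * (M * norm (x - y))"
    let ?v = "\<lambda>u. lin.flow s u (x - y)"
    let ?e = "\<lambda>u. (flow s u x - flow s u y) - ?v u"
    let ?e' = "\<lambda>u. (network_field E \<tau>\<^sub>\<alpha> \<tau>\<^sub>\<beta> (\<lambda>_. gradients) u (flow s u x)
      - network_field E \<tau>\<^sub>\<alpha> \<tau>\<^sub>\<beta> (\<lambda>_. gradients) u (flow s u y)) - network_field E \<tau>\<^sub>\<alpha> \<tau>\<^sub>\<beta> (variational ?z) u (?v u)"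
    have "norm (?e t) \<le> c * exp ((2 * k + 1) * (t - s))"
    proof (rule inhomogeneous_growth[OF st])
      show "continuous_on {s..t} ?e"
        by (intro continuous_on_diff continuous_on_flow_time lin.continuous_on_flow_time)
      show "?e s = 0" by simp
      show "0 \<le> c" "0 \<le> k" using e' M k by (auto simp: c_def)
      show "(?e has_vector_derivative ?e' u) (at u)" for u
        by (intro has_vector_derivative_diff flow_deriv lin.flow_deriv)
      fix u assume u: "s < u" "u < t"
      define r where "r = gradients (flow s u x) - gradients (flow s u y) - variational ?z u (flow s u x - flow s u y)"
      have r: "norm r \<le> c"
      proof -
        have "norm r \<le> e' * norm (flow s u x - flow s u y)"
        proof (rule norm_le_componentwise)
          fix n
          have "norm (?z u $ n) \<le> R"
            using R[of u] u Finite_Cartesian_Product.norm_nth_le[of "?z u" n] by simp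
          then show "norm (r $ n) \<le> e' * norm ((flow s u x - flow s u y) $ n)"
            using approx_d[OF _ close[OF x, of u n] close[OF y, of u n]] u
            by (simp add: r_def gradients_def variational_def)
        qed (use e' in simp)
        also have "\<dots> \<le> c"
          unfolding c_def using e' u by (intro mult_left_mono dist_le) auto
        finally show ?thesis .
      qed
      \<comment> \<open>The error solves the linearised equation with forcing \<open>r\<close>, so
        the inhomogeneous growth bound applies.\<close>
      have "?e' u = network_field E \<tau>\<^sub>\<alpha> \<tau>\<^sub>\<beta> (variational ?z) u (?e u) - weight \<tau>\<^sub>\<alpha> (max 0 u) *\<^sub>R r"
        unfolding network_field_diff
        by (simp add: network_field_def r_def linear_diff[OF linear_laplacian] linear_add[OF linear_laplacian]
            variational_diff variational_add algebra_simps)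
      then have "norm (?e' u) \<le> norm (network_field E \<tau>\<^sub>\<alpha> \<tau>\<^sub>\<beta> (variational ?z) u (?e u)) + norm (weight \<tau>\<^sub>\<alpha> (max 0 u) *\<^sub>R r)"
        by (simp only: norm_triangle_ineq4)
      moreover have "norm (network_field E \<tau>\<^sub>\<alpha> \<tau>\<^sub>\<beta> (variational ?z) u (?e u)) \<le> k * norm (?e u)"
        using lin.F_lip[of u "?e u" 0] unfolding k_def linear_0[OF network_field_variational_linear] diff_zero .
      moreover have "norm (weight \<tau>\<^sub>\<alpha> (max 0 u) *\<^sub>R r) \<le> 1 * norm r"
        unfolding norm_scaleR
        using less_imp_le[OF weight_pos[of "max 0 u" \<tau>\<^sub>\<alpha>, OF less_max_iff_disj[THEN iffD2]]] weight_le_1[of "max 0 u" \<tau>\<^sub>\<alpha>] \<tau>\<^sub>\<beta> \<tau>_less by (intro mult_right_mono) auto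
      ultimately show "norm (?e' u) \<le> k * norm (?e u) + c" using r by linarith
    qed
    also have "c * exp ((2 * k + 1) * (t - s)) = e * norm (x - y)"
      using M by (simp add: c_def e'_def M'_def[symmetric])
    finally show "norm (?e t) \<le> e * norm (x - y)" .
  qed
qed

section \<open>Transversality and the local graph\<close>

definition stable_set :: "real \<Rightarrow> (real ^ 'd ^ 'n) set" where
  "stable_set t0 = {z. ((\<lambda>t. flow t0 t z) \<longlongrightarrow> X0) at_top}"

lemma dim_W: "dim (const ` V :: (real ^ 'd ^ 'n) set) = dim V"
proof (rule dim_image_eq[OF linear_const])
  show "inj_on (const :: _ \<Rightarrow> real ^ 'd ^ 'n) (span V)"
    by (rule inj_onI) (auto simp: vec_eq_iff[of "const _"])
qed

lemma P_eq_0_iff: "P p = 0 \<longleftrightarrow> (\<forall>x\<in>const ` V. orthogonal x p)"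
proof
  assume "P p = 0"
  then show "\<forall>x\<in>const ` V. orthogonal x p"
    using P_orthogonal[of _ p] by (auto simp: orthogonal_def inner_commute)
next
  assume o: "\<forall>x\<in>const ` V. orthogonal x p"
  have "(p - P p) \<bullet> P p = 0" by (rule P_orthogonal[OF P_range])
  moreover have "P p \<bullet> p = 0" using o P_range[of p] by (auto simp: orthogonal_def)
  ultimately have "P p \<bullet> P p = 0" by (simp add: inner_diff_left inner_commute[of p])
  then show "P p = 0" by simp
qed

text \<open>The unstable directions at time \<open>T\<close>, transported back along the linearised flow, are
  transversal to the stable set near \<open>z\<close>.\<close>

lemma stable_transversal:
  fixes z :: "real ^ 'd ^ 'n" and t0 :: real
  defines "L \<equiv> lipschitz_ode.flow (network_field E \<tau>\<^sub>\<alpha> \<tau>\<^sub>\<beta> (variational (\<lambda>t. flow t0 t z)))"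
  assumes T: "T0 \<le> T" "t0 \<le> T"
  obtains \<rho> where "0 < \<rho>" "\<And>x y. norm (x - z) < \<rho> \<Longrightarrow> norm (y - z) < \<rho> \<Longrightarrow>
    hyp.bounded_from T (flow t0 T x) \<Longrightarrow> hyp.bounded_from T (flow t0 T y) \<Longrightarrow>
    x - y \<in> L T t0 ` const ` V \<Longrightarrow> x = y"
proof -
  let ?z = "\<lambda>t. flow t0 t z"
  interpret lin: lipschitz_ode "network_field E \<tau>\<^sub>\<alpha> \<tau>\<^sub>\<beta> (variational ?z)" "laplacian_bound E TYPE('d) + K" 0
    by (rule variational_ode[OF continuous_on_flow_time])
  have lin0: "lin.flow s t 0 = 0" for s t
    by (rule linear_0[OF variational_flow_linear[OF continuous_on_flow_time]])
  \<comment> \<open>\<open>M\<close> bounds the backward linear flow, so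
    \<open>norm (x - y) \<le> M * norm \<omega>\<close>; the tolerance \<open>1 / (4 * M)\<close>
    then makes the error at time \<open>T\<close> at most a quarter of
    \<open>norm \<omega>\<close>.\<close>
  define M where "M = exp ((laplacian_bound E TYPE('d) + K) * \<bar>t0 - T\<bar>)"
  have M: "0 < M" by (simp add: M_def)
  obtain \<rho> where \<rho>: "0 < \<rho>" and approx: "\<And>x y. norm (x - z) < \<rho> \<Longrightarrow> norm (y - z) < \<rho> \<Longrightarrow>
    norm ((flow t0 T x - flow t0 T y) - lin.flow t0 T (x - y)) \<le> 1 / (4 * M) * norm (x - y)"
    by (rule flow_variational_approx[OF T(2), of "1 / (4 * M)"]) (use M in auto)
  show ?thesis
  proof (rule that[OF \<rho>])
    fix x y assume x: "norm (x - z) < \<rho>" and y: "norm (y - z) < \<rho>"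
      and b: "hyp.bounded_from T (flow t0 T x)" "hyp.bounded_from T (flow t0 T y)"
      and "x - y \<in> L T t0 ` const ` V"
    then obtain \<omega> where \<omega>: "\<omega> \<in> const ` V" "x - y = lin.flow T t0 \<omega>"
      by (auto simp: L_def)
    define \<Delta> where "\<Delta> = flow t0 T x - flow t0 T y"
    define r where "r = \<Delta> - \<omega>"
    have "norm (lin.flow T t0 \<omega> - lin.flow T t0 0) \<le> M * norm (\<omega> - 0)"
      unfolding M_def by (rule lin.flow_dist)
    then have xy: "norm (x - y) \<le> M * norm \<omega>" by (simp add: \<omega> lin0)
    have "norm r \<le> 1 / (4 * M) * norm (x - y)"
      using approx[OF x y] by (simp add: r_def \<Delta>_def \<omega>(2))
    also have "\<dots> \<le> 1 / (4 * M) * (M * norm \<omega>)"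
      using xy M by (intro mult_left_mono) auto
    finally have r: "norm r \<le> norm \<omega> / 4" using M by simp
    \<comment> \<open>The cone condition meets a difference that equals \<omega> up to the small
      error \<open>r\<close>: its \<open>W\<close>-component would dominate unless \<omega>
      vanishes.\<close>
    have "hyp.Q 1 (hyp.flow T T (flow t0 T x) - hyp.flow T T (flow t0 T y)) \<le> 0"
      by (rule hyp.Q_diff_nonpos[OF _ T(1) b order_refl]) simp
    then have "(norm (P \<Delta>))\<^sup>2 \<le> (norm (\<Delta> - P \<Delta>))\<^sup>2"
      by (simp add: hyp.Q_def \<Delta>_def)
    then have le: "norm (P \<Delta>) \<le> norm (\<Delta> - P \<Delta>)"
      by (rule power2_le_imp_le) simp
    have P\<Delta>: "P \<Delta> = \<omega> + P r"
      using hyp.P_idem[OF \<omega>(1)] hyp.P_diff[of \<Delta> \<omega>] by (simp add: r_def)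
    have "norm (P r) \<le> norm r" "norm (r - P r) \<le> norm r"
      by (rule power2_le_imp_le, simp_all add: norm_split'[of r])+
    moreover have "norm (\<Delta> - P \<Delta>) = norm (r - P r)" unfolding P\<Delta> by (simp add: r_def diff_diff_add)
    moreover have "norm \<omega> \<le> norm (P \<Delta>) + norm (P r)"
      using norm_triangle_ineq4[of "P \<Delta>" "P r"] by (simp add: P\<Delta>)
    ultimately have "norm \<omega> \<le> norm \<omega> / 4 + norm \<omega> / 4" using le r by linarith
    then have "norm \<omega> \<le> 0" by linarith
    then have "\<omega> = 0" by simp
    then show "x = y" using \<omega>(2) lin0 by simp
  qed
qed

lemma stable_set_graph_manifold:
  assumes t0: "0 \<le> t0" and z: "z \<in> stable_set t0"
  shows "\<exists>U. open U \<and> z \<in> U \<and> continuous_graph (CARD('n) * CARD('d) - dim V) (stable_set t0 \<inter> U)"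
proof -
  let ?W = "const ` V :: (real ^ 'd ^ 'n) set"
  obtain T \<rho> where T: "T0 \<le> T" "t0 \<le> T" and \<rho>: "0 < \<rho>"
    and loc: "\<And>x. norm (x - flow t0 T z) < \<rho> \<Longrightarrow> ((\<lambda>t. flow T t x) \<longlongrightarrow> X0) at_top \<longleftrightarrow> hyp.bounded_from T x"
    using stable_set_locally[OF t0, of z] z unfolding stable_set_def by blast
  let ?L = "lipschitz_ode.flow (network_field E \<tau>\<^sub>\<alpha> \<tau>\<^sub>\<beta> (variational (\<lambda>t. flow t0 t z)))"
  interpret lin: lipschitz_ode "network_field E \<tau>\<^sub>\<alpha> \<tau>\<^sub>\<beta> (variational (\<lambda>t. flow t0 t z))" "laplacian_bound E TYPE('d) + K" 0
    by (rule variational_ode[OF continuous_on_flow_time])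
  obtain \<rho>' where \<rho>': "0 < \<rho>'" and tr: "\<And>x y. norm (x - z) < \<rho>' \<Longrightarrow> norm (y - z) < \<rho>' \<Longrightarrow>
    hyp.bounded_from T (flow t0 T x) \<Longrightarrow> hyp.bounded_from T (flow t0 T y) \<Longrightarrow>
    x - y \<in> ?L T t0 ` ?W \<Longrightarrow> x = y"
    using stable_transversal[OF T] by blast
  obtain \<phi> where \<phi>: "\<And>p. P p = 0 \<Longrightarrow> \<phi> p \<in> ?W" "\<And>p. P p = 0 \<Longrightarrow> hyp.bounded_from T (X0 + p + \<phi> p)"
    "\<And>x. hyp.bounded_from T x \<Longrightarrow> x = X0 + ((x - X0) - P (x - X0)) + \<phi> ((x - X0) - P (x - X0))"
    "continuous_on {p. P p = 0} \<phi>"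
    using hyp.stable_graph[OF T(1)] by blast
  define B where "B = ?L T t0 ` ?W"
  define Wp where "Wp = {p. P p = 0}"
  define g where "g p = flow T t0 (X0 + p + \<phi> p)" for p
  define U where "U = {x. norm (flow t0 T x - flow t0 T z) < \<rho>} \<inter> ball z \<rho>'"
  have linL: "linear (?L T t0)"
    by (rule variational_flow_linear[OF continuous_on_flow_time])
  have B: "subspace B"
    unfolding B_def by (rule linear_subspace_image[OF linL hyp.W])
  have dimB: "dim B = dim V"
    unfolding B_def dim_W[symmetric] by (rule dim_image_eq[OF linL inj_on_subset[OF lin.inj_flow]]) simp
  have Wp_eq: "Wp = {p \<in> UNIV. \<forall>x\<in>?W. orthogonal x p}"
    by (simp add: Wp_def P_eq_0_iff)
  have Wp: "subspace Wp"
    unfolding Wp_eq subspace_def by (auto simp: orthogonal_def inner_add_right)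
  have "dim Wp + dim ?W = dim (UNIV :: (real ^ 'd ^ 'n) set)"
    unfolding Wp_eq by (rule dim_subspace_orthogonal_to_vectors[OF hyp.W subspace_UNIV subset_UNIV])
  then have dim: "dim B + dim Wp = DIM(real ^ 'd ^ 'n)"
    by (simp add: dimB dim_W)
  have "dim Wp = CARD('n) * CARD('d) - dim V"
    using dim dimB by simp
  moreover have "\<exists>U. open U \<and> z \<in> U \<and> continuous_graph (dim Wp) (stable_set t0 \<inter> U)"
  proof (rule local_continuous_graph[OF B Wp dim])
    show "continuous_on Wp g"
      unfolding g_def using \<phi>(4)
      by (intro continuous_on_compose2[OF continuous_on_flow[of UNIV]] continuous_intros) (auto simp: Wp_def)
    show "inj_on g Wp"
    proof (rule inj_onI)
      fix p q assume pq: "p \<in> Wp" "q \<in> Wp" "g p = g q"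
      then have eq: "X0 + p + \<phi> p = X0 + q + \<phi> q"
        using injD[OF inj_flow, of T t0] by (auto simp: g_def)
      then have "P (p + \<phi> p) = P (q + \<phi> q)" by (simp add: add.assoc)
      then have "\<phi> p = \<phi> q"
        using pq \<phi>(1) by (simp add: Wp_def linear_add[OF P_lin] hyp.P_idem)
      then show "p = q" using eq by simp
    qed
    show "open U"
      unfolding U_def
      by (intro open_Int open_ball open_Collect_less continuous_intros continuous_on_flow)
    show "z \<in> stable_set t0" by (rule z)
    show "z \<in> U" using \<rho> \<rho>' by (simp add: U_def)
    have key: "x \<in> stable_set t0 \<longleftrightarrow> hyp.bounded_from T (flow t0 T x)" if "x \<in> U" for x
      using loc[of "flow t0 T x"] that by (simp add: U_def stable_set_def)
    have im: "x \<in> g ` Wp \<longleftrightarrow> hyp.bounded_from T (flow t0 T x)" for x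
    proof
      assume "x \<in> g ` Wp"
      then show "hyp.bounded_from T (flow t0 T x)" using \<phi>(2) by (auto simp: g_def Wp_def)
    next
      assume b: "hyp.bounded_from T (flow t0 T x)"
      define p where "p = (flow t0 T x - X0) - P (flow t0 T x - X0)"
      have "P p = 0" by (simp add: p_def hyp.P_diff[of _ "P _"] hyp.P_idem[OF P_range])
      moreover have "x = g p"
        unfolding g_def p_def \<phi>(3)[OF b, symmetric] by simp
      ultimately show "x \<in> g ` Wp" by (simp add: Wp_def)
    qed
    show "stable_set t0 \<inter> U = g ` Wp \<inter> U" using key im by blast
    show "x = y" if "x \<in> stable_set t0 \<inter> U" "y \<in> stable_set t0 \<inter> U" "x - y \<in> B" for x y
      using tr[of x y] key that by (auto simp: U_def B_def dist_norm norm_minus_commute)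
  qed
  ultimately show ?thesis by simp
qed

end

section \<open>Choice of the constants and conclusion\<close>

theorem theorem2:
  fixes E :: "('n::finite \<times> 'n) set"
    and f :: "'n \<Rightarrow> real ^ 'd::finite \<Rightarrow> real"
    and \<tau>\<^sub>\<alpha> \<tau>\<^sub>\<beta> :: real
    and xs :: "real ^ 'd"
  defines "F \<equiv> (\<lambda>y. \<Sum>n\<in>UNIV. f n y)"
  defines "p \<equiv> num_neg_eigenvalues (hessian F xs)"
  assumes "connected_simple_graph E"
    and "\<And>n. C2 (f n)"
    and "\<And>n. coercive (f n)"
    and "\<And>n. \<exists>L. L-lipschitz_on UNIV (grad (f n))"
    and "0 \<le> \<tau>\<^sub>\<beta>" and "\<tau>\<^sub>\<beta> < \<tau>\<^sub>\<alpha>" and "\<tau>\<^sub>\<alpha> \<le> 1"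
    and "nondegenerate_saddle F xs"
  shows "\<forall>\<^sub>F t\<^sub>0 in at_top.
           \<exists>S :: (real ^ 'd ^ 'n) set.
             graph_manifold (CARD('n) * CARD('d) - p) S
             \<and> (\<forall>x. dgf_solution E f \<tau>\<^sub>\<alpha> \<tau>\<^sub>\<beta> t\<^sub>0 x \<longrightarrow>
                   ((\<exists>n. ((\<lambda>t. x t $ n) \<longlongrightarrow> xs) at_top) \<longleftrightarrow> x t\<^sub>0 \<in> S))"
proof -
  note C2 = assms(4)
  have "\<forall>n. \<exists>L. L-lipschitz_on UNIV (grad (f n))" using assms(6) by blast
  then obtain L where L: "\<And>n. (L n)-lipschitz_on UNIV (grad (f n))"
    unfolding choice_iff by blast
  \<comment> \<open>The added 1 makes the common Lipschitz constant strictly positive.\<close>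
  define K where "K = Max (range L) + 1"
  have LK: "L n \<le> K" for n
  proof -
    have "L n \<le> Max (range L)" by (rule Max_ge) auto
    then show ?thesis unfolding K_def by linarith
  qed
  have "L undefined \<le> Max (range L)" by (rule Max_ge) auto
  then have K_pos: "0 < K"
    using lipschitz_on_nonneg[OF L[of undefined]] unfolding K_def by linarith
  have grad_lip: "norm (grad (f n) x - grad (f n) y) \<le> K * norm (x - y)" for n x y
    using lipschitz_onD[OF L[of n], of x y] mult_right_mono[OF LK[of n] norm_ge_zero[of "x - y"]]
    by (simp add: dist_norm)
  have "\<exists>m. \<forall>y. m \<le> f n y" for n
    using coercive_bounded_below[OF assms(5)[of n]] C2[of n]
    by (metis C2_def differentiable_imp_continuous_on)
  then have "\<forall>n. \<exists>m. \<forall>y. m \<le> f n y" by blast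
  then obtain m where m: "\<And>n y. m n \<le> f n y"
    unfolding choice_iff by blast
  obtain lam where lam: "0 < lam"
    "\<And>y :: real ^ 'd ^ 'n. (\<And>v. y \<bullet> const v = 0) \<Longrightarrow> lam * (norm y)\<^sup>2 \<le> y \<bullet> laplacian E y"
    using laplacian_spectral_gap[OF assms(3)] by blast
  interpret distributed_flow E f \<tau>\<^sub>\<alpha> \<tau>\<^sub>\<beta> K lam m
    by unfold_locales (fact assms(3) C2 K_pos grad_lip m assms(7) assms(8) assms(9) lam)+
  have F_C2: "C2 F" and gradF: "grad F = (\<lambda>y. \<Sum>n\<in>UNIV. grad (f n) y)"
    and hessF: "hessian F x *v v = (\<Sum>n\<in>UNIV. hessian (f n) x *v v)" for x v
    unfolding F_def using C2_sum[of f, OF C2] by auto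
  have crit: "(\<Sum>n\<in>UNIV. grad (f n) xs) = 0" and inv: "invertible (hessian F xs)"
    using assms(10) unfolding nondegenerate_saddle_def gradF by auto
  obtain V \<mu> where V_subspace: "subspace V" and V_dim: "dim V = num_neg_eigenvalues (hessian F xs)" and \<mu>: "0 < \<mu>"
    and V_inv: "\<And>v. v \<in> V \<Longrightarrow> hessian F xs *v v \<in> V"
    and V_neg: "\<And>v. v \<in> V \<Longrightarrow> v \<bullet> (hessian F xs *v v) \<le> - \<mu> * (norm v)\<^sup>2"
    and V_pos: "\<And>w. \<forall>v\<in>V. w \<bullet> v = 0 \<Longrightarrow> \<mu> * (norm w)\<^sup>2 \<le> w \<bullet> (hessian F xs *v w)"
    by (rule neg_eigenspace_splitting[OF hessian_selfadjoint[OF F_C2] inv]) (rule that)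
  define \<nu> where "\<nu> = \<mu> / real CARD('n)"
  have \<nu>: "0 < \<nu>" "real CARD('n) * \<nu> = \<mu>" using \<mu> by (simp_all add: \<nu>_def)
  obtain P :: "real ^ 'd ^ 'n \<Rightarrow> real ^ 'd ^ 'n" where P: "linear P" "\<And>x. P x \<in> const ` V"
    "\<And>x y. y \<in> const ` V \<Longrightarrow> (x - P x) \<bullet> y = 0"
    using orthogonal_projection[OF linear_subspace_image[OF linear_const V_subspace]] by blast
  define ok where "ok n d \<longleftrightarrow> 0 < d \<and> (\<forall>c x y. norm c \<le> norm xs \<longrightarrow> norm (x - c) \<le> d \<longrightarrow> norm (y - c) \<le> d \<longrightarrow>
    norm (grad (f n) x - grad (f n) y - hessian (f n) c *v (x - y)) \<le> \<nu> / 16 * norm (x - y))" for n d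
  have "\<forall>n. \<exists>d. ok n d"
  proof
    fix n
    have \<nu>16: "0 < \<nu> / 16" using \<nu> by simp
    show "\<exists>d. ok n d"
      unfolding ok_def by (rule C2_grad_approx[OF C2[of n] \<nu>16, of "norm xs"]) blast
  qed
  then obtain d where ok: "\<And>n. ok n (d n)"
    unfolding choice_iff by blast
  define \<delta> where "\<delta> = Min (range d)"
  have \<delta>: "0 < \<delta>" using ok by (simp add: \<delta>_def ok_def)
  have \<delta>_le: "\<delta> \<le> d n" for n by (simp add: \<delta>_def)
  have approx: "norm (grad (f n) (xs + v) - grad (f n) (xs + w) - hessian (f n) xs *v (v - w)) \<le> \<nu> / 16 * norm (v - w)"
    if "norm v \<le> \<delta>" "norm w \<le> \<delta>" for v w n
  proof -
    have "norm (grad (f n) (xs + v) - grad (f n) (xs + w) - hessian (f n) xs *v ((xs + v) - (xs + w)))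
      \<le> \<nu> / 16 * norm ((xs + v) - (xs + w))"
      using ok[of n, unfolded ok_def, THEN conjunct2, rule_format, of xs "xs + v" "xs + w"] that \<delta>_le[of n]
      by simp
    then show ?thesis by simp
  qed
  obtain A where A: "\<And>t. -1 < t \<Longrightarrow> (A has_real_derivative weight \<tau>\<^sub>\<alpha> t) (at t)" "filterlim A at_top at_top"
    using weight_primitive[OF assms(9)] by blast
  \<comment> \<open>The two bounds on \<open>T0\<close>, restated as lower bounds for
    \<open>lam * \<gamma> t\<close>; both hold eventually because \<gamma> tends to
    infinity.\<close>
  define c1 where "c1 = 32 * K\<^sup>2 / \<nu> + 4 * K + 2 * \<nu>"
  define c2 where "c2 = 4 * (norm (gradients (const xs)))\<^sup>2 / (\<nu> / 2 * (\<delta>\<^sup>2 / 20))"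
  have "\<forall>\<^sub>F t in at_top. max c1 c2 / lam \<le> \<gamma> t"
    using \<gamma>_top by (simp add: filterlim_at_top)
  then obtain T' where T': "\<And>t. T' \<le> t \<Longrightarrow> max c1 c2 / lam \<le> \<gamma> t"
    by (auto simp: eventually_at_top_linorder)
  define T0 where "T0 = max T1 T'"
  have T0: "c1 \<le> lam * \<gamma> t" "c2 \<le> lam * \<gamma> t" if "T0 \<le> t" for t
    using T'[of t] that lam(1) by (auto simp: T0_def pos_divide_le_eq mult.commute)
  have T0': "4 * (norm (gradients (const xs)))\<^sup>2 / (lam * \<gamma> t) \<le> \<nu> / 2 * (\<delta>\<^sup>2 / 20)" if "T0 \<le> t" for t
  proof -
    have "0 < \<gamma> t" using that T1(1) by (intro \<gamma>_pos) (auto simp: T0_def)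
    then show ?thesis
      using T0(2)[OF that] \<nu> \<delta> lam(1) unfolding c2_def by (simp add: pos_divide_le_eq mult.commute)
  qed
  interpret saddle_flow E f \<tau>\<^sub>\<alpha> \<tau>\<^sub>\<beta> K lam m xs V P \<nu> \<delta> T0 A
  proof unfold_locales
    show "\<And>v. v \<in> V \<Longrightarrow> (\<Sum>n\<in>UNIV. hessian (f n) xs *v v) \<in> V"
      unfolding hessF[symmetric] by (rule V_inv)
    show "\<And>v. v \<in> V \<Longrightarrow> v \<bullet> (\<Sum>n\<in>UNIV. hessian (f n) xs *v v) \<le> - (real CARD('n) * \<nu>) * (norm v)\<^sup>2"
      unfolding hessF[symmetric] \<nu>(2) by (rule V_neg)
    show "\<And>w. (\<And>v. v \<in> V \<Longrightarrow> w \<bullet> v = 0) \<Longrightarrow>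
      real CARD('n) * \<nu> * (norm w)\<^sup>2 \<le> w \<bullet> (\<Sum>n\<in>UNIV. hessian (f n) xs *v w)"
      unfolding hessF[symmetric] \<nu>(2) by (rule V_pos) blast
    show "\<And>t. T0 \<le> t \<Longrightarrow> 32 * K\<^sup>2 / \<nu> + 4 * K + 2 * \<nu> \<le> lam * \<gamma> t"
      using T0(1) unfolding c1_def .
    show "T1 \<le> T0" by (simp add: T0_def)
    show "\<And>t. 0 \<le> t \<Longrightarrow> (A has_real_derivative weight \<tau>\<^sub>\<alpha> t) (at t)"
      using A(1) by simp
  qed (fact crit V_subspace \<nu>(1) linear_add[OF P(1)] linear_scale[OF P(1)] P(2,3) \<delta> approx A(2) T0')+
  have "\<exists>S. graph_manifold (CARD('n) * CARD('d) - p) S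
      \<and> (\<forall>x. dgf_solution E f \<tau>\<^sub>\<alpha> \<tau>\<^sub>\<beta> t\<^sub>0 x \<longrightarrow>
        ((\<exists>n. ((\<lambda>t. x t $ n) \<longlongrightarrow> xs) at_top) \<longleftrightarrow> x t\<^sub>0 \<in> S))" if t0: "T0 \<le> t\<^sub>0" for t\<^sub>0
  proof (intro exI[of _ "stable_set t\<^sub>0"] conjI allI impI)
    have t0': "0 \<le> t\<^sub>0" using t0 T0_nonneg by simp
    have "stable_set t\<^sub>0 \<noteq> {}"
      using stable_point_near[OF t0] unfolding stable_set_def by blast
    then show "graph_manifold (CARD('n) * CARD('d) - p) (stable_set t\<^sub>0)"
      unfolding graph_manifold_def p_def V_dim[symmetric] using stable_set_graph_manifold[OF t0'] by blast
    fix x assume x: "dgf_solution E f \<tau>\<^sub>\<alpha> \<tau>\<^sub>\<beta> t\<^sub>0 x"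
    have ev: "\<forall>\<^sub>F t in at_top. flow t\<^sub>0 t (x t\<^sub>0) = x t"
      using eventually_ge_at_top[of t\<^sub>0] by eventually_elim (rule dgf_solution_flow[OF x t0', symmetric])
    have "((\<lambda>t. x t $ n) \<longlongrightarrow> xs) at_top \<longleftrightarrow> ((\<lambda>t. flow t\<^sub>0 t (x t\<^sub>0) $ n) \<longlongrightarrow> xs) at_top" for n
      by (rule filterlim_cong[OF refl refl]) (use ev in eventually_elim, simp)
    \<comment> \<open>Convergence of a single node suffices because the disagreement vanishes along
      every solution.\<close>
    moreover have "(\<exists>n. ((\<lambda>t. flow t\<^sub>0 t (x t\<^sub>0) $ n) \<longlongrightarrow> xs) at_top) \<longleftrightarrow> x t\<^sub>0 \<in> stable_set t\<^sub>0"
    proof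
      assume "\<exists>n. ((\<lambda>t. flow t\<^sub>0 t (x t\<^sub>0) $ n) \<longlongrightarrow> xs) at_top"
      then show "x t\<^sub>0 \<in> stable_set t\<^sub>0"
        unfolding stable_set_def using flow_tendsto_const by blast
    next
      assume "x t\<^sub>0 \<in> stable_set t\<^sub>0"
      then have "((\<lambda>t. flow t\<^sub>0 t (x t\<^sub>0)) \<longlongrightarrow> X0) at_top" by (simp add: stable_set_def)
      \<comment> \<open>Any node serves as a witness; \<open>undefined\<close> is just some
        index.\<close>
      from tendsto_vec_nth[OF this, of undefined]
      show "\<exists>n. ((\<lambda>t. flow t\<^sub>0 t (x t\<^sub>0) $ n) \<longlongrightarrow> xs) at_top" by auto
    qed
    ultimately show "(\<exists>n. ((\<lambda>t. x t $ n) \<longlongrightarrow> xs) at_top) \<longleftrightarrow> x t\<^sub>0 \<in> stable_set t\<^sub>0" by simp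
  qed
  then show ?thesis
    by (rule eventually_mono[OF eventually_ge_at_top[of T0]])
qed

end
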